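(* Let $n\ge2$ and let $Q$ be the affine quiver of type $\widetilde{A}_{2n-1,1}$, with $X_?$, $X_\delta$ and $N_{2n}(l)$ as in the context. Then: (1) $X_{I_{2n}[-1]}X_\delta=q^{\frac12}X_{I_{2n-1}}+q^{-\frac12}X_{I_1[-1]}$; (2) $X_{I_{2n-1}}X_\delta=q^{\frac12}X_{N_{2n}(1)}+q^{-\frac12}X_{I_{2n}[-1]}$; (3) $X_{N_{2n}(l)}X_\delta=q^{\frac12}X_{N_{2n}(l+1)}+q^{-\frac12}X_{N_{2n}(l-1)}$ for $l\ge1$.
   Context: Fix $n\ge2$. $\Lambda$ is the skew-symmetric $2n\times 2n$ integer matrix with $\Lambda_{ij}=1$ for $i<j$ with $j-i$ odd and $\Lambda_{ij}=0$ for $i<j$ with $j-i$ even; write $\Lambda(\mathbf e,\mathbf f)=\mathbf e^{tr}\Lambda\mathbf f$. $B=(b_{ij})$ is the skew-symmetric $2n\times2n$ matrix with $b_{i,i+1}=1$ ($1\le i\le 2n-1$), $b_{1,2n}=1$, and all other entries above the diagonal $0$. $\mathbb F$ is a finite field with $q$ elements. The quantum torus is the $\mathbb Z[q^{\pm\frac12}]$-algebra with basis $\{X^{\mathbf e}:\mathbf e\in\mathbb Z^{2n}\}$ and product $X^{\mathbf e}X^{\mathbf f}=q^{\Lambda(\mathbf e,\mathbf f)/2}X^{\mathbf e+\mathbf f}$; put $X_i=X^{\mathbf e_i}$. The identities are identities in the torus. $Q$ is the quiver with vertices $1,\dots,2n$ and arrows $i\to i+1$ ($1\le i\le 2n-1$)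 and $1\to 2n$. Let $k$ be the degree-$2$ extension of $\mathbb F$. Representations are finite-dimensional representations of $Q$ over $k$; $\mathbf{dim}$ is the dimension vector over $k$; $P_i,I_i$ are the projective and injective representations at vertex $i$. $R=(r_{ij})$ with $r_{ij}$ the number of arrows $j\to i$. The Euler form is $\langle \mathbf v,\mathbf w\rangle=2\mathbf v^{tr}(\mathbf I-R^{tr})\mathbf w$. In the cluster category $\mathcal C_Q$ of $Q$ over $k$ (shift $[1]$) each object is uniquely $V\oplus P[1]$ with $V$ a representation and $P$ a projective representation, and $I_i[-1]\cong P_i[1]$. For $V$ a representation with $\mathbf v=\mathbf{dim}\,V$ and $P$ projective, $$X_{V\oplus P[1]}=\sum_{\mathbf e}|\mathrm{Gr}_{\mathbf e}V|\,q^{-\frac12\langle\mathbf e,\mathbf v-\mathbf e\rangle}X^{-B\mathbf e-(\mathbf I-R^{tr})\mathbf v+\mathbf t_P},\qquad \mathbf t_P=\mathbf{dim}(P/\mathrm{rad}P),$$ where $\mathrm{Gr}_{\mathbf e}V$ is the set of subrepresentations of $V$ of dimension vector $\mathbf e$. In particular $X_{I_i[-1]}=X_{P_i[1]}=X_i$. $\delta=(1,\dots,1)$. For $\lambda\in k$, $E(\lambda)$ is the representation with $k$ at each vertex, identity maps on the arrows $i\to i+1$ and multiplication by $\lambda$ on $1\to 2n$; $X_\delta:=X_{E(\lambda)}$ (independent of $\lambda$). For $l\ge0$, $N_{2n}(l)$ is the indecomposable preinjective representation with $\mathbf{dim}\,N_{2n}(l)=\mathbf{dim}\,I_{2n-1}+l\delta$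 (so $N_{2n}(0)=I_{2n-1}$). *)

theory Defs
  imports
    Complex_Main
    "HOL-Library.Poly_Mapping"
    "HOL-Library.Function_Algebras"
    "HOL-Library.FuncSet"
    "HOL-Library.Cardinality"
begin

section \<open>The quiver and its matrices\<close>

text \<open>
  The vertices are \<open>1, \<dots>, 2n\<close>. A vector indexed by the vertices is a function on \<open>nat\<close> that is
  zero outside of \<open>verts n\<close>; a matrix is a function of a row and a column index, of which only the
  entries with both indices in \<open>verts n\<close> matter.
\<close>

definition verts :: "nat \<Rightarrow> nat set" where
  "verts n = {1..2 * n}"

text \<open>For \<open>n \<ge> 2\<close> there are no parallel arrows, so an arrow is given by its source and target.\<close>

definition arrows :: "nat \<Rightarrow> (nat \<times> nat) set" where
  "arrows n = {(i, i + 1) | i. 1 \<le> i \<and> i \<le> 2 * n - 1} \<union> {(1, 2 * n)}"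

type_synonym ivec = "nat \<Rightarrow> int"
type_synonym imat = "nat \<Rightarrow> nat \<Rightarrow> int"

definition mat_vec :: "nat \<Rightarrow> imat \<Rightarrow> ivec \<Rightarrow> ivec" where
  "mat_vec n M v = (\<lambda>i. if i \<in> verts n then \<Sum>j\<in>verts n. M i j * v j else 0)"

definition bilin :: "nat \<Rightarrow> imat \<Rightarrow> ivec \<Rightarrow> ivec \<Rightarrow> int" where
  "bilin n M v w = (\<Sum>i\<in>verts n. v i * mat_vec n M w i)"

definition skew :: "imat \<Rightarrow> imat" where
  \<comment> \<open>the skew-symmetric matrix with the same entries above the diagonal\<close>
  "skew U = (\<lambda>i j. if i < j then U i j else if j < i then - U j i else 0)"

definition Lam :: imat where
  "Lam = skew (\<lambda>i j. of_bool (odd (j - i)))"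

definition Bmat :: "nat \<Rightarrow> imat" where
  "Bmat n = skew (\<lambda>i j. of_bool (j = i + 1 \<or> i = 1 \<and> j = 2 * n))"

definition Rmat :: "nat \<Rightarrow> imat" where
  "Rmat n = (\<lambda>i j. of_bool ((j, i) \<in> arrows n))"

definition I_minus_Rtr :: "nat \<Rightarrow> imat" where
  "I_minus_Rtr n = (\<lambda>i j. of_bool (i = j) - Rmat n j i)"

definition euler :: "nat \<Rightarrow> ivec \<Rightarrow> ivec \<Rightarrow> int" where
  "euler n v w = 2 * bilin n (I_minus_Rtr n) v w"

definition delta :: "nat \<Rightarrow> ivec" where
  "delta n = (\<lambda>i. of_bool (i \<in> verts n))"


section \<open>The quantum torus\<close>

text \<open>
  An element is the finitely supported family of its coefficients in the basis \<open>X\<^sup>e\<close>.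
  The coefficient ring \<open>\<int>[q\<^sup>1\<^sup>/\<^sup>2, q\<^sup>-\<^sup>1\<^sup>/\<^sup>2]\<close> is viewed as a subring of the reals; since the \<open>X\<^sup>e\<close>
  form a basis, the torus is a subring of the one with real coefficients, and equality of its
  elements may be expressed there. The product is \<open>qt_mult\<close>; the (untwisted) instance of \<open>(*)\<close> on
  \<open>\<Rightarrow>\<^sub>0\<close> is not used.
\<close>

type_synonym qtorus = "ivec \<Rightarrow>\<^sub>0 real"

definition qt_mult :: "nat \<Rightarrow> nat \<Rightarrow> qtorus \<Rightarrow> qtorus \<Rightarrow> qtorus" where
  "qt_mult n q x y =
     (\<Sum>e\<in>Poly_Mapping.keys x. \<Sum>f\<in>Poly_Mapping.keys y.
        Poly_Mapping.single (e + f)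
          (real q powr (real_of_int (bilin n Lam e f) / 2)
             * (Poly_Mapping.lookup x e * Poly_Mapping.lookup y f)))"

definition qt_scale :: "real \<Rightarrow> qtorus \<Rightarrow> qtorus" where
  "qt_scale c x = Poly_Mapping.map (\<lambda>a. c * a) x"


section \<open>Representations\<close>

text \<open>
  Every vector space over \<open>'k\<close> is isomorphic to a subspace of some \<open>'b \<Rightarrow> 'k\<close>, and every
  finite-dimensional one to a subspace of \<open>nat \<Rightarrow> 'k\<close>; every linear map between subspaces is the
  restriction of a linear map between the ambient spaces. Hence a representation is a family of
  finite-dimensional subspaces of \<open>'b \<Rightarrow> 'k\<close> with linear maps of the ambient space that restrict
  to the given subspaces.
\<close>

definition fscale :: "'k::field \<Rightarrow> ('b \<Rightarrow> 'k) \<Rightarrow> ('b \<Rightarrow> 'k)" where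
  "fscale c f = (\<lambda>x. c * f x)"

global_interpretation fn: vector_space "fscale :: 'k::field \<Rightarrow> ('b \<Rightarrow> 'k) \<Rightarrow> ('b \<Rightarrow> 'k)"
  by standard (auto simp: fscale_def fun_eq_iff algebra_simps)

record ('b, 'k) qrep =
  sp :: "nat \<Rightarrow> ('b \<Rightarrow> 'k) set"
  mp :: "nat \<times> nat \<Rightarrow> ('b \<Rightarrow> 'k) \<Rightarrow> ('b \<Rightarrow> 'k)"

definition is_rep :: "nat \<Rightarrow> ('b, 'k::field) qrep \<Rightarrow> bool" where
  "is_rep n V \<longleftrightarrow>
     (\<forall>i\<in>verts n. \<exists>A. finite A \<and> sp V i = fn.span A) \<and>
     (\<forall>(i, j)\<in>arrows n. Vector_Spaces.linear fscale fscale (mp V (i, j)) \<and>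
        mp V (i, j) ` sp V i \<subseteq> sp V j)"

definition dim_family :: "nat \<Rightarrow> (nat \<Rightarrow> ('b \<Rightarrow> 'k::field) set) \<Rightarrow> ivec" where
  "dim_family n U = (\<lambda>i. if i \<in> verts n then int (fn.dim (U i)) else 0)"

definition dimvec :: "nat \<Rightarrow> ('b, 'k::field) qrep \<Rightarrow> ivec" where
  "dimvec n V = dim_family n (sp V)"

definition subreps :: "nat \<Rightarrow> ('b, 'k::field) qrep \<Rightarrow> (nat \<Rightarrow> ('b \<Rightarrow> 'k) set) set" where
  "subreps n V =
     {U \<in> (\<Pi>\<^sub>E i\<in>verts n. {W. fn.subspace W \<and> W \<subseteq> sp V i}).
        \<forall>(i, j)\<in>arrows n. mp V (i, j) ` U i \<subseteq> U j}"

definition Gr :: "nat \<Rightarrow> ('b, 'k::field) qrep \<Rightarrow> ivec \<Rightarrow> (nat \<Rightarrow> ('b \<Rightarrow> 'k) set) set" where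
  "Gr n V e = {U \<in> subreps n V. dim_family n U = e}"

definition is_hom ::
  "nat \<Rightarrow> ('b, 'k::field) qrep \<Rightarrow> ('c, 'k) qrep \<Rightarrow> (nat \<Rightarrow> ('b \<Rightarrow> 'k) \<Rightarrow> ('c \<Rightarrow> 'k)) \<Rightarrow> bool" where
  "is_hom n V W h \<longleftrightarrow>
     (\<forall>i\<in>verts n. Vector_Spaces.linear fscale fscale (h i) \<and> h i ` sp V i \<subseteq> sp W i) \<and>
     (\<forall>(i, j)\<in>arrows n. \<forall>x\<in>sp V i. h j (mp V (i, j) x) = mp W (i, j) (h i x))"

definition isomorphic :: "nat \<Rightarrow> ('b, 'k::field) qrep \<Rightarrow> ('c, 'k) qrep \<Rightarrow> bool" where
  "isomorphic n V W \<longleftrightarrow>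
     (\<exists>h. is_hom n V W h \<and> (\<forall>i\<in>verts n. bij_betw (h i) (sp V i) (sp W i)))"

definition indecomposable :: "nat \<Rightarrow> ('b, 'k::field) qrep \<Rightarrow> bool" where
  "indecomposable n V \<longleftrightarrow>
     (\<exists>i\<in>verts n. sp V i \<noteq> {0}) \<and>
     (\<forall>U\<in>subreps n V. \<forall>W\<in>subreps n V.
        (\<forall>i\<in>verts n. U i \<inter> W i = {0} \<and> {u + w | u w. u \<in> U i \<and> w \<in> W i} = sp V i) \<longrightarrow>
        (\<forall>i\<in>verts n. U i = {0}) \<or> (\<forall>i\<in>verts n. W i = {0}))"


subsection \<open>Projective and injective representations\<close>

text \<open>A path is the nonempty list of the vertices it visits; \<open>[i]\<close> is the trivial path at \<open>i\<close>.\<close>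

definition paths :: "nat \<Rightarrow> nat \<Rightarrow> nat \<Rightarrow> nat list set" where
  "paths n i j = {p. p \<noteq> [] \<and> set p \<subseteq> verts n \<and> hd p = i \<and> last p = j \<and>
     successively (\<lambda>a b. (a, b) \<in> arrows n) p}"

text \<open>
  \<open>P\<^sub>i\<close> has at \<open>j\<close> the space with basis the paths from \<open>i\<close> to \<open>j\<close>, and an arrow \<open>j \<rightarrow> j'\<close>
  prolongs paths. \<open>I\<^sub>i\<close> has at \<open>j\<close> the dual of the space with basis the paths from \<open>j\<close> to \<open>i\<close>,
  and an arrow \<open>j \<rightarrow> j'\<close> acts by the transpose of prepending it to paths.
\<close>

definition proj_rep :: "nat \<Rightarrow> nat \<Rightarrow> (nat list, 'k::field) qrep" where
  "proj_rep n i =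
     \<lparr>sp = (\<lambda>j. {f. \<forall>p. f p \<noteq> 0 \<longrightarrow> p \<in> paths n i j}),
      mp = (\<lambda>(j, j') f p.
              if p \<noteq> [] \<and> last p = j' \<and> butlast p \<in> paths n i j then f (butlast p) else 0)\<rparr>"

definition inj_rep :: "nat \<Rightarrow> nat \<Rightarrow> (nat list, 'k::field) qrep" where
  "inj_rep n i =
     \<lparr>sp = (\<lambda>j. {f. \<forall>p. f p \<noteq> 0 \<longrightarrow> p \<in> paths n j i}),
      mp = (\<lambda>(j, j') f p. if p \<in> paths n j' i then f (j # p) else 0)\<rparr>"

definition zero_rep :: "(unit, 'k::field) qrep" where
  "zero_rep = \<lparr>sp = (\<lambda>_. {0}), mp = (\<lambda>_ _. 0)\<rparr>"

definition maximal_subrep ::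
  "nat \<Rightarrow> ('b, 'k::field) qrep \<Rightarrow> (nat \<Rightarrow> ('b \<Rightarrow> 'k) set) \<Rightarrow> bool" where
  "maximal_subrep n V U \<longleftrightarrow>
     U \<in> subreps n V \<and> (\<exists>i\<in>verts n. U i \<noteq> sp V i) \<and>
     (\<forall>W\<in>subreps n V. (\<forall>i\<in>verts n. U i \<subseteq> W i) \<longrightarrow>
        (\<forall>i\<in>verts n. W i = U i) \<or> (\<forall>i\<in>verts n. W i = sp V i))"

definition rad :: "nat \<Rightarrow> ('b, 'k::field) qrep \<Rightarrow> nat \<Rightarrow> ('b \<Rightarrow> 'k) set" where
  "rad n V = (\<lambda>i. {x \<in> sp V i. \<forall>U. maximal_subrep n V U \<longrightarrow> x \<in> U i})"

definition dim_top :: "nat \<Rightarrow> ('b, 'k::field) qrep \<Rightarrow> ivec" where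
  \<comment> \<open>the dimension vector of \<open>V / rad V\<close>\<close>
  "dim_top n V = dimvec n V - dim_family n (rad n V)"


subsection \<open>Preinjective representations\<close>

definition short_exact ::
  "nat \<Rightarrow> ('b, 'k::field) qrep \<Rightarrow> (nat \<Rightarrow> ('b \<Rightarrow> 'k) \<Rightarrow> ('c \<Rightarrow> 'k)) \<Rightarrow>
   ('c, 'k) qrep \<Rightarrow> (nat \<Rightarrow> ('c \<Rightarrow> 'k) \<Rightarrow> ('d \<Rightarrow> 'k)) \<Rightarrow> ('d, 'k) qrep \<Rightarrow> bool" where
  "short_exact n L f M g N \<longleftrightarrow>
     is_hom n L M f \<and> is_hom n M N g \<and>
     (\<forall>i\<in>verts n. inj_on (f i) (sp L i) \<and> g i ` sp M i = sp N i \<and>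
        f i ` sp L i = {x \<in> sp M i. g i x = 0})"

definition split_epi ::
  "nat \<Rightarrow> ('b, 'k::field) qrep \<Rightarrow> ('c, 'k) qrep \<Rightarrow> (nat \<Rightarrow> ('b \<Rightarrow> 'k) \<Rightarrow> ('c \<Rightarrow> 'k)) \<Rightarrow> bool" where
  "split_epi n Z N h \<longleftrightarrow> (\<exists>s. is_hom n N Z s \<and> (\<forall>i\<in>verts n. \<forall>x\<in>sp N i. h i (s i x) = x))"

text \<open>
  Almost split sequences \<open>0 \<rightarrow> L \<rightarrow> M \<rightarrow> N \<rightarrow> 0\<close>; such a sequence exhibits \<open>L\<close> as the
  Auslander--Reiten translate of \<open>N\<close>. The test representations \<open>Z\<close> live in \<open>nat \<Rightarrow> 'k\<close>, where
  every finite-dimensional representation occurs up to isomorphism.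
\<close>

definition almost_split ::
  "nat \<Rightarrow> (nat, 'k::field) qrep \<Rightarrow> (nat, 'k) qrep \<Rightarrow> (nat, 'k) qrep \<Rightarrow> bool" where
  "almost_split n L M N \<longleftrightarrow>
     is_rep n L \<and> is_rep n M \<and> is_rep n N \<and> indecomposable n L \<and> indecomposable n N \<and>
     (\<exists>f g. short_exact n L f M g N \<and> \<not> split_epi n M N g \<and>
        (\<forall>(Z :: (nat, 'k) qrep) h. is_rep n Z \<and> is_hom n Z N h \<and> \<not> split_epi n Z N h \<longrightarrow>
           (\<exists>t. is_hom n Z M t \<and> (\<forall>i\<in>verts n. \<forall>x\<in>sp Z i. g i (t i x) = h i x))))"

text \<open>The indecomposable preinjective representations are the iterated translates of the \<open>I\<^sub>i\<close>.\<close>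

inductive indec_preinjective :: "nat \<Rightarrow> (nat, 'k::field) qrep \<Rightarrow> bool" for n where
  injective: "is_rep n V \<Longrightarrow> i \<in> verts n \<Longrightarrow> isomorphic n V (inj_rep n i :: (nat list, 'k) qrep)
    \<Longrightarrow> indec_preinjective n V"
| translate: "indec_preinjective n N \<Longrightarrow> almost_split n L M N \<Longrightarrow> indec_preinjective n L"

definition is_N2n :: "nat \<Rightarrow> nat \<Rightarrow> (nat, 'k::field) qrep \<Rightarrow> bool" where
  "is_N2n n l N \<longleftrightarrow>
     is_rep n N \<and> indecomposable n N \<and> indec_preinjective n N \<and>
     dimvec n N =
       (\<lambda>i. dimvec n (inj_rep n (2 * n - 1) :: (nat list, 'k) qrep) i + int l * delta n i)"

definition E_rep :: "nat \<Rightarrow> 'k::field \<Rightarrow> (unit, 'k) qrep" where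
  "E_rep n c =
     \<lparr>sp = (\<lambda>_. UNIV), mp = (\<lambda>a. if a = (1, 2 * n) then fscale c else id)\<rparr>"


section \<open>The quantum cluster characters\<close>

text \<open>
  An object \<open>V \<oplus> P[1]\<close> of the cluster category is given by the two representations \<open>V\<close> and \<open>P\<close>.
  The sum runs over the box \<open>0 \<le> e \<le> dim V\<close> (pointwise order), outside of which \<open>Gr\<^sub>e V\<close> is empty.
\<close>

definition cluster_char ::
  "nat \<Rightarrow> nat \<Rightarrow> ('b, 'k::field) qrep \<Rightarrow> ('c, 'k) qrep \<Rightarrow> qtorus" where
  "cluster_char n q V P =
     (let v = dimvec n V in
      \<Sum>e\<in>{0..v}.
        Poly_Mapping.single
          (- mat_vec n (Bmat n) e - mat_vec n (I_minus_Rtr n) v + dim_top n P)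
          (real (card (Gr n V e)) * real q powr (- real_of_int (euler n e (v - e)) / 2)))"

definition X_rep :: "nat \<Rightarrow> nat \<Rightarrow> ('b, 'k::field) qrep \<Rightarrow> qtorus" where
  "X_rep n q V = cluster_char n q V (zero_rep :: (unit, 'k) qrep)"

definition X_shift :: "nat \<Rightarrow> nat \<Rightarrow> ('c, 'k::field) qrep \<Rightarrow> qtorus" where
  \<comment> \<open>the character of \<open>P[1]\<close>; as \<open>I\<^sub>i[-1] \<cong> P\<^sub>i[1]\<close>, that of \<open>I\<^sub>i[-1]\<close> is the one of \<open>P\<^sub>i[1]\<close>\<close>
  "X_shift n q P = cluster_char n q (zero_rep :: (unit, 'k) qrep) P"


section \<open>Quadratic extensions\<close>

definition degree2_extension :: "('f::field \<Rightarrow> 'k::field) \<Rightarrow> bool" where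
  "degree2_extension \<iota> \<longleftrightarrow>
     \<iota> 1 = 1 \<and> (\<forall>a b. \<iota> (a + b) = \<iota> a + \<iota> b) \<and> (\<forall>a b. \<iota> (a * b) = \<iota> a * \<iota> b) \<and>
     vector_space.dim (\<lambda>a x. \<iota> a * x) (UNIV :: 'k set) = 2"

end

theory Submission
  imports Defs
begin

text \<open>
  The counts of subrepresentations of \<open>N\<^sub>2\<^sub>n(l)\<close> satisfy a three-term recursion. A submodule \<open>U\<close> of
  \<open>N\<^sub>2\<^sub>n(l + 1)\<close> induces submodules of \<open>E(0)\<close> and \<open>N\<^sub>2\<^sub>n(l)\<close> along \<open>0 \<rightarrow> E(0) \<rightarrow> N\<^sub>2\<^sub>n(l + 1) \<rightarrow> N\<^sub>2\<^sub>n(l) \<rightarrow> 0\<close>.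
  The number of \<open>U\<close> over a pair of submodules is a power of \<open>card k = q\<^sup>2\<close>, which agrees with the
  power of \<open>q\<close> in the product of the two terms in the quantum torus, with one exception: nothing lies over
  a pair \<open>(0, W)\<close> if \<open>W\<close> contains the canonical copy of \<open>E(0)\<close> in \<open>N\<^sub>2\<^sub>n(l)\<close>. These \<open>W\<close> are the submodules
  of the quotient \<open>N\<^sub>2\<^sub>n(l - 1)\<close>, and their terms make up the second summand.

  That an indecomposable representation with the dimension vector of \<open>N\<^sub>2\<^sub>n(l)\<close> is isomorphic to the
  standard one follows by repeated reflection at the source, which reduces it to the simple
  representation at the vertex \<open>1\<close>.
\<close>

section \<open>Subspaces over a finite field\<close>

text \<open>Let \<open>W\<close> be a submodule of \<open>model n l\<close> and T the submodule of
  E(0) supported at the vertices after \<open>k\<close>. The lifts of the pair (T, W), if there are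
  any, form a torsor under Hom(W, E(0)/T). For 0 < k < 2n the quotient E(0)/T is the injective
  module I_k; hence lifts exist, and they are counted by the functionals on the space of
  \<open>W\<close> at \<open>k\<close>. For k = 2n the quotient is E(0) itself, which is not
  injective: this is the origin of the exceptional pairs. In the torus, the product of two terms
  produces q raised to twice the Euler pairing of the same two dimension vectors, up to the overall
  factor q^(1/2).

  The representations of the statement are known only through indecomposability, preinjectivity and
  a dimension vector, whereas the count needs explicit maps. The models provide these maps, and the
  classification carries the result over. Since the field is finite, dimensions are compared through
  cardinalities.\<close>

lemma (in vector_space) card_span_independent:
  assumes "finite (UNIV :: 'a set)" and B: "finite B" "independent B"
  shows "finite (span B)" and "card (span B) = CARD('a) ^ card B"
proof -
  have bij: "bij_betw (\<lambda>g. \<Sum>b\<in>B. g b *s b) (B \<rightarrow>\<^sub>E UNIV) (span B)"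
    unfolding bij_betw_def
  proof
    show "inj_on (\<lambda>g. \<Sum>b\<in>B. g b *s b) (B \<rightarrow>\<^sub>E UNIV)"
    proof (rule inj_onI)
      fix g h assume gh: "g \<in> B \<rightarrow>\<^sub>E UNIV" "h \<in> B \<rightarrow>\<^sub>E UNIV" "(\<Sum>b\<in>B. g b *s b) = (\<Sum>b\<in>B. h b *s b)"
      have "(\<Sum>b\<in>B. (g b - h b) *s b) = 0"
        using gh(3) by (simp add: scale_left_diff_distrib sum_subtractf)
      then have "g b - h b = 0" if "b \<in> B" for b
        using independentD[OF B(2,1) subset_refl, of "\<lambda>b. g b - h b" b] that by blast
      then show "g = h" using gh(1,2) by (intro PiE_ext) auto
    qed
    show "(\<lambda>g. \<Sum>b\<in>B. g b *s b) ` (B \<rightarrow>\<^sub>E UNIV) = span B"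
    proof
      show "(\<lambda>g. \<Sum>b\<in>B. g b *s b) ` (B \<rightarrow>\<^sub>E UNIV) \<subseteq> span B"
        by (intro image_subsetI span_sum span_scale span_base)
      show "span B \<subseteq> (\<lambda>g. \<Sum>b\<in>B. g b *s b) ` (B \<rightarrow>\<^sub>E UNIV)"
      proof
        fix x assume "x \<in> span B"
        then obtain u where "x = (\<Sum>b\<in>B. u b *s b)" using span_finite[OF B(1)] by auto
        then have "x = (\<Sum>b\<in>B. restrict u B b *s b)" by simp
        then show "x \<in> (\<lambda>g. \<Sum>b\<in>B. g b *s b) ` (B \<rightarrow>\<^sub>E UNIV)"
          by (intro image_eqI[of _ _ "restrict u B"]) auto
      qed
    qed
  qed
  have "card (B \<rightarrow>\<^sub>E (UNIV :: 'a set)) = CARD('a) ^ card B"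
    using B(1) by (simp add: card_PiE)
  then show "card (span B) = CARD('a) ^ card B"
    using bij_betw_same_card[OF bij] by simp
  have "finite (B \<rightarrow>\<^sub>E (UNIV :: 'a set))"
    using assms by (intro finite_PiE) auto
  then show "finite (span B)"
    using bij_betw_finite[OF bij] by simp
qed

text \<open>Over a finite field a dimension can be read off from a cardinality, so bijections and
  exact sequences may be exploited by counting.\<close>

lemma (in vector_space) card_subspace:
  assumes "finite (UNIV :: 'a set)" "finite W" "subspace W"
  shows "card W = CARD('a) ^ dim W"
proof -
  obtain B where B: "B \<subseteq> W" "independent B" "W \<subseteq> span B" "card B = dim W"
    using basis_exists by blast
  have "span B = W" using B assms(3) span_minimal by blast
  then show ?thesis using card_span_independent(2)[OF assms(1) _ B(2)] B finite_subset[OF B(1) assms(2)]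
    by simp
qed

lemma (in vector_space) finite_span:
  assumes "finite (UNIV :: 'a set)" "finite A"
  shows "finite (span A)"
proof -
  obtain B where B: "B \<subseteq> A" "independent B" "A \<subseteq> span B"
    using maximal_independent_subset by blast
  then have "span A = span B" using span_mono span_minimal subspace_span by (metis subset_antisym)
  then show ?thesis using card_span_independent(1)[OF assms(1) _ B(2)] finite_subset[OF B(1) assms(2)]
    by simp
qed

text \<open>Powers of \<open>CARD('k)\<close> thereby become even powers of \<open>q\<close>, which
  is what matches the factor 2 in \<open>euler\<close>.\<close>

lemma degree2_extension_card:
  fixes \<iota> :: "'f::{field, finite} \<Rightarrow> 'k::field"
  assumes "degree2_extension \<iota>"
  shows "finite (UNIV :: 'k set)" and "CARD('k) = CARD('f) ^ 2"
proof -
  have h: "\<iota> 1 = 1" "\<iota> (a + b) = \<iota> a + \<iota> b" "\<iota> (a * b) = \<iota> a * \<iota> b" for a b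
    using assms by (auto simp: degree2_extension_def)
  interpret vs: vector_space "\<lambda>a x. \<iota> a * x"
    by standard (auto simp: h algebra_simps)
  have dim: "vs.dim UNIV = 2" using assms by (simp add: degree2_extension_def)
  obtain B where B: "vs.independent B" "UNIV \<subseteq> vs.span B" "card B = 2"
    using vs.basis_exists[of UNIV] dim by metis
  have "finite B" using B(3) card.infinite by fastforce
  moreover have "vs.span B = UNIV" using B(2) by auto
  ultimately show "finite (UNIV :: 'k set)" "CARD('k) = CARD('f) ^ 2"
    using vs.card_span_independent[of B] B by auto
qed

text \<open>For \<open>e \<in> S\<close> these are the hyperplanes of \<open>S\<close> through
  \<open>T\<close> that avoid \<open>e\<close>, that is, the kernels of the functionals on
  \<open>S\<close> that vanish on \<open>T\<close> and take the value 1 at \<open>e\<close>.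
  Functionals are thus encoded without dual spaces.\<close>

definition complements :: "('b \<Rightarrow> 'k::field) \<Rightarrow> ('b \<Rightarrow> 'k) set \<Rightarrow> ('b \<Rightarrow> 'k) set \<Rightarrow> ('b \<Rightarrow> 'k) set set" where
  "complements e T S = {U. fn.subspace U \<and> T \<subseteq> U \<and> U \<subseteq> S \<and> e \<notin> U \<and>
     (\<forall>s\<in>S. \<exists>c. s - fscale c e \<in> U)}"

lemma card_gt_one_field: "finite (UNIV :: 'k::field set) \<Longrightarrow> CARD('k) > 1"
  using card_mono[of UNIV "{0, 1 :: 'k}"] by simp

lemma subspace_scale_iff:
  assumes "fn.subspace U" "c \<noteq> 0"
  shows "fscale c e \<in> U \<longleftrightarrow> e \<in> U"
proof
  assume "fscale c e \<in> U"
  then have "fscale (inverse c) (fscale c e) \<in> U" using assms(1) fn.subspace_scale by blast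
  then show "e \<in> U" using assms(2) by simp
qed (use assms fn.subspace_scale in blast)

lemma add_line_eq:
  "fn.subspace T \<Longrightarrow> fn.span (insert b T) = {x. \<exists>c. x - fscale c b \<in> T}"
  by (simp add: fn.span_insert fn.span_eq_iff[THEN iffD2])

lemma card_add_line:
  fixes T :: "('b \<Rightarrow> 'k::field) set"
  assumes fin: "finite (UNIV :: 'k set)" and T: "fn.subspace T" "finite T" and "b \<notin> T"
  shows "finite (fn.span (insert b T))" "card (fn.span (insert b T)) = CARD('k) * card T"
proof -
  have bij: "bij_betw (\<lambda>(c, x). x + fscale c b) (UNIV \<times> T) (fn.span (insert b T))"
    unfolding bij_betw_def
  proof
    show "inj_on (\<lambda>(c, x). x + fscale c b) (UNIV \<times> T)"
    proof (rule inj_onI, clarify)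
      fix c x d y assume xy: "x \<in> T" "y \<in> T" "x + fscale c b = y + fscale d b"
      then have "fscale (c - d) b = y - x"
        by (simp add: fn.scale_left_diff_distrib algebra_simps)
      then have "fscale (c - d) b \<in> T" using xy T fn.subspace_diff by metis
      then have "c = d" using subspace_scale_iff[OF T(1)] \<open>b \<notin> T\<close> by (metis right_minus_eq)
      then show "c = d \<and> x = y" using xy by simp
    qed
    show "(\<lambda>(c, x). x + fscale c b) ` (UNIV \<times> T) = fn.span (insert b T)"
      unfolding add_line_eq[OF T(1)]
    proof (intro equalityI subsetI)
      fix x assume "x \<in> {x. \<exists>c. x - fscale c b \<in> T}"
      then obtain c where "x - fscale c b \<in> T" by blast
      then show "x \<in> (\<lambda>(c, x). x + fscale c b) ` (UNIV \<times> T)"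
        by (intro image_eqI[of _ _ "(c, x - fscale c b)"]) auto
    next
      fix x assume "x \<in> (\<lambda>(c, x). x + fscale c b) ` (UNIV \<times> T)"
      then obtain c y where "x = y + fscale c b" "y \<in> T" by auto
      then show "x \<in> {x. \<exists>c. x - fscale c b \<in> T}" by (auto intro!: exI[of _ c])
    qed
  qed
  then show "finite (fn.span (insert b T))" "card (fn.span (insert b T)) = CARD('k) * card T"
    using bij_betw_same_card[OF bij] bij_betw_finite[OF bij] fin T(2)
    by (auto simp: card_cartesian_product)
qed

text \<open>
  Induction on the codimension of \<open>T\<close>: for \<open>b\<close> in \<open>S\<close> outside of \<open>T + \<langle>e\<rangle>\<close>, a complement contains exactly
  one of the vectors \<open>b + c e\<close>, so the complements are distributed evenly over the scalars \<open>c\<close>.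
\<close>

lemma complements_count:
  fixes e :: "'b \<Rightarrow> 'k::field"
  assumes fin: "finite (UNIV :: 'k set)" and S: "fn.subspace S" "finite S" "e \<in> S"
    and T: "fn.subspace T" "T \<subseteq> S" "e \<notin> T"
  shows "card (complements e T S) * card T * CARD('k) = card S"
  using T
proof (induction "card S - card T" arbitrary: T rule: less_induct)
  case less
  have fT: "finite T" using less.prems S finite_subset by blast
  have sub: "fn.span (insert x T) \<subseteq> S" if "x \<in> S" for x
    using that less.prems S(1) by (intro fn.span_minimal) auto
  show ?case
  proof (cases "fn.span (insert e T) = S")
    case True
    \<comment> \<open>The end of the induction: \<open>T\<close> is itself a hyperplane avoiding
      \<open>e\<close>, hence the only complement.\<close>
    have dec: "\<exists>c. s - fscale c e \<in> T" if "s \<in> S" for s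
      using that True add_line_eq[OF less.prems(1)] by blast
    have "U = T" if U: "U \<in> complements e T S" for U
    proof
      show "T \<subseteq> U" using U by (simp add: complements_def)
      show "U \<subseteq> T"
      proof
        fix u assume u: "u \<in> U"
        then obtain c where c: "u - fscale c e \<in> T" using dec U unfolding complements_def by blast
        have "u - (u - fscale c e) \<in> U" using U u c unfolding complements_def
          by - (rule fn.subspace_diff, auto)
        moreover have "u - (u - fscale c e) = fscale c e" by (simp add: fun_eq_iff)
        ultimately have "fscale c e \<in> U" by simp
        then have "c = 0" using U subspace_scale_iff unfolding complements_def by blast
        then show "u \<in> T" using c by simp
      qed
    qed
    moreover have "T \<in> complements e T S"
      using less.prems dec by (auto simp: complements_def)
    ultimately have "complements e T S = {T}" by blast
    then show ?thesis using card_add_line[OF fin less.prems(1) fT less.prems(3)] True by simp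
  next
    case False
    then obtain b where b: "b \<in> S" "b \<notin> fn.span (insert e T)" using sub S(3) by blast
    let ?x = "\<lambda>c. b + fscale c e"
    let ?T = "\<lambda>c. fn.span (insert (?x c) T)"
    have xS: "?x c \<in> S" for c using b S by (simp add: fn.subspace_add fn.subspace_scale)
    have xe: "?x c \<notin> fn.span (insert e T)" for c
    proof
      assume "?x c \<in> fn.span (insert e T)"
      then have "?x c - fscale c e \<in> fn.span (insert e T)"
        by (intro fn.span_diff fn.span_scale) (simp_all add: fn.span_base)
      then show False using b(2) by simp
    qed
    have xT: "?x c \<notin> T" for c using xe[of c] fn.span_base[of "?x c" "insert e T"] by auto
    have eT: "e \<notin> ?T c" for c
    proof
      assume "e \<in> ?T c"
      then obtain a where a: "e - fscale a (?x c) \<in> T" using add_line_eq[OF less.prems(1)] by blast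
      then have "a \<noteq> 0" using less.prems(3) by auto
      have "fscale a (?x c) \<in> fn.span (insert e T)"
      proof -
        have "e - (e - fscale a (?x c)) \<in> fn.span (insert e T)"
          using a by - (rule fn.span_diff, simp_all add: fn.span_base)
        then show ?thesis by simp
      qed
      then show False using xe subspace_scale_iff[OF fn.subspace_span \<open>a \<noteq> 0\<close>] by blast
    qed
    have cT: "card (?T c) = CARD('k) * card T" for c using card_add_line[OF fin less.prems(1) fT xT] by blast
    have le: "card (?T c) \<le> card S" for c using card_mono[OF S(2) sub[OF xS]] .
    have pos: "card T > 0" using fT less.prems(1) fn.subspace_0 card_gt_0_iff by blast
    have lt: "card S - card (?T c) < card S - card T" for c
    proof -
      have "card T < card (?T c)" unfolding cT using pos card_gt_one_field[OF fin] by simp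
      then show ?thesis using le[of c] by simp
    qed
    have "card (complements e (?T c) S) * card (?T c) * CARD('k) = card S" for c
      using less.hyps[OF lt fn.subspace_span sub[OF xS] eT] by simp
    then have each: "card (complements e (?T c) S) * (CARD('k) * card T) * CARD('k) = card S" for c
      using cT by simp
    have un: "complements e T S = (\<Union>c. complements e (?T c) S)"
    proof (intro equalityI subsetI)
      fix U assume U: "U \<in> complements e T S"
      then obtain c where c: "b - fscale c e \<in> U" using b unfolding complements_def by blast
      \<comment> \<open>\<open>complements\<close> subtracts multiples of \<open>e\<close> while
        \<open>?x\<close> adds them, hence the sign.\<close>
      have "?T (- c) \<subseteq> U" using U c unfolding complements_def by (intro fn.span_minimal) auto
      then have "U \<in> complements e (?T (- c)) S" using U unfolding complements_def by simp
      then show "U \<in> (\<Union>c. complements e (?T c) S)" by blast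
    next
      fix U assume "U \<in> (\<Union>c. complements e (?T c) S)"
      then obtain c where c: "U \<in> complements e (?T c) S" by blast
      have "T \<subseteq> ?T c" using fn.span_superset[of "insert (?x c) T"] by simp
      then show "U \<in> complements e T S" using c unfolding complements_def by auto
    qed
    have disj: "complements e (?T c) S \<inter> complements e (?T d) S = {}" if "c \<noteq> d" for c d
    proof -
      have False if U: "U \<in> complements e (?T c) S" "U \<in> complements e (?T d) S" for U
      proof -
        have "?x c \<in> ?T c" "?x d \<in> ?T d" by (simp_all add: fn.span_base)
        then have "?x c \<in> U" "?x d \<in> U" using U unfolding complements_def by auto
        then have "?x c - ?x d \<in> U" using U unfolding complements_def by - (rule fn.subspace_diff, auto)
        then have "fscale (c - d) e \<in> U" by (simp add: fn.scale_left_diff_distrib)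
        moreover have "fn.subspace U" "e \<notin> U" "c - d \<noteq> 0"
          using U \<open>c \<noteq> d\<close> by (auto simp: complements_def)
        ultimately show False using subspace_scale_iff by blast
      qed
      then show ?thesis by blast
    qed
    have fc: "finite (complements e (?T c) S)" for c
      by (rule finite_subset[of _ "Pow S"]) (use S(2) in \<open>simp_all add: complements_def subset_iff\<close>)
    have "card (complements e T S) = (\<Sum>c\<in>UNIV. card (complements e (?T c) S))"
      unfolding un
    proof (rule card_UN_disjoint)
      show "\<forall>c\<in>UNIV. finite (complements e (?T c) S)" using fc by blast
      show "\<forall>c\<in>UNIV. \<forall>d\<in>UNIV. c \<noteq> d \<longrightarrow> complements e (?T c) S \<inter> complements e (?T d) S = {}"
        using disj by blast
    qed (fact fin)
    then have "card (complements e T S) * (CARD('k) * card T) * CARD('k)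
        = (\<Sum>c\<in>UNIV. card (complements e (?T c) S) * (CARD('k) * card T) * CARD('k))"
      by (simp only: sum_distrib_right)
    also have "\<dots> = CARD('k) * card S"
      by (simp only: each sum_constant of_nat_id)
    finally have "card (complements e T S) * (CARD('k) * card T) * CARD('k) = CARD('k) * card S" .
    then have "(card (complements e T S) * card T * CARD('k)) * CARD('k) = card S * CARD('k)"
      by (simp only: mult_ac)
    then show ?thesis using card_gt_one_field[OF fin] by simp
  qed
qed

section \<open>The models of the preinjective representations\<close>

lemma arrowsD: "n \<ge> 1 \<Longrightarrow> (i, j) \<in> arrows n \<Longrightarrow> i \<in> verts n \<and> j \<in> verts n \<and> i < j"
  by (auto simp: arrows_def verts_def)

lemma subrepsD:
  assumes "U \<in> subreps n V"
  shows "U \<in> extensional (verts n)" "i \<in> verts n \<Longrightarrow> fn.subspace (U i)" "i \<in> verts n \<Longrightarrow> U i \<subseteq> sp V i"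
    "(i, j) \<in> arrows n \<Longrightarrow> x \<in> U i \<Longrightarrow> mp V (i, j) x \<in> U j"
proof -
  have UP: "U \<in> (\<Pi>\<^sub>E i\<in>verts n. {W. fn.subspace W \<and> W \<subseteq> sp V i})"
    and Ua: "\<forall>(i, j)\<in>arrows n. mp V (i, j) ` U i \<subseteq> U j"
    using assms unfolding subreps_def by blast+
  show "U \<in> extensional (verts n)" using UP by (simp add: PiE_iff)
  show "i \<in> verts n \<Longrightarrow> fn.subspace (U i)" "i \<in> verts n \<Longrightarrow> U i \<subseteq> sp V i"
    using PiE_mem[OF UP] by auto
  show "(i, j) \<in> arrows n \<Longrightarrow> x \<in> U i \<Longrightarrow> mp V (i, j) x \<in> U j" using Ua by blast
qed

lemma subrepsI:
  assumes "U \<in> extensional (verts n)" "\<And>i. i \<in> verts n \<Longrightarrow> fn.subspace (U i)" "\<And>i. i \<in> verts n \<Longrightarrow> U i \<subseteq> sp V i"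
    "\<And>i j x. (i, j) \<in> arrows n \<Longrightarrow> x \<in> U i \<Longrightarrow> mp V (i, j) x \<in> U j"
  shows "U \<in> subreps n V"
  unfolding subreps_def using assms by (auto simp: PiE_iff)

text \<open>Lets a mere cardinality serve as the threshold of an initial segment of the vertices,
  the empty one included.\<close>

lemma down_closed_eq:
  assumes "finite A" "0 \<notin> A" "\<And>i j. j \<in> A \<Longrightarrow> i \<le> j \<Longrightarrow> 1 \<le> i \<Longrightarrow> i \<in> A"
  shows "A = {1..card A}"
proof (cases "A = {}")
  case False
  have "1 \<le> a" if "a \<in> A" for a
  proof -
    have "a \<noteq> 0" using that assms(2) by metis
    then show ?thesis by simp
  qed
  then have "A \<subseteq> {1..Max A}" using assms(1) by (auto intro: Max_ge)
  moreover have "{1..Max A} \<subseteq> A" using assms(3)[OF Max_in[OF assms(1) False]] by auto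
  ultimately have "A = {1..Max A}" by (rule equalityI)
  then show ?thesis by (metis card_atLeastAtMost diff_Suc_1)
qed simp

type_synonym 'k rep = "(nat, 'k) qrep"

definition supp_below :: "nat \<Rightarrow> (nat \<Rightarrow> 'k::field) set" where
  "supp_below d = {f. \<forall>j\<ge>d. f j = 0}"

definition trunc :: "nat \<Rightarrow> (nat \<Rightarrow> 'k::field) \<Rightarrow> (nat \<Rightarrow> 'k)" where
  "trunc d f = (\<lambda>j. if j < d then f j else 0)"

definition shift :: "(nat \<Rightarrow> 'k::field) \<Rightarrow> (nat \<Rightarrow> 'k)" where
  "shift f = (\<lambda>j. f (Suc j))"

definition unit0 :: "nat \<Rightarrow> 'k::field" where
  "unit0 = (\<lambda>j. of_bool (j = 0))"

text \<open>
  \<open>model n l\<close> is \<open>N\<^sub>2\<^sub>n(l)\<close>: it has the basis \<open>e\<^sub>0, \<dots>, e\<^sub>l\<close> at the vertices \<open>i < 2n\<close> and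
  \<open>e\<^sub>0, \<dots>, e\<^sub>l\<^sub>-\<^sub>1\<close> at \<open>2n\<close>. The map \<open>shift\<close>, applied at every vertex, is also an epimorphism from
  \<open>model n (l + 1)\<close> to \<open>model n l\<close>; its kernel is spanned by \<open>e\<^sub>0\<close> and isomorphic to \<open>E(0)\<close>.
\<close>

definition model :: "nat \<Rightarrow> nat \<Rightarrow> 'k::field rep" where
  "model n l = \<lparr>sp = (\<lambda>i. supp_below (if i < 2 * n then Suc l else l)),
     mp = (\<lambda>(i, j). if i = 1 \<and> j = 2 * n then shift else if i = 2 * n - 1 then trunc l else id)\<rparr>"

lemma shift_simps [simp]:
  "shift (x + y) = shift x + shift y" "shift (x - y) = shift x - shift y"
  "shift (fscale c x) = fscale c (shift x)" "shift 0 = 0" "shift unit0 = 0"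
  by (auto simp: shift_def fscale_def unit0_def fun_eq_iff)

lemma trunc_simps [simp]:
  "trunc d (x + y) = trunc d x + trunc d y" "trunc d (x - y) = trunc d x - trunc d y"
  "trunc d (fscale c x) = fscale c (trunc d x)" "trunc d 0 = 0" "trunc (Suc d) unit0 = unit0"
  by (auto simp: trunc_def fscale_def unit0_def fun_eq_iff)

lemma shift_trunc: "shift (trunc (Suc d) x) = trunc d (shift x)"
  by (auto simp: trunc_def shift_def)

lemma surj_shift: "surj shift"
proof (rule surjI)
  show "shift (case_nat 0 f) = f" for f :: "nat \<Rightarrow> 'k::field" by (simp add: shift_def)
qed

text \<open>The kernel of \<open>shift\<close> is the line of \<open>unit0\<close>; comparing the
  entries at 0 names the scalar.\<close>

lemma shift_eq_iff: "shift x = shift y \<longleftrightarrow> x - fscale (x 0 - y 0) unit0 = y"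
proof
  assume "shift x = shift y"
  then have "x j = y j" if "j \<noteq> 0" for j
    using that by (cases j) (auto simp: shift_def fun_eq_iff)
  then show "x - fscale (x 0 - y 0) unit0 = y"
    by (auto simp: fun_eq_iff fscale_def unit0_def)
next
  assume "x - fscale (x 0 - y 0) unit0 = y"
  then have "shift y = shift (x - fscale (x 0 - y 0) unit0)" by simp
  then show "shift x = shift y" by (simp only: shift_simps) simp
qed

lemma unit0_nonzero [simp]: "unit0 \<noteq> 0"
  by (auto simp: unit0_def fun_eq_iff)

lemma supp_below_shift_iff [simp]: "shift x \<in> supp_below d \<longleftrightarrow> x \<in> supp_below (Suc d)"
  unfolding supp_below_def shift_def using Suc_le_D by auto

lemma subspace_vimage:
  assumes "fn.subspace W" "f 0 = 0" "\<And>x y. f (x + y) = f x + f y" "\<And>c x. f (fscale c x) = fscale c (f x)"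
  shows "fn.subspace (f -` W)"
  using assms by (auto simp: fn.subspace_def)

lemma subspace_image:
  assumes "fn.subspace W" "f 0 = 0" "\<And>x y. f (x + y) = f x + f y" "\<And>c x. f (fscale c x) = fscale c (f x)"
  shows "fn.subspace (f ` W)"
  unfolding fn.subspace_def
proof (intro conjI ballI allI)
  show "0 \<in> f ` W" using assms(1,2) fn.subspace_0 by (metis image_eqI)
  show "x + y \<in> f ` W" if "x \<in> f ` W" "y \<in> f ` W" for x y
    using that assms(1,3) fn.subspace_add by (metis (no_types, lifting) image_iff)
  show "fscale c x \<in> f ` W" if "x \<in> f ` W" for c x
    using that assms(1,4) fn.subspace_scale by (metis (no_types, lifting) image_iff)
qed

lemma shift_vimage_image:
  assumes "fn.subspace U" "unit0 \<in> U"
  shows "shift -` (shift ` U) = U"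
proof
  show "shift -` (shift ` U) \<subseteq> U"
  proof
    fix x assume "x \<in> shift -` (shift ` U)"
    then obtain u where u: "u \<in> U" "shift u = shift x" by auto
    then have "x = u - fscale (u 0 - x 0) unit0" using shift_eq_iff by metis
    then show "x \<in> U" using u assms fn.subspace_diff fn.subspace_scale by metis
  qed
qed auto

lemma card_shift_vimage:
  fixes W :: "(nat \<Rightarrow> 'k::field) set"
  assumes "finite (UNIV :: 'k set)" "finite W"
  shows "finite (shift -` W)" "card (shift -` W) = CARD('k) * card W"
proof -
  have bij: "bij_betw (\<lambda>x. (x 0, shift x)) (shift -` W) (UNIV \<times> W)"
    by (rule bij_betwI[where g = "\<lambda>(c, w). case_nat c w"])
      (auto simp: shift_def fun_eq_iff split: nat.splits)
  show "card (shift -` W) = CARD('k) * card W"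
    using bij_betw_same_card[OF bij] by (simp add: card_cartesian_product)
  show "finite (shift -` W)" using bij_betw_finite[OF bij] assms by simp
qed

lemma finite_supp_below:
  assumes "finite (UNIV :: 'k::field set)"
  shows "finite (supp_below d :: (nat \<Rightarrow> 'k) set)" "card (supp_below d :: (nat \<Rightarrow> 'k) set) = CARD('k) ^ d"
proof (induction d)
  case 0
  have "supp_below 0 = {0 :: nat \<Rightarrow> 'k}" by (auto simp: supp_below_def)
  then show "finite (supp_below 0 :: (nat \<Rightarrow> 'k) set)" "card (supp_below 0 :: (nat \<Rightarrow> 'k) set) = CARD('k) ^ 0"
    by auto
next
  case (Suc d)
  have "supp_below (Suc d) = shift -` (supp_below d :: (nat \<Rightarrow> 'k) set)" by auto
  then show "finite (supp_below (Suc d) :: (nat \<Rightarrow> 'k) set)"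
    "card (supp_below (Suc d) :: (nat \<Rightarrow> 'k) set) = CARD('k) ^ Suc d"
    using card_shift_vimage[OF assms] Suc by simp_all
qed

lemma subspace_supp_below [simp]: "fn.subspace (supp_below d)"
  by (auto simp: fn.subspace_def supp_below_def fscale_def)

text \<open>A subspace that avoids \<open>unit0\<close> meets the kernel of \<open>shift\<close>
  trivially, so within the full preimage of its image it is complementary to that kernel.\<close>

lemma complement_vimage:
  assumes U: "fn.subspace U" "unit0 \<notin> U" and "T \<subseteq> U"
  shows "U \<in> complements unit0 T (shift -` (shift ` U))"
proof -
  have "\<exists>c. s - fscale c unit0 \<in> U" if "shift s \<in> shift ` U" for s
  proof -
    obtain u where "u \<in> U" "shift s = shift u" using \<open>shift s \<in> shift ` U\<close> by auto
    then show ?thesis using shift_eq_iff by metis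
  qed
  then show ?thesis using assms by (simp add: complements_def image_subset_iff_subset_vimage[symmetric])
qed

definition model_dim :: "nat \<Rightarrow> nat \<Rightarrow> nat \<Rightarrow> nat" where
  "model_dim n l i = (if i < 2 * n then Suc l else l)"

lemma ball_arrows:
  assumes "n \<ge> 1"
  shows "(\<forall>(i, j)\<in>arrows n. P i j) \<longleftrightarrow>
    (\<forall>i. 1 \<le> i \<and> i < 2 * n - 1 \<longrightarrow> P i (Suc i)) \<and> P (2 * n - 1) (2 * n) \<and> P 1 (2 * n)"
proof -
  have "arrows n = {(i, Suc i) |i. 1 \<le> i \<and> i < 2 * n - 1} \<union> {(2 * n - 1, 2 * n), (1, 2 * n)}"
    using assms by (force simp: arrows_def)
  then show ?thesis by auto
qed

text \<open>Along the arrows between vertices below \<open>2 * n\<close> the model has identity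
  maps, so only the two arrows into the sink give more than an inclusion.\<close>

lemma subreps_model_iff:
  assumes "n \<ge> 2"
  shows "U \<in> subreps n (model n l) \<longleftrightarrow> U \<in> extensional (verts n) \<and>
    (\<forall>i\<in>verts n. fn.subspace (U i) \<and> U i \<subseteq> supp_below (model_dim n l i)) \<and>
    (\<forall>i. 1 \<le> i \<and> i < 2 * n - 1 \<longrightarrow> U i \<subseteq> U (Suc i)) \<and>
    trunc l ` U (2 * n - 1) \<subseteq> U (2 * n) \<and> shift ` U 1 \<subseteq> U (2 * n)"
proof -
  have mp1: "mp (model n l) (i, Suc i) ` A = A" if "1 \<le> i" "i < 2 * n - 1" for i A
    using that by (auto simp: model_def)
  have mp2: "mp (model n l) (2 * n - 1, 2 * n) = trunc l" "mp (model n l) (1, 2 * n) = shift"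
    using assms by (auto simp: model_def)
  have arr: "(\<forall>(i, j)\<in>arrows n. mp (model n l) (i, j) ` U i \<subseteq> U j) \<longleftrightarrow>
    (\<forall>i. 1 \<le> i \<and> i < 2 * n - 1 \<longrightarrow> U i \<subseteq> U (Suc i)) \<and>
    trunc l ` U (2 * n - 1) \<subseteq> U (2 * n) \<and> shift ` U 1 \<subseteq> U (2 * n)"
  proof -
    have "(\<forall>(i, j)\<in>arrows n. mp (model n l) (i, j) ` U i \<subseteq> U j) \<longleftrightarrow>
      (\<forall>i. 1 \<le> i \<and> i < 2 * n - 1 \<longrightarrow> mp (model n l) (i, Suc i) ` U i \<subseteq> U (Suc i)) \<and>
      mp (model n l) (2 * n - 1, 2 * n) ` U (2 * n - 1) \<subseteq> U (2 * n) \<and> mp (model n l) (1, 2 * n) ` U 1 \<subseteq> U (2 * n)"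
      by (rule ball_arrows) (use assms in simp)
    also have "\<dots> \<longleftrightarrow> (\<forall>i. 1 \<le> i \<and> i < 2 * n - 1 \<longrightarrow> U i \<subseteq> U (Suc i)) \<and>
      trunc l ` U (2 * n - 1) \<subseteq> U (2 * n) \<and> shift ` U 1 \<subseteq> U (2 * n)"
      unfolding mp2 using mp1 by metis
    finally show ?thesis .
  qed
  have sp: "sp (model n l) i = supp_below (model_dim n l i)" for i
    by (simp add: model_def model_dim_def)
  show ?thesis
    unfolding subreps_def mem_Collect_eq PiE_iff arr sp
    by (rule iffI; elim conjE; intro conjI; assumption)
qed

definition shift_family :: "nat \<Rightarrow> (nat \<Rightarrow> (nat \<Rightarrow> 'k::field) set) \<Rightarrow> nat \<Rightarrow> (nat \<Rightarrow> 'k) set" where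
  "shift_family n U = (\<lambda>i\<in>verts n. shift ` U i)"

text \<open>
  A subrepresentation contains \<open>e\<^sub>0\<close> exactly at the vertices after \<open>k\<close>, its level. At those it is
  determined by its image \<open>W\<close> under \<open>shift\<close>; at the earlier ones it is the graph of a functional on
  \<open>W\<close>, and these functionals are determined by the one at the pivot vertex \<open>k\<close>.
\<close>

definition level :: "nat \<Rightarrow> (nat \<Rightarrow> (nat \<Rightarrow> 'k::field) set) \<Rightarrow> nat" where
  "level n U = card {i \<in> verts n. unit0 \<notin> U i}"

text \<open>The submodules of E(0) are supported at the vertices after some \<open>k\<close>, hence
  indexed by \<open>k\<close> = 0, ..., \<open>2 * n\<close>. The pair of \<open>k\<close> and
  \<open>W\<close> therefore records the submodules induced on the kernel and on the quotient of
  \<open>shift\<close>.\<close>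

definition fibre :: "nat \<Rightarrow> nat \<Rightarrow> (nat \<Rightarrow> (nat \<Rightarrow> 'k::field) set) \<Rightarrow> nat \<Rightarrow> (nat \<Rightarrow> (nat \<Rightarrow> 'k) set) set" where
  "fibre n l W k = {U \<in> subreps n (model n (Suc l)). shift_family n U = W \<and> level n U = k}"

text \<open>The action in \<open>model n l\<close> of the path from \<open>i\<close> through
  \<open>i + 1\<close> and so on to \<open>k\<close>: the identity, except for the truncation on
  entering the sink.\<close>

definition to_pivot :: "nat \<Rightarrow> nat \<Rightarrow> nat \<Rightarrow> nat \<Rightarrow> (nat \<Rightarrow> 'k::field) \<Rightarrow> (nat \<Rightarrow> 'k)" where
  "to_pivot n l k i = (if k = 2 * n \<and> i < 2 * n then trunc l else id)"

text \<open>Inverse to taking the subspace at the pivot: up to the pivot, a vector is accepted if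
  the path carries it into \<open>C\<close>. For \<open>k = 0\<close> all vertices lie after the
  level, and the family does not depend on \<open>C\<close>.\<close>

definition lift_family ::
    "nat \<Rightarrow> nat \<Rightarrow> (nat \<Rightarrow> (nat \<Rightarrow> 'k::field) set) \<Rightarrow> nat \<Rightarrow> (nat \<Rightarrow> 'k) set \<Rightarrow> nat \<Rightarrow> (nat \<Rightarrow> 'k) set" where
  "lift_family n l W k C = (\<lambda>i\<in>verts n.
     if k < i then shift -` W i else shift -` W i \<inter> to_pivot n (Suc l) k i -` C)"

text \<open>
  At the pivot \<open>2n\<close> the arrow from \<open>1\<close> imposes a condition: as \<open>shift ` U 1 = W 1\<close>, the subspace at
  \<open>2n\<close> has to contain \<open>W 1\<close>.
\<close>

definition pivot_base :: "nat \<Rightarrow> (nat \<Rightarrow> (nat \<Rightarrow> 'k::field) set) \<Rightarrow> nat \<Rightarrow> (nat \<Rightarrow> 'k) set" where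
  "pivot_base n W k = (if k = 2 * n then W 1 else {0})"

lemma to_pivot_simps [simp]:
  "to_pivot n d k i (x + y) = to_pivot n d k i x + to_pivot n d k i y"
  "to_pivot n d k i (x - y) = to_pivot n d k i x - to_pivot n d k i y"
  "to_pivot n d k i (fscale c x) = fscale c (to_pivot n d k i x)"
  "to_pivot n d k i 0 = 0" "to_pivot n (Suc d) k i unit0 = unit0"
  by (simp_all add: to_pivot_def)

section \<open>Submodules of the extension over a given submodule of the quotient\<close>

context
  fixes n :: nat
  assumes n: "n \<ge> 2"
begin

lemma model_subrepD:
  assumes "U \<in> subreps n (model n l)"
  shows "U \<in> extensional (verts n)"
    and "i \<in> verts n \<Longrightarrow> fn.subspace (U i)"
    and "i \<in> verts n \<Longrightarrow> U i \<subseteq> supp_below (model_dim n l i)"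
    and "1 \<le> i \<Longrightarrow> i \<le> j \<Longrightarrow> j < 2 * n \<Longrightarrow> U i \<subseteq> U j"
    and "1 \<le> i \<Longrightarrow> i < 2 * n \<Longrightarrow> x \<in> U i \<Longrightarrow> trunc l x \<in> U (2 * n)"
    and "x \<in> U 1 \<Longrightarrow> shift x \<in> U (2 * n)"
proof -
  have U: "U \<in> extensional (verts n)" "\<forall>i\<in>verts n. fn.subspace (U i) \<and> U i \<subseteq> supp_below (model_dim n l i)"
    "\<forall>i. 1 \<le> i \<and> i < 2 * n - 1 \<longrightarrow> U i \<subseteq> U (Suc i)"
    "trunc l ` U (2 * n - 1) \<subseteq> U (2 * n)" "shift ` U 1 \<subseteq> U (2 * n)"
    using assms unfolding subreps_model_iff[OF n] by - (elim conjE, assumption)+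
  show "U \<in> extensional (verts n)" by (fact U)
  show "fn.subspace (U i)" "U i \<subseteq> supp_below (model_dim n l i)" if "i \<in> verts n" for i
    using bspec[OF U(2) that] by simp_all
  show mono: "U i \<subseteq> U j" if ij: "1 \<le> i" "i \<le> j" "j < 2 * n" for i j
    using ij(2,3)
  proof (induction j rule: dec_induct)
    case (step m)
    then have "U m \<subseteq> U (Suc m)" using U(3)[rule_format, of m] ij(1) by linarith
    then show ?case using step.IH step.prems by simp
  qed simp
  show "shift x \<in> U (2 * n)" if "x \<in> U 1" using U(5) that by blast
  show "trunc l x \<in> U (2 * n)" if "1 \<le> i" "i < 2 * n" "x \<in> U i"
  proof -
    have "i \<le> 2 * n - 1" "2 * n - 1 < 2 * n" using that n by linarith+
    then have "x \<in> U (2 * n - 1)" using mono[of i "2 * n - 1"] that by blast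
    then show ?thesis using U(4) by blast
  qed
qed

lemma to_pivot_mem:
  assumes "U \<in> subreps n (model n l)" "i \<in> verts n" "k \<in> verts n" "i \<le> k" "x \<in> U i"
  shows "to_pivot n l k i x \<in> U k"
proof (cases "i < 2 * n")
  case True
  then show ?thesis
    using assms model_subrepD(4)[OF assms(1), of i k] model_subrepD(5)[OF assms(1), of i x]
    by (auto simp: to_pivot_def verts_def)
qed (use assms in \<open>auto simp: to_pivot_def verts_def\<close>)

text \<open>The path maps of \<open>model n (Suc l)\<close> fix \<open>unit0\<close>, even the
  truncation into the sink, because the space there has dimension \<open>Suc l\<close>. So the
  vertices at which \<open>unit0\<close> is missing form an initial segment.\<close>

lemma unit0_mem_iff_level:
  assumes U: "U \<in> subreps n (model n (Suc l))" and i: "i \<in> verts n"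
  shows "unit0 \<in> U i \<longleftrightarrow> level n U < i" "level n U \<le> 2 * n"
proof -
  define A where "A = {i \<in> verts n. unit0 \<notin> U i}"
  have A: "A = {1..card A}"
  proof (rule down_closed_eq)
    show "finite A" "0 \<notin> A" by (auto simp: A_def verts_def)
    fix i j assume "j \<in> A" "i \<le> j" "1 \<le> i"
    moreover from this have "i \<in> verts n" "j \<in> verts n" by (auto simp: A_def verts_def)
    ultimately show "i \<in> A" using to_pivot_mem[OF U, of i j unit0] by (auto simp: A_def)
  qed
  have "level n U = card A" by (simp add: level_def A_def)
  moreover have "unit0 \<in> U i \<longleftrightarrow> i \<notin> A" using i by (simp add: A_def)
  moreover have "i \<in> A \<longleftrightarrow> i \<le> card A"
    using i by (subst A) (auto simp: verts_def)
  ultimately show "unit0 \<in> U i \<longleftrightarrow> level n U < i" by auto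
  have "card A \<le> card (verts n)" by (rule card_mono) (auto simp: A_def verts_def)
  then show "level n U \<le> 2 * n" using \<open>level n U = card A\<close> by (simp add: verts_def)
qed

lemma level_eqI:
  assumes "\<And>i. i \<in> verts n \<Longrightarrow> unit0 \<in> U i \<longleftrightarrow> k < i" "k \<le> 2 * n"
  shows "level n U = k"
proof -
  have "{i \<in> verts n. unit0 \<notin> U i} = {1..k}" using assms by (force simp: verts_def)
  then show ?thesis by (simp add: level_def)
qed

lemma shift_family_subrep:
  assumes U: "U \<in> subreps n (model n (Suc l))"
  shows "shift_family n U \<in> subreps n (model n l)"
  unfolding subreps_model_iff[OF n]
proof (intro conjI ballI allI impI)
  show "shift_family n U \<in> extensional (verts n)" by (simp add: shift_family_def)
  show "fn.subspace (shift_family n U i)" if "i \<in> verts n" for i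
    using that model_subrepD(2)[OF U] by (auto simp: shift_family_def intro!: subspace_image)
  show "shift_family n U i \<subseteq> supp_below (model_dim n l i)" if "i \<in> verts n" for i
    using that model_subrepD(3)[OF U, of i] by (auto simp: shift_family_def model_dim_def split: if_splits)
  show "shift_family n U i \<subseteq> shift_family n U (Suc i)" if "1 \<le> i \<and> i < 2 * n - 1" for i
  proof -
    have "Suc i < 2 * n" "i \<in> verts n" "Suc i \<in> verts n" using that by (auto simp: verts_def)
    then show ?thesis using that model_subrepD(4)[OF U, of i "Suc i"] by (auto simp: shift_family_def)
  qed
  have v: "1 \<in> verts n" "2 * n - 1 \<in> verts n" "2 * n \<in> verts n" using n by (auto simp: verts_def)
  have "trunc l (shift x) \<in> shift ` U (2 * n)" if "x \<in> U (2 * n - 1)" for x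
    using model_subrepD(5)[OF U, of "2 * n - 1" x] that n by (auto simp: shift_trunc[symmetric])
  then show "trunc l ` shift_family n U (2 * n - 1) \<subseteq> shift_family n U (2 * n)"
    using v by (auto simp: shift_family_def)
  show "shift ` shift_family n U 1 \<subseteq> shift_family n U (2 * n)"
    using v model_subrepD(6)[OF U] by (auto simp: shift_family_def)
qed

text \<open>A vector in the preimage of \<open>W i\<close> differs from one in \<open>U i\<close> by
  a multiple of \<open>unit0\<close>, and this multiple is detected at the pivot, where
  \<open>unit0\<close> is missing. Beyond \<open>W\<close> and the level, nothing but
  \<open>U k\<close> has to be remembered.\<close>

lemma fibre_eq_lift_family:
  assumes "U \<in> fibre n l W k"
  shows "U = lift_family n l W k (U k)"
    and "k \<in> verts n \<Longrightarrow> U k \<in> complements unit0 (pivot_base n W k) (shift -` W k)"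
proof -
  have U: "U \<in> subreps n (model n (Suc l))" and W: "W = shift_family n U" and k: "k = level n U"
    using assms by (auto simp: fibre_def)
  have Wi: "W i = shift ` U i" if "i \<in> verts n" for i using that W by (simp add: shift_family_def)
  show "U = lift_family n l W k (U k)"
  proof (rule extensionalityI[of _ "verts n"])
    fix i assume i: "i \<in> verts n"
    have sub: "fn.subspace (U i)" using model_subrepD(2)[OF U i] .
    show "U i = lift_family n l W k (U k) i"
    proof (cases "k < i")
      case True
      then have "unit0 \<in> U i" using unit0_mem_iff_level[OF U i] k by simp
      then have "shift -` W i = U i" using shift_vimage_image[OF sub] Wi[OF i] by simp
      then show ?thesis using True i by (simp add: lift_family_def)
    next
      case False
      then have kv: "k \<in> verts n" "i \<le> k" using i unit0_mem_iff_level(2)[OF U i] k by (auto simp: verts_def)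
      have ek: "unit0 \<notin> U k" using unit0_mem_iff_level(1)[OF U kv(1)] k by simp
      have "U i = shift -` W i \<inter> to_pivot n (Suc l) k i -` U k"
      proof (intro equalityI subsetI)
        fix x assume "x \<in> U i"
        then show "x \<in> shift -` W i \<inter> to_pivot n (Suc l) k i -` U k"
          using to_pivot_mem[OF U i kv] Wi[OF i] by auto
      next
        fix x assume x: "x \<in> shift -` W i \<inter> to_pivot n (Suc l) k i -` U k"
        then obtain u where u: "u \<in> U i" "shift x = shift u" using Wi[OF i] by auto
        define c where "c = x 0 - u 0"
        have c: "x - fscale c unit0 = u" using u(2) shift_eq_iff unfolding c_def by blast
        \<comment> \<open>As \<open>to_pivot\<close> fixes \<open>unit0\<close>, the difference of
          the two vectors is still \<open>fscale c unit0\<close> at the pivot.\<close>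
        have "to_pivot n (Suc l) k i (x - fscale c unit0) \<in> U k"
          using to_pivot_mem[OF U i kv] u(1) c by blast
        then have "to_pivot n (Suc l) k i x - fscale c unit0 \<in> U k" by simp
        then have "to_pivot n (Suc l) k i x - (to_pivot n (Suc l) k i x - fscale c unit0) \<in> U k"
          using x model_subrepD(2)[OF U kv(1)] by - (rule fn.subspace_diff, auto)
        then have "fscale c unit0 \<in> U k" by (simp add: algebra_simps)
        then have "c = 0" using subspace_scale_iff[OF model_subrepD(2)[OF U kv(1)]] ek by blast
        then show "x \<in> U i" using c u(1) by simp
      qed
      then show ?thesis using False i by (simp add: lift_family_def)
    qed
  qed (use model_subrepD(1)[OF U] in \<open>auto simp: lift_family_def\<close>)
  show "U k \<in> complements unit0 (pivot_base n W k) (shift -` W k)" if kv: "k \<in> verts n"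
  proof -
    have "1 \<in> verts n" using n by (simp add: verts_def)
    then have "pivot_base n W k \<subseteq> U k"
      using Wi model_subrepD(6)[OF U] fn.subspace_0[OF model_subrepD(2)[OF U kv]]
      by (auto simp: pivot_base_def)
    moreover have "unit0 \<notin> U k" using unit0_mem_iff_level(1)[OF U kv] k by simp
    ultimately show ?thesis
      using complement_vimage[OF model_subrepD(2)[OF U kv]] Wi[OF kv] by simp
  qed
qed

text \<open>Every complement at the pivot occurs. Together with \<open>fibre_eq_lift_family\<close>
  this identifies the fibre with a set of complements, and for \<open>k = 0\<close> with a single
  point.\<close>

lemma lift_family_in_fibre:
  assumes W: "W \<in> subreps n (model n l)" and k: "k \<le> 2 * n"
    and C: "k = 0 \<or> C \<in> complements unit0 (pivot_base n W k) (shift -` W k)"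
  shows "lift_family n l W k C \<in> fibre n l W k"
    and "k \<noteq> 0 \<Longrightarrow> lift_family n l W k C k = C"
proof -
  have v: "1 \<in> verts n" "2 * n - 1 \<in> verts n" "2 * n \<in> verts n" using n by (auto simp: verts_def)
  let ?U = "lift_family n l W k C"
  have Ck: "fn.subspace C" "unit0 \<notin> C" "pivot_base n W k \<subseteq> C" "C \<subseteq> shift -` W k"
      "\<And>s. s \<in> shift -` W k \<Longrightarrow> \<exists>c. s - fscale c unit0 \<in> C" if "k \<noteq> 0"
    using that C by (auto simp: complements_def)
  have mem: "x \<in> ?U i \<longleftrightarrow> shift x \<in> W i \<and> (i \<le> k \<longrightarrow> to_pivot n (Suc l) k i x \<in> C)" if "i \<in> verts n" for i x
    using that by (auto simp: lift_family_def)
  show self: "?U k = C" if "k \<noteq> 0"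
  proof -
    have "k \<in> verts n" using that k by (simp add: verts_def)
    moreover have "to_pivot n (Suc l) k k x = x" for x :: "nat \<Rightarrow> 'a" by (auto simp: to_pivot_def)
    ultimately show ?thesis using mem Ck(4)[OF that] by auto
  qed
  have sub: "?U \<in> subreps n (model n (Suc l))"
    unfolding subreps_model_iff[OF n]
  proof (intro conjI ballI allI impI)
    show "?U \<in> extensional (verts n)" by (simp add: lift_family_def)
    show "fn.subspace (?U i)" if i: "i \<in> verts n" for i
    proof -
      have "fn.subspace (shift -` W i)"
        by (rule subspace_vimage) (simp_all add: model_subrepD(2)[OF W i])
      moreover have "fn.subspace (to_pivot n (Suc l) k i -` C)" if "\<not> k < i"
      proof -
        have "k \<noteq> 0" using that i by (auto simp: verts_def)
        then show ?thesis by (intro subspace_vimage) (simp_all add: Ck)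
      qed
      ultimately show ?thesis using i by (auto simp: lift_family_def intro: fn.subspace_inter)
    qed
    show "?U i \<subseteq> supp_below (model_dim n (Suc l) i)" if i: "i \<in> verts n" for i
    proof
      fix x assume "x \<in> ?U i"
      then have "shift x \<in> supp_below (model_dim n l i)" using mem[OF i] model_subrepD(3)[OF W i] by blast
      then show "x \<in> supp_below (model_dim n (Suc l) i)" by (auto simp: model_dim_def)
    qed
    show "?U i \<subseteq> ?U (Suc i)" if i: "1 \<le> i \<and> i < 2 * n - 1" for i
    proof
      fix x assume x: "x \<in> ?U i"
      have iv: "i \<in> verts n" "Suc i \<in> verts n" using i by (auto simp: verts_def)
      have "Suc i < 2 * n" using i by linarith
      then have "W i \<subseteq> W (Suc i)" using model_subrepD(4)[OF W, of i "Suc i"] i by auto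
      moreover have "to_pivot n (Suc l) k i x = to_pivot n (Suc l) k (Suc i) x"
        using i by (auto simp: to_pivot_def)
      ultimately show "x \<in> ?U (Suc i)" using x mem iv by auto
    qed
    show "trunc (Suc l) ` ?U (2 * n - 1) \<subseteq> ?U (2 * n)"
    proof clarify
      fix x assume x: "x \<in> ?U (2 * n - 1)"
      then have "shift (trunc (Suc l) x) \<in> W (2 * n)"
        using mem[OF v(2)] model_subrepD(5)[OF W, of "2 * n - 1" "shift x"] n by (simp add: shift_trunc)
      moreover have "trunc (Suc l) x \<in> C" if "2 * n \<le> k"
      proof -
        have "k = 2 * n" using that k by simp
        then show ?thesis using x mem[OF v(2)] n by (auto simp: to_pivot_def)
      qed
      ultimately show "trunc (Suc l) x \<in> ?U (2 * n)" using mem[OF v(3)] by (simp add: to_pivot_def)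
    qed
    show "shift ` ?U 1 \<subseteq> ?U (2 * n)"
    proof clarify
      fix x assume "x \<in> ?U 1"
      then have x: "shift x \<in> W 1" using mem[OF v(1)] by simp
      then have "shift (shift x) \<in> W (2 * n)" using model_subrepD(6)[OF W] by blast
      \<comment> \<open>The condition imposed by the arrow from 1 to a pivot at the sink:
        \<open>shift\<close> carries \<open>?U 1\<close> into \<open>W 1\<close>, which
        \<open>pivot_base\<close> places inside \<open>C\<close>.\<close>
      moreover have "shift x \<in> C" if "2 * n \<le> k"
      proof -
        have "k = 2 * n" "k \<noteq> 0" using that k n by auto
        then show ?thesis using x Ck(3) by (auto simp: pivot_base_def)
      qed
      ultimately show "shift x \<in> ?U (2 * n)" using mem[OF v(3)] by (simp add: to_pivot_def)
    qed
  qed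
  moreover have "level n ?U = k"
  proof (rule level_eqI)
    fix i assume i: "i \<in> verts n"
    have "shift unit0 \<in> W i" using fn.subspace_0[OF model_subrepD(2)[OF W i]] by simp
    moreover have "k \<noteq> 0" if "i \<le> k" using that i by (auto simp: verts_def)
    ultimately show "unit0 \<in> ?U i \<longleftrightarrow> k < i" using mem[OF i] Ck(2) by auto
  qed (fact k)
  moreover have "shift_family n ?U = W"
  proof (rule extensionalityI[of _ "verts n"])
    fix i assume i: "i \<in> verts n"
    have "shift ` ?U i = W i"
    proof (intro equalityI subsetI)
      fix y assume y: "y \<in> W i"
      obtain x where x: "shift x = y" using surj_shift by (metis surjD)
      show "y \<in> shift ` ?U i"
      proof (cases "i \<le> k")
        case True
        then have k0: "k \<noteq> 0" "k \<in> verts n" using i k by (auto simp: verts_def)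
        have "shift (to_pivot n (Suc l) k i x) = to_pivot n l k i y"
          using x by (auto simp: to_pivot_def shift_trunc)
        then have "to_pivot n (Suc l) k i x \<in> shift -` W k"
          using to_pivot_mem[OF W i k0(2) True y] by simp
        \<comment> \<open>A preimage of \<open>y\<close> may be changed by a multiple of
          \<open>unit0\<close> without affecting its shift; a suitable multiple moves its image at
          the pivot into \<open>C\<close>.\<close>
        then obtain c where c: "to_pivot n (Suc l) k i x - fscale c unit0 \<in> C" using Ck(5)[OF k0(1)] by blast
        have "x - fscale c unit0 \<in> ?U i" using mem[OF i] c x y by simp
        moreover have "shift (x - fscale c unit0) = y" using x by simp
        ultimately show ?thesis by blast
      next
        case False
        then show ?thesis using mem[OF i] x y by force
      qed
    qed (use mem[OF i] in auto)
    then show "shift_family n ?U i = W i" using i by (simp add: shift_family_def)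
  qed (use model_subrepD(1)[OF W] in \<open>auto simp: shift_family_def\<close>)
  ultimately show "?U \<in> fibre n l W k" by (simp add: fibre_def)
qed

end

section \<open>Cardinalities of the fibres and regrouping of sums over submodules\<close>

lemma finite_subreps:
  assumes "\<And>i. i \<in> verts n \<Longrightarrow> finite (sp V i)"
  shows "finite (subreps n V)"
proof -
  have "(\<Pi>\<^sub>E i\<in>verts n. {W. fn.subspace W \<and> W \<subseteq> sp V i}) \<subseteq> (\<Pi>\<^sub>E i\<in>verts n. Pow (sp V i))"
    by (rule PiE_mono) auto
  then have "subreps n V \<subseteq> (\<Pi>\<^sub>E i\<in>verts n. Pow (sp V i))"
    unfolding subreps_def by blast
  moreover have "finite (\<Pi>\<^sub>E i\<in>verts n. Pow (sp V i))"
    using assms by (intro finite_PiE) (auto simp: verts_def)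
  ultimately show ?thesis by (rule finite_subset)
qed

text \<open>Dimension vector of the submodule of E(0) supported after \<open>k\<close>. The
  difference \<open>delta n - tail n k\<close> is that of the quotient, which is I_k for 0 <
  \<open>k\<close> < \<open>2 * n\<close>.\<close>

definition tail :: "nat \<Rightarrow> nat \<Rightarrow> ivec" where
  "tail n k = (\<lambda>i. of_bool (k < i \<and> i \<in> verts n))"

lemma tail_0: "tail n 0 = delta n"
  by (auto simp: tail_def delta_def verts_def)

lemma dim_eq_iff_card:
  fixes U :: "('b \<Rightarrow> 'k::field) set" and W :: "('c \<Rightarrow> 'k) set"
  assumes "finite (UNIV :: 'k set)" "fn.subspace U" "finite U" "fn.subspace W" "finite W"
  shows "fn.dim U = fn.dim W + j \<longleftrightarrow> card U = CARD('k) ^ j * card W"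
proof -
  have "card U = CARD('k) ^ j * card W \<longleftrightarrow> CARD('k) ^ fn.dim U = CARD('k) ^ (fn.dim W + j)"
    using fn.card_subspace[of U] fn.card_subspace[of W] assms by (simp add: power_add mult.commute)
  also have "\<dots> \<longleftrightarrow> fn.dim U = fn.dim W + j"
    using card_gt_one_field[OF assms(1)] by (rule power_inject_exp)
  finally show ?thesis by simp
qed

context
  fixes n :: nat
  assumes n: "n \<ge> 2" and fin: "finite (UNIV :: 'k::field set)"
begin

lemma finite_model_subrep:
  assumes "U \<in> subreps n (model n l :: 'k rep)" "i \<in> verts n"
  shows "finite (U i)"
  using model_subrepD(3)[OF n assms] finite_supp_below(1)[OF fin] finite_subset by blast

lemma finite_subreps_model: "finite (subreps n (model n l :: 'k rep))"
  by (rule finite_subreps) (simp add: model_def finite_supp_below(1)[OF fin])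

text \<open>On \<open>U i\<close> the map \<open>shift\<close> is injective up to the level, and has
  the line of \<open>unit0\<close> as its kernel afterwards.\<close>

lemma fibre_dim_family:
  assumes U: "U \<in> fibre n l (W :: nat \<Rightarrow> (nat \<Rightarrow> 'k) set) k"
  shows "dim_family n U = dim_family n W + tail n k"
proof
  fix i
  have U': "U \<in> subreps n (model n (Suc l))" and W: "W = shift_family n U" and k: "k = level n U"
    using U by (auto simp: fibre_def)
  have W': "W \<in> subreps n (model n l)" using shift_family_subrep[OF n U'] W by simp
  show "dim_family n U i = (dim_family n W + tail n k) i"
  proof (cases "i \<in> verts n")
    case True
    note sub = model_subrepD(2)[OF n U' True] model_subrepD(2)[OF n W' True]
      and f = finite_model_subrep[OF U' True] finite_model_subrep[OF W' True]
    have Wi: "W i = shift ` U i" using W True by (simp add: shift_family_def)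
    have "card (U i) = CARD('k) ^ of_bool (k < i) * card (W i)"
    proof (cases "k < i")
      case False
      then have e: "unit0 \<notin> U i" using unit0_mem_iff_level(1)[OF n U' True] k by simp
      have "inj_on shift (U i)"
      proof (rule inj_onI)
        fix x y assume xy: "x \<in> U i" "y \<in> U i" "shift x = shift y"
        have xy': "x - fscale (x 0 - y 0) unit0 = y" using xy(3) shift_eq_iff by blast
        have "x - y \<in> U i" using xy sub(1) by - (rule fn.subspace_diff)
        moreover have "x - y = fscale (x 0 - y 0) unit0" by (subst xy'[symmetric]) simp
        ultimately have "x 0 - y 0 = 0" using subspace_scale_iff[OF sub(1)] e by metis
        then show "x = y" using xy' by simp
      qed
      then show ?thesis using False Wi by (simp add: card_image)
    next
      case less: True
      then have "shift -` W i = U i"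
        using shift_vimage_image[OF sub(1)] unit0_mem_iff_level(1)[OF n U' True] k Wi by simp
      then show ?thesis using card_shift_vimage(2)[OF fin f(2)] less by simp
    qed
    then have "fn.dim (U i) = fn.dim (W i) + of_bool (k < i)"
      using dim_eq_iff_card[OF fin sub(1) f(1) sub(2) f(2)] by blast
    then show ?thesis using True by (simp add: dim_family_def tail_def)
  qed (simp add: dim_family_def tail_def)
qed

lemma card_fibre_pivot:
  assumes W: "W \<in> subreps n (model n l :: 'k rep)" and k: "k \<in> verts n"
  shows "card (fibre n l W k) = card (complements unit0 (pivot_base n W k) (shift -` W k))"
proof -
  have k': "k \<le> 2 * n" "k \<noteq> 0" using k by (auto simp: verts_def)
  have "bij_betw (\<lambda>U. U k) (fibre n l W k) (complements unit0 (pivot_base n W k) (shift -` W k))"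
    using fibre_eq_lift_family[OF n, of _ l W k] lift_family_in_fibre[OF n W k'(1)] k k'(2)
    by (intro bij_betwI[where g = "lift_family n l W k"]) auto
  then show ?thesis by (rule bij_betw_same_card)
qed

text \<open>At level 0, \<open>U\<close> contains the whole kernel of \<open>shift\<close> and so is
  the full preimage of \<open>W\<close>.\<close>

lemma card_fibre_0:
  assumes W: "W \<in> subreps n (model n l :: 'k rep)"
  shows "card (fibre n l W 0) = 1"
proof -
  have ind: "lift_family n l W 0 C = lift_family n l W 0 {}" for C
    by (rule ext) (auto simp: lift_family_def restrict_def verts_def)
  have "lift_family n l W 0 {} \<in> fibre n l W 0" using lift_family_in_fibre(1)[OF n W] by simp
  moreover have "U = lift_family n l W 0 {}" if "U \<in> fibre n l W 0" for U
    using fibre_eq_lift_family(1)[OF n that] ind by metis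
  ultimately have "fibre n l W 0 = {lift_family n l W 0 {}}" by blast
  then show ?thesis by simp
qed

text \<open>By \<open>complements_count\<close> the number is the cardinality of \<open>W k\<close>,
  divided by that of the prescribed subspace at the pivot. The latter is trivial below the sink and
  equals \<open>W 1\<close> at the sink; if \<open>W 1\<close> contains \<open>unit0\<close>, no
  complement can contain \<open>W 1\<close>.\<close>

lemma card_fibre:
  assumes W: "W \<in> subreps n (model n l :: 'k rep)" and k: "k \<le> 2 * n"
  shows "real (card (fibre n l W k)) =
    (if k = 2 * n then if unit0 \<in> W 1 then 0
       else real CARD('k) powr real_of_int (dim_family n W (2 * n) - dim_family n W 1)
     else real CARD('k) powr real_of_int (dim_family n W k))"
proof -
  have m: "real CARD('k) > 0" using fin finite_UNIV_card_ge_0 by simp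
  have v: "1 \<in> verts n" "2 * n \<in> verts n" using n by (auto simp: verts_def)
  consider "k = 0" | "k \<in> verts n" "k < 2 * n" | "k = 2 * n" using k by (fastforce simp: verts_def)
  then show ?thesis
  proof cases
    case 1
    \<comment> \<open>There is no vertex 0 and \<open>dim_family\<close> is 0 there, so the general
      formula correctly yields 1.\<close>
    then show ?thesis using card_fibre_0[OF W] n m by (simp add: dim_family_def verts_def)
  next
    case 2
    note sub = model_subrepD(2)[OF n W 2(1)] and f = finite_model_subrep[OF W 2(1)]
    have "fn.subspace (shift -` W k)" by (rule subspace_vimage) (simp_all add: sub)
    moreover have "unit0 \<in> shift -` W k" "0 \<in> shift -` W k" using fn.subspace_0[OF sub] by simp_all
    moreover have "pivot_base n W k = {0}" using 2(2) by (simp add: pivot_base_def)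
    ultimately have "card (fibre n l W k) * card {0 :: nat \<Rightarrow> 'k} * CARD('k) = card (shift -` W k)"
      unfolding card_fibre_pivot[OF W 2(1)]
      by (simp only:) (rule complements_count[OF fin], auto simp: card_shift_vimage(1)[OF fin f])
    then have "card (fibre n l W k) = card (W k)"
      using m by (simp add: card_shift_vimage(2)[OF fin f])
    then show ?thesis
      using 2 m fn.card_subspace[OF fin f sub] by (simp add: dim_family_def powr_realpow)
  next
    case 3
    note sub = model_subrepD(2)[OF n W v(1)] model_subrepD(2)[OF n W v(2)]
      and f = finite_model_subrep[OF W v(1)] finite_model_subrep[OF W v(2)]
    show ?thesis
    proof (cases "unit0 \<in> W 1")
      case True
      then have "complements unit0 (pivot_base n W k) (shift -` W k) = {}"
        using 3 by (auto simp: complements_def pivot_base_def)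
      then show ?thesis using 3 True card_fibre_pivot[OF W] v by simp
    next
      case False
      have "fn.subspace (shift -` W (2 * n))" by (rule subspace_vimage) (simp_all add: sub)
      moreover have "unit0 \<in> shift -` W (2 * n)" using fn.subspace_0[OF sub(2)] by simp
      moreover have "W 1 \<subseteq> shift -` W (2 * n)" using model_subrepD(6)[OF n W] by auto
      ultimately have "card (fibre n l W (2 * n)) * card (W 1) * CARD('k) = card (shift -` W (2 * n))"
        unfolding card_fibre_pivot[OF W v(2)] using False sub(1) card_shift_vimage(1)[OF fin f(2)]
        unfolding pivot_base_def by (simp only: if_True refl) (intro complements_count[OF fin])
      then have "card (fibre n l W (2 * n)) * card (W 1) = card (W (2 * n))"
        using m by (simp add: card_shift_vimage(2)[OF fin f(2)])
      then have "real (card (fibre n l W (2 * n))) * real (card (W 1)) = real (card (W (2 * n)))"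
        by (metis of_nat_mult)
      moreover have "real (card (W i)) = real CARD('k) powr real_of_int (dim_family n W i)"
        if "i \<in> {1, 2 * n}" for i
        using that fn.card_subspace[OF fin f(1) sub(1)] fn.card_subspace[OF fin f(2) sub(2)] v m
        by (auto simp: dim_family_def powr_realpow)
      ultimately have "real (card (fibre n l W (2 * n))) =
          real CARD('k) powr real_of_int (dim_family n W (2 * n) - dim_family n W 1)"
        using m by (simp add: powr_diff field_simps)
      then show ?thesis using 3 False by simp
    qed
  qed
qed

text \<open>The summand is constant on each fibre. The inner sum is kept because the values of
  \<open>F\<close> need not admit scalars; in the torus \<open>sum_const_qt\<close> turns it into a
  multiple.\<close>

lemma sum_subreps_model_Suc:
  "(\<Sum>U\<in>subreps n (model n (Suc l) :: 'k rep). F (dim_family n U)) =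
   (\<Sum>W\<in>subreps n (model n l :: 'k rep). \<Sum>k\<le>2 * n.
      (\<Sum>U\<in>fibre n l W k. F (dim_family n W + tail n k)))"
proof -
  have "(\<lambda>U. (shift_family n U, level n U)) ` subreps n (model n (Suc l) :: 'k rep)
      \<subseteq> subreps n (model n l) \<times> {..2 * n}"
  proof clarify
    fix U assume U: "U \<in> subreps n (model n (Suc l) :: 'k rep)"
    have "1 \<in> verts n" using n by (simp add: verts_def)
    then show "shift_family n U \<in> subreps n (model n l) \<and> level n U \<in> {..2 * n}"
      using shift_family_subrep[OF n U] unit0_mem_iff_level(2)[OF n U] by simp
  qed
  then have "(\<Sum>U\<in>subreps n (model n (Suc l) :: 'k rep). F (dim_family n U)) =
      (\<Sum>p\<in>subreps n (model n l :: 'k rep) \<times> {..2 * n}.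
        \<Sum>U\<in>{U \<in> subreps n (model n (Suc l)). (shift_family n U, level n U) = p}. F (dim_family n U))"
    using finite_subreps_model by (intro sum.group[symmetric]) auto
  also have "\<dots> = (\<Sum>(W, k)\<in>subreps n (model n l :: 'k rep) \<times> {..2 * n}.
        \<Sum>U\<in>fibre n l W k. F (dim_family n U))"
    by (intro sum.cong refl) (auto simp: fibre_def)
  also have "\<dots> = (\<Sum>W\<in>subreps n (model n l :: 'k rep). \<Sum>k\<le>2 * n.
      (\<Sum>U\<in>fibre n l W k. F (dim_family n W + tail n k)))"
    unfolding sum.cartesian_product[symmetric]
    by (intro sum.cong refl arg_cong[where f = F] fibre_dim_family)
  finally show ?thesis .
qed

text \<open>Containing \<open>unit0\<close> at the vertex 1 means level 0, and the fibres of level 0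
  are single points: these submodules correspond to those of the quotient by E(0).\<close>

lemma sum_subreps_model_unit0:
  "(\<Sum>U | U \<in> subreps n (model n (Suc l) :: 'k rep) \<and> unit0 \<in> U 1. F (dim_family n U)) =
   (\<Sum>W\<in>subreps n (model n l :: 'k rep). F (dim_family n W + delta n))"
proof -
  let ?S = "{U. U \<in> subreps n (model n (Suc l) :: 'k rep) \<and> unit0 \<in> U 1}"
  have v: "1 \<in> verts n" using n by (simp add: verts_def)
  have "(\<Sum>U\<in>?S. F (dim_family n U)) =
      (\<Sum>W\<in>subreps n (model n l :: 'k rep). \<Sum>U\<in>{U \<in> ?S. shift_family n U = W}. F (dim_family n U))"
    using finite_subreps_model shift_family_subrep[OF n] by (intro sum.group[symmetric]) auto
  also have "\<dots> = (\<Sum>W\<in>subreps n (model n l :: 'k rep). \<Sum>U\<in>fibre n l W 0. F (dim_family n U))"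
  proof (intro sum.cong refl)
    show "{U \<in> ?S. shift_family n U = W} = fibre n l W 0" for W
      using unit0_mem_iff_level(1)[OF n _ v] by (auto simp: fibre_def)
  qed
  also have "\<dots> = (\<Sum>W\<in>subreps n (model n l :: 'k rep). F (dim_family n W + delta n))"
  proof (intro sum.cong refl)
    fix W assume W: "W \<in> subreps n (model n l :: 'k rep)"
    have "(\<Sum>U\<in>fibre n l W 0. F (dim_family n U)) = (\<Sum>U\<in>fibre n l W 0. F (dim_family n W + delta n))"
      using fibre_dim_family by (intro sum.cong refl) (simp add: tail_0)
    also obtain U where "fibre n l W 0 = {U}" using card_fibre_0[OF W] card_1_singletonE by blast
    then have "(\<Sum>U\<in>fibre n l W 0. F (dim_family n W + delta n)) = F (dim_family n W + delta n)" by simp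
    finally show "(\<Sum>U\<in>fibre n l W 0. F (dim_family n U)) = F (dim_family n W + delta n)" .
  qed
  finally show ?thesis .
qed

end

section \<open>The quantum torus\<close>

text \<open>The support of a sum may be smaller than the union of the supports. Additivity of the
  product is therefore proved over a common index set.\<close>

lemma qt_mult_superset:
  assumes "finite A" "Poly_Mapping.keys x \<subseteq> A" "finite B" "Poly_Mapping.keys y \<subseteq> B"
  shows "qt_mult n q x y = (\<Sum>e\<in>A. \<Sum>f\<in>B. Poly_Mapping.single (e + f)
    (real q powr (real_of_int (bilin n Lam e f) / 2) * (Poly_Mapping.lookup x e * Poly_Mapping.lookup y f)))"
proof -
  have "qt_mult n q x y = (\<Sum>e\<in>Poly_Mapping.keys x. \<Sum>f\<in>B. Poly_Mapping.single (e + f)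
    (real q powr (real_of_int (bilin n Lam e f) / 2) * (Poly_Mapping.lookup x e * Poly_Mapping.lookup y f)))"
    unfolding qt_mult_def
    by (intro sum.cong refl sum.mono_neutral_left) (use assms in \<open>auto simp: in_keys_iff\<close>)
  also have "\<dots> = (\<Sum>e\<in>A. \<Sum>f\<in>B. Poly_Mapping.single (e + f)
    (real q powr (real_of_int (bilin n Lam e f) / 2) * (Poly_Mapping.lookup x e * Poly_Mapping.lookup y f)))"
    by (intro sum.mono_neutral_left) (use assms in \<open>auto simp: in_keys_iff\<close>)
  finally show ?thesis .
qed

lemma qt_mult_add_left: "qt_mult n q (x + x') y = qt_mult n q x y + qt_mult n q x' y"
proof -
  let ?A = "Poly_Mapping.keys x \<union> Poly_Mapping.keys x'" and ?B = "Poly_Mapping.keys y"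
  have "Poly_Mapping.keys (x + x') \<subseteq> ?A" by (rule Poly_Mapping.keys_add)
  then show ?thesis
    by (subst (1 2 3) qt_mult_superset[of ?A _ ?B])
      (auto simp: lookup_add single_add[symmetric] sum.distrib[symmetric] algebra_simps)
qed

lemma qt_mult_add_right: "qt_mult n q x (y + y') = qt_mult n q x y + qt_mult n q x y'"
proof -
  let ?B = "Poly_Mapping.keys y \<union> Poly_Mapping.keys y'" and ?A = "Poly_Mapping.keys x"
  have "Poly_Mapping.keys (y + y') \<subseteq> ?B" by (rule Poly_Mapping.keys_add)
  then show ?thesis
    by (subst (1 2 3) qt_mult_superset[of ?A _ ?B])
      (auto simp: lookup_add single_add[symmetric] sum.distrib[symmetric] algebra_simps)
qed

lemma qt_mult_sum:
  "qt_mult n q (\<Sum>i\<in>I. f i) (\<Sum>j\<in>J. g j) = (\<Sum>i\<in>I. \<Sum>j\<in>J. qt_mult n q (f i) (g j))"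
proof -
  have "qt_mult n q 0 y = 0" "qt_mult n q x 0 = 0" for x y by (simp_all add: qt_mult_def)
  note zero = this
  have right: "qt_mult n q x (\<Sum>j\<in>J. g j) = (\<Sum>j\<in>J. qt_mult n q x (g j))" for x
    by (induction J rule: infinite_finite_induct) (simp_all add: qt_mult_add_right zero)
  have left: "qt_mult n q (\<Sum>i\<in>I. f i) y = (\<Sum>i\<in>I. qt_mult n q (f i) y)" for y
    by (induction I rule: infinite_finite_induct) (simp_all add: qt_mult_add_left zero)
  show ?thesis by (subst left) (simp add: right)
qed

lemma qt_mult_single:
  "qt_mult n q (Poly_Mapping.single e a) (Poly_Mapping.single f b) =
   Poly_Mapping.single (e + f) (real q powr (real_of_int (bilin n Lam e f) / 2) * (a * b))"
  by (subst qt_mult_superset[of "{e}" _ "{f}"]) auto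

lemma qt_scale_lookup: "Poly_Mapping.lookup (qt_scale c x) e = c * Poly_Mapping.lookup x e"
  by (simp add: qt_scale_def Poly_Mapping.map.rep_eq when_def)

lemma qt_scale_add: "qt_scale c (x + y) = qt_scale c x + qt_scale c y"
  by (rule poly_mapping_eqI) (simp add: qt_scale_lookup lookup_add algebra_simps)

lemma qt_scale_single: "qt_scale c (Poly_Mapping.single e a) = Poly_Mapping.single e (c * a)"
  by (rule poly_mapping_eqI) (simp add: qt_scale_lookup lookup_single when_def)

lemma qt_scale_sum: "qt_scale c (\<Sum>i\<in>I. f i) = (\<Sum>i\<in>I. qt_scale c (f i))"
proof -
  have "qt_scale c 0 = 0" by (rule poly_mapping_eqI) (simp add: qt_scale_lookup)
  then show ?thesis by (induction I rule: infinite_finite_induct) (simp_all add: qt_scale_add)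
qed

section \<open>The compatible pair of matrices and the exponents of \<open>q\<close>\<close>

abbreviation Bvec :: "nat \<Rightarrow> ivec \<Rightarrow> ivec" where
  "Bvec n \<equiv> mat_vec n (Bmat n)"

abbreviation Cvec :: "nat \<Rightarrow> ivec \<Rightarrow> ivec" where
  "Cvec n \<equiv> mat_vec n (I_minus_Rtr n)"

abbreviation Cform :: "nat \<Rightarrow> ivec \<Rightarrow> ivec \<Rightarrow> int" where
  "Cform n \<equiv> bilin n (I_minus_Rtr n)"

lemma mat_vec_add: "mat_vec n M (v + w) = mat_vec n M v + mat_vec n M w"
  and mat_vec_diff: "mat_vec n M (v - w) = mat_vec n M v - mat_vec n M w"
  by (auto simp: mat_vec_def fun_eq_iff algebra_simps sum.distrib sum_subtractf)

lemma bilin_add_left: "bilin n M (v + v') w = bilin n M v w + bilin n M v' w"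
  and bilin_add_right: "bilin n M v (w + w') = bilin n M v w + bilin n M v w'"
  and bilin_diff_left: "bilin n M (v - v') w = bilin n M v w - bilin n M v' w"
  and bilin_diff_right: "bilin n M v (w - w') = bilin n M v w - bilin n M v w'"
  by (auto simp: bilin_def mat_vec_add mat_vec_diff algebra_simps sum.distrib sum_subtractf)

lemma bilin_minus_left: "bilin n M (- v) w = - bilin n M v w"
  and bilin_minus_right: "bilin n M v (- w) = - bilin n M v w"
  by (simp_all add: bilin_def mat_vec_def sum_negf cong: if_cong)

lemmas bilin_simps = bilin_add_left bilin_add_right bilin_diff_left bilin_diff_right
  bilin_minus_left bilin_minus_right

lemma bilin_sum: "bilin n M v w = (\<Sum>i\<in>verts n. \<Sum>j\<in>verts n. v i * M i j * w j)"
  by (auto simp: bilin_def mat_vec_def sum_distrib_left mult.assoc intro!: sum.cong)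

lemma arrows_iff:
  assumes "i \<in> verts n"
  shows "(i, j) \<in> arrows n \<longleftrightarrow> j = Suc i \<and> i < 2 * n \<or> i = 1 \<and> j = 2 * n"
  using assms by (auto simp: arrows_def verts_def)

lemma mat_vec_I_minus_Rtr:
  assumes n: "n \<ge> 2" and i: "i \<in> verts n"
  shows "Cvec n v i =
    v i - (if i < 2 * n then v (Suc i) else 0) - (if i = 1 then v (2 * n) else 0)"
proof -
  have "(I_minus_Rtr n i j) * v j = (if j = i then v j else 0)
      - (if j = Suc i then if i < 2 * n then v j else 0 else 0) - (if j = 2 * n then if i = 1 then v j else 0 else 0)" for j
    using n arrows_iff[OF i, of j] by (auto simp: I_minus_Rtr_def Rmat_def)
  then show ?thesis
    using i n by (auto simp: mat_vec_def sum_subtractf verts_def sum.delta)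
qed

text \<open>The first form isolates the nonzero entries for summation. The second says that B is the
  antisymmetrised Euler matrix, which turns pairings with B into Euler pairings.\<close>

lemma Bmat_eq:
  assumes "n \<ge> 2" "i \<in> verts n" "j \<in> verts n"
  shows "Bmat n i j = of_bool (j = Suc i) + of_bool (i = 1 \<and> j = 2 * n)
      - of_bool (i = Suc j) - of_bool (j = 1 \<and> i = 2 * n)"
    and "Bmat n i j = I_minus_Rtr n j i - I_minus_Rtr n i j"
proof -
  show B: "Bmat n i j = of_bool (j = Suc i) + of_bool (i = 1 \<and> j = 2 * n)
      - of_bool (i = Suc j) - of_bool (j = 1 \<and> i = 2 * n)"
    using assms by (auto simp: Bmat_def skew_def verts_def)
  show "Bmat n i j = I_minus_Rtr n j i - I_minus_Rtr n i j"
    unfolding B using assms arrows_iff[OF assms(2), of j] arrows_iff[OF assms(3), of i]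
    by (auto simp: I_minus_Rtr_def Rmat_def verts_def)
qed

lemma sum_of_bool_pick:
  fixes f :: "'a \<Rightarrow> int"
  assumes "finite S" "P \<Longrightarrow> a \<in> S"
  shows "(\<Sum>j\<in>S. of_bool (j = a \<and> P) * f j) = of_bool P * f a"
proof (cases P)
  case True
  then have "(\<Sum>j\<in>S. of_bool (j = a \<and> P) * f j) = (\<Sum>j\<in>S. if j = a then f j else 0)"
    by (intro sum.cong refl) simp
  then show ?thesis using assms True by simp
qed simp

text \<open>The compatibility relation \<Lambda>B = -2I. A column of B has its two nonzero entries
  at the neighbours of \<open>k\<close> on the cycle. For 1 < \<open>k\<close> <
  \<open>2 * n\<close> these neighbours have the same parity, so their contributions cancel unless
  \<open>k\<close> lies at \<open>i\<close>, between them; at the ends the parities differ, and so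
  do the signs.\<close>

lemma Lam_Bmat:
  assumes n: "n \<ge> 2" and i: "i \<in> verts n" and k: "k \<in> verts n"
  shows "(\<Sum>j\<in>verts n. Lam i j * Bmat n j k) = (if i = k then - 2 else 0)"
proof -
  have fv: "finite (verts n)" by (simp add: verts_def)
  have "Lam i j * Bmat n j k = of_bool (j = k - 1 \<and> 2 \<le> k) * Lam i j + of_bool (j = 1 \<and> k = 2 * n) * Lam i j
      - of_bool (j = Suc k \<and> k < 2 * n) * Lam i j - of_bool (j = 2 * n \<and> k = 1) * Lam i j" if j: "j \<in> verts n" for j
  proof -
    \<comment> \<open>Each index equation is rewritten as \<open>j = a\<close> under a side
      condition that makes \<open>a\<close> a vertex, the form that \<open>sum_of_bool_pick\<close>
      requires.\<close>
    have "k = Suc j \<longleftrightarrow> j = k - 1 \<and> 2 \<le> k" "j = Suc k \<longleftrightarrow> j = Suc k \<and> k < 2 * n"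
      "k = 1 \<and> j = 2 * n \<longleftrightarrow> j = 2 * n \<and> k = 1"
      using j by (auto simp: verts_def)
    then show ?thesis unfolding Bmat_eq(1)[OF n j k] by (simp only: algebra_simps)
  qed
  then have "(\<Sum>j\<in>verts n. Lam i j * Bmat n j k) = of_bool (2 \<le> k) * Lam i (k - 1) + of_bool (k
      = 2 * n) * Lam i 1
      - of_bool (k < 2 * n) * Lam i (Suc k) - of_bool (k = 1) * Lam i (2 * n)"
    using n k by (simp only: sum_subtractf sum.distrib cong: sum.cong) (subst (1 2 3 4) sum_of_bool_pick[OF fv], auto simp: verts_def)
  also have "\<dots> = (if i = k then - 2 else 0)"
  proof -
    consider "k = 1" | "k = 2 * n" "k \<ge> 2" | "2 \<le> k" "k < 2 * n" using k n by (auto simp: verts_def; linarith)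
    then show ?thesis
    proof cases
      case 1
      have "- Lam i (Suc k) - Lam i (2 * n) = (if i = k then - 2 else 0)"
        using i n 1 by (cases "i = 2") (auto simp: Lam_def skew_def verts_def)
      moreover have "\<not> 2 \<le> k" "k \<noteq> 2 * n" "k < 2 * n" using 1 n by auto
      ultimately show ?thesis using 1 by simp
    next
      case 2
      have "Lam i (2 * n - 1) + Lam i 1 = (if i = 2 * n then - 2 else 0)"
        using i n by (cases "i = 2 * n - 1") (auto simp: Lam_def skew_def verts_def)
      then show ?thesis using 2 n by simp
    next
      case 3
      have "Lam i (k - 1) - Lam i (Suc k) = (if i = k then - 2 else 0)"
      proof -
        consider "i < k - 1" | "i = k - 1" | "i = k" | "i = Suc k" | "i > Suc k" by linarith
        then show ?thesis using 3 by cases (auto simp: Lam_def skew_def)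
      qed
      then show ?thesis using 3 by simp
    qed
  qed
  finally show ?thesis .
qed

lemma bilin_Lam_Bmat_right:
  assumes "n \<ge> 2"
  shows "bilin n Lam u (Bvec n f) = - 2 * (\<Sum>i\<in>verts n. u i * f i)"
proof -
  have "bilin n Lam u (Bvec n f)
      = (\<Sum>i\<in>verts n. \<Sum>j\<in>verts n. \<Sum>k\<in>verts n. u i * Lam i j * (Bmat n j k * f k))"
    unfolding bilin_sum by (intro sum.cong refl) (simp add: mat_vec_def sum_distrib_left)
  also have "\<dots> = (\<Sum>i\<in>verts n. \<Sum>k\<in>verts n. u i * (\<Sum>j\<in>verts n. Lam i j * Bmat n j k) * f k)"
    by (rule sum.cong[OF refl], subst sum.swap) (simp add: sum_distrib_left sum_distrib_right mult.assoc)
  also have "\<dots> = (\<Sum>i\<in>verts n. \<Sum>k\<in>verts n. if k = i then - 2 * (u k * f k) else 0)"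
    by (intro sum.cong refl) (use Lam_Bmat[OF assms] in auto)
  also have "\<dots> = - 2 * (\<Sum>i\<in>verts n. u i * f i)"
    by (simp add: sum_distrib_left verts_def)
  finally show ?thesis .
qed

lemma bilin_Lam_skew: "bilin n Lam v u = - bilin n Lam u v"
proof -
  have skew: "v j * Lam j i * u i = - (u i * Lam i j * v j)" for i j
    by (auto simp: Lam_def skew_def)
  show ?thesis
    unfolding bilin_sum sum_negf[symmetric]
    by (subst sum.swap) (simp only: skew)
qed

lemma dot_Bmat:
  assumes "n \<ge> 2"
  shows "(\<Sum>i\<in>verts n. Bvec n e i * f i) = Cform n e f - Cform n f e"
proof -
  have "(\<Sum>i\<in>verts n. Bvec n e i * f i) = (\<Sum>i\<in>verts n. \<Sum>j\<in>verts n. Bmat n i j * e j * f i)"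
    by (intro sum.cong refl) (simp add: mat_vec_def sum_distrib_right)
  also have "\<dots> = (\<Sum>i\<in>verts n. \<Sum>j\<in>verts n. e j * I_minus_Rtr n j i * f i)
      - (\<Sum>i\<in>verts n. \<Sum>j\<in>verts n. f i * I_minus_Rtr n i j * e j)"
    unfolding sum_subtractf[symmetric]
    by (intro sum.cong refl) (simp add: Bmat_eq(2)[OF assms] algebra_simps)
  also have "(\<Sum>i\<in>verts n. \<Sum>j\<in>verts n. e j * I_minus_Rtr n j i * f i) = Cform n e f"
    unfolding bilin_sum by (rule sum.swap)
  finally show ?thesis unfolding bilin_sum .
qed

lemma dot_I_minus_Rtr: "(\<Sum>i\<in>verts n. mat_vec n M v i * f i) = bilin n M f v"
  by (simp add: bilin_def mult.commute)

text \<open>The arrows \<open>i \<rightarrow> i + 1\<close> telescope to \<open>v 1\<close>; the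
  remaining arrow subtracts \<open>v (2 * n)\<close>.\<close>

lemma sum_mat_vec_I_minus_Rtr:
  assumes n: "n \<ge> 2"
  shows "(\<Sum>i\<in>verts n. Cvec n v i) = v 1 - v (2 * n)"
proof -
  have split: "verts n = insert (2 * n) {1..<2 * n}" using n by (auto simp: verts_def)
  have "(\<Sum>i\<in>verts n. Cvec n v i) = (\<Sum>i\<in>verts n. (v i - (if i < 2 * n then v (Suc i) else 0))
      - (if i = 1 then v (2 * n) else 0))"
    by (intro sum.cong refl) (simp add: mat_vec_I_minus_Rtr[OF n])
  also have "\<dots> = (\<Sum>i\<in>verts n. v i - (if i < 2 * n then v (Suc i) else 0)) - v (2 * n)"
    using n by (simp add: sum_subtractf verts_def)
  also have "(\<Sum>i\<in>verts n. v i - (if i < 2 * n then v (Suc i) else 0)) = v (2 * n) + (\<Sum>i=1..<2 * n. v i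
      - v (Suc i))"
    unfolding split by simp
  also have "(\<Sum>i=1..<2 * n. v i - v (Suc i)) = v 1 - v (2 * n)"
    using sum_Suc_diff'[of 1 "2 * n" "\<lambda>i. - v i"] n by simp
  finally show ?thesis by simp
qed

text \<open>\<open>Cvec n (delta n)\<close> is the unit vector at \<open>2 * n\<close> minus the one
  at 1, and \<Lambda> pairs every unit vector with it to 1. So the pairing sums the coordinates of
  the left argument.\<close>

lemma bilin_Lam_delta:
  assumes n: "n \<ge> 2"
  shows "bilin n Lam (Cvec n v) (Cvec n (delta n)) = v 1 - v (2 * n)"
proof -
  let ?C = "I_minus_Rtr n"
  have d: "mat_vec n ?C (delta n) j = (if j = 2 * n then 1 else 0) - (if j = 1 then 1 else 0)" if "j \<in> verts n"
      for j
    unfolding mat_vec_I_minus_Rtr[OF n that] using that n by (auto simp: delta_def verts_def)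
  have L: "Lam i (2 * n) - Lam i 1 = 1" if "i \<in> verts n" for i
    using that n by (cases "i = 2 * n") (auto simp: Lam_def skew_def verts_def)
  have "bilin n Lam u (mat_vec n ?C (delta n)) = (\<Sum>i\<in>verts n. u i)" for u
  proof -
    have "bilin n Lam u (mat_vec n ?C (delta n)) = (\<Sum>i\<in>verts n. \<Sum>j\<in>verts n.
        (if j = 2 * n then u i * Lam i j else 0) - (if j = 1 then u i * Lam i j else 0))"
      unfolding bilin_sum by (intro sum.cong refl) (simp add: d)
    also have "\<dots> = (\<Sum>i\<in>verts n. u i * (Lam i (2 * n) - Lam i 1))"
      using n by (intro sum.cong refl) (simp add: sum_subtractf verts_def algebra_simps)
    finally show ?thesis by (simp only: L mult_1_right cong: sum.cong)
  qed
  then show ?thesis using sum_mat_vec_I_minus_Rtr[OF n] by simp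
qed

text \<open>For 0 < \<open>k\<close> < \<open>2 * n\<close> the right argument is the dimension
  vector of I_k, and pairing with it reads off the entry at \<open>k\<close>. The values are the
  exponents in \<open>card_fibre\<close>; \<open>e 0 = 0\<close> takes care of
  \<open>k = 0\<close>.\<close>

lemma bilin_delta_minus_tail:
  assumes n: "n \<ge> 2" and k: "k \<le> 2 * n" and e0: "e 0 = 0"
  shows "Cform n e (delta n - tail n k) = (if k = 2 * n then e (2 * n) - e 1 else e k)"
proof -
  have "Cvec n (delta n - tail n k) i = (if i = k then 1 else 0) - (if i = 1 then if k
      = 2 * n then 1 else 0 else 0)"
    if "i \<in> verts n" for i
    unfolding mat_vec_I_minus_Rtr[OF n that] using that n k by (auto simp: delta_def verts_def tail_def)
  then have "Cform n e (delta n - tail n k) = (\<Sum>i\<in>verts n. (if i = k then e i else 0)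
      - (if i = 1 then if k = 2 * n then e i else 0 else 0))"
    unfolding bilin_def by (intro sum.cong refl) auto
  also have "\<dots> = (if k = 2 * n then e (2 * n) - e 1 else e k)"
  proof -
    have "n \<noteq> 0" using n by simp
    then show ?thesis using k e0 by (cases "k = 0"; cases "k
        = 2 * n") (auto simp: sum_subtractf verts_def cong: if_cong)
  qed
  finally show ?thesis .
qed

text \<open>The contribution of a single submodule to a character. Negative entries are permitted,
  for the sake of a virtual representation used later.\<close>

definition qterm :: "nat \<Rightarrow> nat \<Rightarrow> ivec \<Rightarrow> ivec \<Rightarrow> qtorus" where
  "qterm n q v e = Poly_Mapping.single (- Bvec n e - Cvec n v)
     (real q powr (- real_of_int (euler n e (v - e)) / 2))"

text \<open>The condition on \<open>v\<close> enters through \<open>bilin_Lam_delta\<close> and is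
  the source of the factor q^(1/2). The rest of the scalar is a power of q^2, to be matched with the
  number of elements of a fibre.\<close>

lemma qt_mult_qterm:
  assumes n: "n \<ge> 2" and q: "q > 0" and v: "v 1 - v (2 * n) = 1"
  shows "qt_mult n q (qterm n q v e) (qterm n q (delta n) f) =
    qt_scale (real q powr (1 / 2 + 2 * real_of_int (Cform n e (delta n - f))))
      (qterm n q (v + delta n) (e + f))"
proof -
  let ?B = "Bvec n" and ?C = "Cvec n" and ?b = "Cform n"
  let ?L = "bilin n Lam"
  have BB: "?L (?B e) (?B f) = - 2 * (?b e f - ?b f e)"
    unfolding bilin_Lam_Bmat_right[OF n] dot_Bmat[OF n] ..
  have BC: "?L (?B e) (?C w) = 2 * ?b e w" for w
    using bilin_Lam_skew[of n "?B e" "?C w"] by (simp add: bilin_Lam_Bmat_right[OF n] dot_I_minus_Rtr)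
  have CB: "?L (?C w) (?B f) = - 2 * ?b f w" for w
    by (simp add: bilin_Lam_Bmat_right[OF n] dot_I_minus_Rtr)
  have L: "?L (- ?B e - ?C v) (- ?B f - ?C (delta n)) =
      2 * (?b f e - ?b e f) + 2 * ?b e (delta n) - 2 * ?b f v + 1"
    using bilin_Lam_delta[OF n, of v] v by (simp add: bilin_simps BB BC CB)
  \<comment> \<open>Of the four copies of \<open>?b e (delta n - f)\<close> two come from \<Lambda>;
    the other two offset the cross term of the Euler form of the sums. The cross term in the
    opposite order cancels.\<close>
  have "?L (- ?B e - ?C v) (- ?B f - ?C (delta n)) - euler n e (v - e) - euler n f (delta n - f)
      = 1 + 4 * ?b e (delta n - f) - euler n (e + f) (v + delta n - (e + f))"
    unfolding L euler_def by (simp add: bilin_simps)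
  moreover have "real_of_int A / 2 + (- real_of_int E1 / 2 + - real_of_int E2 / 2) = (1 / 2 + 2 * real_of_int b)
      + - real_of_int E3 / 2"
    if "A - E1 - E2 = 1 + 4 * b - E3" for A E1 E2 E3 b :: int
  proof -
    have "A = 1 + 4 * b - E3 + E1 + E2" using that by simp
    then show ?thesis by (simp add: field_simps)
  qed
  ultimately have *: "real_of_int (?L (- ?B e - ?C v) (- ?B f - ?C (delta n))) / 2
      + (- real_of_int (euler n e (v - e)) / 2 + - real_of_int (euler n f (delta n - f)) / 2)
      = (1 / 2 + 2 * real_of_int (?b e (delta n - f))) + - real_of_int (euler n (e + f) (v + delta n - (e + f))) / 2"
    by blast
  have "(- ?B e - ?C v) + (- ?B f - ?C (delta n)) = - ?B (e + f) - ?C (v + delta n)"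
    by (simp add: mat_vec_add)
  then show ?thesis
    unfolding qterm_def qt_mult_single qt_scale_single
    by (simp only: powr_add[symmetric] *)
qed

section \<open>Cluster characters as sums over subrepresentations\<close>

lemma dim_zero_space: "fn.dim {0 :: 'b \<Rightarrow> 'k::field} = 0"
  using fn.dim_eq_card[of "{}" "{0}"] by (simp add: fn.independent_empty)

lemma dim_line: "b \<noteq> 0 \<Longrightarrow> fn.dim (range (\<lambda>c. fscale c b)) = 1"
  using fn.dim_eq_card[of "{b}" "range (\<lambda>c. fscale c b)"]
  by (simp add: fn.span_singleton[symmetric] fn.span_span)

lemma dim_top_zero_rep: "dim_top n (zero_rep :: (unit, 'k::field) qrep) = 0"
proof -
  have "rad n zero_rep i = {0 :: unit \<Rightarrow> 'k}" if "i \<in> verts n" for i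
  proof -
    have "0 \<in> U i" if "maximal_subrep n (zero_rep :: (unit, 'k) qrep) U" for U
    proof -
      have "U \<in> subreps n (zero_rep :: (unit, 'k) qrep)" using that by (simp add: maximal_subrep_def)
      then show ?thesis using subrepsD(2) \<open>i \<in> verts n\<close> fn.subspace_0 by metis
    qed
    then show ?thesis by (auto simp: rad_def zero_rep_def)
  qed
  then show ?thesis
    by (auto simp: dim_top_def dimvec_def dim_family_def zero_rep_def dim_zero_space fun_eq_iff)
qed

lemma zero_rep_subreps:
  assumes "n \<ge> 1"
  shows "subreps n (zero_rep :: (unit, 'k::field) qrep) = {\<lambda>i\<in>verts n. {0}}"
proof -
  have "fn.subspace W \<and> W \<subseteq> {0} \<longleftrightarrow> W = {0}" for W :: "(unit \<Rightarrow> 'k) set"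
    using fn.subspace_0 by (auto simp: fn.subspace_single_0)
  then have P: "(\<Pi>\<^sub>E i\<in>verts n. {W. fn.subspace W \<and> W \<subseteq> sp (zero_rep :: (unit, 'k) qrep) i})
      = {\<lambda>i\<in>verts n. {0}}"
    by (simp add: zero_rep_def PiE_singleton restrict_def PiE_over_singleton_iff)
  have Q: "\<forall>(i, j)\<in>arrows n. mp (zero_rep :: (unit, 'k) qrep) (i, j) ` (\<lambda>i\<in>verts n. {0 :: unit \<Rightarrow> 'k}) i
      \<subseteq> (\<lambda>i\<in>verts n. {0}) j"
    using assms by (auto simp: zero_rep_def arrows_def verts_def)
  show ?thesis unfolding subreps_def P using Q by (auto simp only: mem_Collect_eq singleton_iff)
qed

lemma X_shift_eq:
  fixes P :: "('c, 'k::field) qrep"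
  assumes n: "n \<ge> 1" and q: "q > 0"
  shows "X_shift n q P = Poly_Mapping.single (dim_top n P) 1"
proof -
  have d: "dimvec n (zero_rep :: (unit, 'k) qrep) = 0"
    by (auto simp: dimvec_def dim_family_def zero_rep_def dim_zero_space fun_eq_iff)
  have "Gr n (zero_rep :: (unit, 'k) qrep) 0 = {\<lambda>i\<in>verts n. {0}}"
    unfolding Gr_def zero_rep_subreps[OF n]
    by (auto simp: dim_family_def dim_zero_space fun_eq_iff)
  moreover have "euler n 0 0 = 0" "mat_vec n M 0 = 0" for M
    by (auto simp: euler_def bilin_def mat_vec_def fun_eq_iff)
  ultimately show ?thesis
    using q unfolding X_shift_def cluster_char_def Let_def d by simp
qed

text \<open>Summing over submodules instead of dimension vectors removes the Grassmannian counts, so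
  that bijections of submodules can be applied directly.\<close>

lemma X_rep_eq:
  fixes V :: "('b, 'k::field) qrep"
  assumes fin: "finite (UNIV :: 'k set)"
    and V: "\<And>i. i \<in> verts n \<Longrightarrow> finite (sp V i) \<and> fn.subspace (sp V i)"
  shows "X_rep n q V = (\<Sum>U\<in>subreps n V. qterm n q (dimvec n V) (dim_family n U))"
proof -
  let ?v = "dimvec n V"
  have fv: "finite {0..?v}"
  proof -
    \<comment> \<open>The box is an interval of functions on \<open>nat\<close>; its members vanish
      outside of the vertices, which makes it finite.\<close>
    have "inj_on (\<lambda>e. restrict e (verts n)) {0..?v}"
    proof (rule inj_onI)
      fix e f assume ef: "e \<in> {0..?v}" "f \<in> {0..?v}" "restrict e (verts n) = restrict f (verts n)"
      have "e i = f i" for i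
      proof (cases "i \<in> verts n")
        case True
        then show ?thesis using ef(3) by (metis restrict_apply')
      next
        case False
        then have "?v i = 0" by (simp add: dimvec_def dim_family_def)
        then show ?thesis using ef(1,2) unfolding atLeastAtMost_iff le_fun_def
          by (metis order_antisym zero_fun_apply)
      qed
      then show "e = f" by blast
    qed
    moreover have "(\<lambda>e. restrict e (verts n)) ` {0..?v} \<subseteq> (\<Pi>\<^sub>E i\<in>verts n. {0..?v i})"
      by (auto simp: le_fun_def)
    moreover have "finite (\<Pi>\<^sub>E i\<in>verts n. {0..?v i})"
      by (intro finite_PiE) (auto simp: verts_def)
    ultimately show ?thesis by (meson finite_imageD finite_subset)
  qed
  have fs: "finite (subreps n V)" using V by (intro finite_subreps) blast
  have sub: "fn.subspace (U i) \<and> U i \<subseteq> sp V i" if "U \<in> subreps n V" "i \<in> verts n" for U i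
    using subrepsD(2,3)[OF that] by blast
  have box: "dim_family n U \<in> {0..?v}" if U: "U \<in> subreps n V" for U
  proof -
    have "fn.dim (U i) \<le> fn.dim (sp V i)" if i: "i \<in> verts n" for i
    proof -
      have "finite (U i)" using sub[OF U i] V[OF i] finite_subset by blast
      then have "CARD('k) ^ fn.dim (U i) \<le> CARD('k) ^ fn.dim (sp V i)"
        using sub[OF U i] V[OF i] card_mono[of "sp V i" "U i"]
        by (simp add: fn.card_subspace[OF fin, symmetric])
      then show ?thesis using card_gt_one_field[OF fin] by simp
    qed
    then show ?thesis by (auto simp: le_fun_def dimvec_def dim_family_def)
  qed
  have const: "(\<Sum>U\<in>A. Poly_Mapping.single a r) = Poly_Mapping.single a (real (card A) * r)"
    if "finite A" for A :: "(nat \<Rightarrow> ('b \<Rightarrow> 'k) set) set" and a r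
    using that by induction (simp_all add: single_add[symmetric] algebra_simps)
  have "X_rep n q V = (\<Sum>e\<in>{0..?v}. \<Sum>U\<in>{U \<in> subreps n V. dim_family n U = e}. qterm n q ?v (dim_family n U))"
    unfolding X_rep_def cluster_char_def Let_def dim_top_zero_rep
  proof (intro sum.cong refl)
    fix e assume "e \<in> {0..?v}"
    have "(\<Sum>U\<in>{U \<in> subreps n V. dim_family n U = e}. qterm n q ?v (dim_family n U))
      = (\<Sum>U\<in>{U \<in> subreps n V. dim_family n U = e}. qterm n q ?v e)" by (intro sum.cong refl) auto
    also have "\<dots> = Poly_Mapping.single (- Bvec n e - Cvec n ?v)
        (real (card (Gr n V e)) * real q powr (- real_of_int (euler n e (?v - e)) / 2))"
      unfolding qterm_def Gr_def using fs by (intro const) auto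
    finally show "Poly_Mapping.single (- Bvec n e - Cvec n ?v + 0)
        (real (card (Gr n V e)) * real q powr (- real_of_int (euler n e (?v - e)) / 2))
      = (\<Sum>U\<in>{U \<in> subreps n V. dim_family n U = e}. qterm n q ?v (dim_family n U))" by simp
  qed
  also have "\<dots> = (\<Sum>U\<in>subreps n V. qterm n q ?v (dim_family n U))"
    using fs fv box by (intro sum.group) auto
  finally show ?thesis .
qed

text \<open>A submodule with a nonzero space at a vertex contains the lines at all later vertices up
  to \<open>p\<close>. Conversely such a tail is closed under every arrow, because arrows increase
  the vertex. The map on the arrow from 1 to \<open>2 * n\<close> thus has no influence, which is
  why the character of E(\<lambda>) does not depend on \<lambda>.\<close>

lemma sum_subreps_thin:
  fixes V :: "('b, 'k::field) qrep"
  assumes n: "n \<ge> 1" and p: "p \<le> 2 * n"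
    and V: "\<And>i. i \<in> verts n \<Longrightarrow> sp V i = (if i \<le> p then range (\<lambda>c. fscale c (b i)) else {0})"
    and b: "\<And>i. i \<in> verts n \<Longrightarrow> i \<le> p \<Longrightarrow> b i \<noteq> 0"
    and step: "\<And>i. i \<in> verts n \<Longrightarrow> i < p \<Longrightarrow> mp V (i, Suc i) (b i) = b (Suc i)"
    and lin: "\<And>i j c x. (i, j) \<in> arrows n \<Longrightarrow> mp V (i, j) (fscale c x) = fscale c (mp V (i, j) x)"
    and mp: "\<And>i j x. (i, j) \<in> arrows n \<Longrightarrow> x \<in> sp V i \<Longrightarrow> mp V (i, j) x \<in> sp V j"
  shows "(\<Sum>U\<in>subreps n V. F (dim_family n U)) = (\<Sum>k\<le>p. F (tail n k - tail n p))"
    and "dimvec n V = tail n 0 - tail n p"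
proof -
  define T where "T k = (\<lambda>i\<in>verts n. if k < i then sp V i else {0})" for k
  have sub: "fn.subspace (sp V i)" if "i \<in> verts n" for i
    using V[OF that] by (auto simp: fn.span_singleton[symmetric] fn.subspace_single_0 fn.subspace_span)
  have T_sub: "T k \<in> subreps n V" for k
  proof (rule subrepsI)
    show "fn.subspace (T k i)" "T k i \<subseteq> sp V i" if "i \<in> verts n" for i
      using that sub fn.subspace_0[OF sub] by (auto simp: T_def fn.subspace_single_0)
    fix i j x assume ij: "(i, j) \<in> arrows n" and x: "x \<in> T k i"
    have v: "i \<in> verts n" "j \<in> verts n" "i < j" using arrowsD[OF n ij] by auto
    show "mp V (i, j) x \<in> T k j"
    proof (cases "k < i")
      case True
      then show ?thesis using x mp[OF ij] v by (simp add: T_def)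
    next
      case False
      \<comment> \<open>Zero is written as a multiple of itself, so that homogeneity alone shows
        that the arrow preserves it.\<close>
      then have "x = fscale 0 0" using x v by (simp add: T_def)
      then have "mp V (i, j) x = 0" using lin[OF ij, of 0 0] by simp
      then show ?thesis using fn.subspace_0[OF sub[OF v(2)]] v by (simp add: T_def)
    qed
  qed (simp add: T_def)
  have dim: "dim_family n (T k) = tail n k - tail n p" if "k \<le> p" for k
    using that b by (auto simp: dim_family_def T_def V dim_zero_space dim_line tail_def fun_eq_iff)
  have inj: "inj_on T {..p}"
  proof (rule inj_onI)
    fix k l assume kl: "k \<in> {..p}" "l \<in> {..p}" "T k = T l"
    have "False" if "k < l" "l \<le> p" "T k = T l" for k l
    proof -
      have l: "l \<in> verts n" using that p by (simp add: verts_def)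
      have "fscale 1 (b l) \<in> sp V l" unfolding V[OF l] if_P[OF that(2)] by (rule rangeI)
      then have "b l \<in> sp V l" by simp
      then have "b l \<in> T k l" using that(1) l by (simp add: T_def)
      then have "b l \<in> T l l" unfolding that(3) .
      then show False using l b[OF l that(2)] by (simp add: T_def)
    qed
    then show "k = l" using kl by (metis atMost_iff linorder_neqE_nat)
  qed
  have surj: "U \<in> T ` {..p}" if U: "U \<in> subreps n V" for U
  proof -
    note Ui = subrepsD(2,3)[OF U]
    have full: "U i = {0} \<or> U i = sp V i \<and> b i \<in> U i" if i: "i \<in> verts n" "i \<le> p" for i
    proof (cases "U i = {0}")
      case False
      then obtain x where x: "x \<in> U i" "x \<noteq> 0" using fn.subspace_0[OF Ui(1)[OF i(1)]] by blast
      then obtain c where c: "x = fscale c (b i)" using Ui(2)[OF i(1)] V[OF i(1)] i(2) by auto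
      then have "c \<noteq> 0" using x by auto
      then have "b i \<in> U i" using subspace_scale_iff[OF Ui(1)[OF i(1)]] x c by blast
      then have "sp V i \<subseteq> U i" using V[OF i(1)] i(2) fn.subspace_scale[OF Ui(1)[OF i(1)]] by auto
      then show ?thesis using Ui(2)[OF i(1)] \<open>b i \<in> U i\<close> by blast
    qed simp
    define A where "A = {i \<in> verts n. i \<le> p \<and> U i = {0}}"
    have A: "A = {1..card A}"
    proof (rule down_closed_eq)
      show "finite A" "0 \<notin> A" by (auto simp: A_def verts_def)
      fix i j assume ij: "j \<in> A" "i \<le> j" "1 \<le> i"
      show "i \<in> A"
        using ij(2,1)
      proof (induction rule: inc_induct)
        case (step m)
        then have "Suc m \<in> A" by blast
        then have m: "m \<in> verts n" "m < p" "Suc m \<in> verts n" "U (Suc m) = {0}"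
          using step ij by (auto simp: A_def verts_def)
        have "(m, Suc m) \<in> arrows n" using m by (auto simp: arrows_def verts_def)
        moreover have "b (Suc m) \<noteq> 0" using b m by simp
        \<comment> \<open>Otherwise \<open>U (Suc m)\<close> would contain the nonzero vector
          \<open>b (Suc m)\<close>.\<close>
        ultimately have "b m \<notin> U m" using assms(5)[OF m(1,2)] m(4) subrepsD(4)[OF U] by force
        then have "U m = {0}" using full[OF m(1)] m(2) by auto
        then show ?case using m by (simp add: A_def)
      qed
    qed
    have le: "card A \<le> p"
    proof -
      have "A \<subseteq> {1..p}" by (auto simp: A_def verts_def)
      then show ?thesis using card_mono[of "{1..p}" A] by simp
    qed
    have "U = T (card A)"
    proof (rule extensionalityI[of _ "verts n"])
      fix i assume i: "i \<in> verts n"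
      have "i \<in> A \<longleftrightarrow> i \<le> card A" using i by (subst A) (auto simp: verts_def)
      then have "U i = (if card A < i then sp V i else {0})"
        using full[OF i] i Ui(2)[OF i] V[OF i] fn.subspace_0[OF Ui(1)[OF i]] by (auto simp: A_def)
      then show "U i = T (card A) i" using i by (simp add: T_def)
    qed (use subrepsD(1)[OF U] in \<open>auto simp: T_def\<close>)
    then show ?thesis using le by simp
  qed
  have "subreps n V = T ` {..p}" using T_sub surj by blast
  then have "(\<Sum>U\<in>subreps n V. F (dim_family n U)) = (\<Sum>k\<in>{..p}. F (dim_family n (T k)))"
    using inj by (simp add: sum.reindex)
  also have "\<dots> = (\<Sum>k\<le>p. F (tail n k - tail n p))" using dim by (intro sum.cong) auto
  finally show "(\<Sum>U\<in>subreps n V. F (dim_family n U)) = (\<Sum>k\<le>p. F (tail n k - tail n p))" .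
  show "dimvec n V = tail n 0 - tail n p"
    using b by (auto simp: dimvec_def dim_family_def V dim_zero_space dim_line tail_def fun_eq_iff verts_def)
qed

section \<open>Projective and injective representations\<close>

text \<open>Arrows increase the vertex, so a path visits no vertex twice; in particular there are
  only finitely many paths.\<close>

lemma paths_sorted:
  assumes "n \<ge> 1" "p \<in> paths n i j"
  shows "sorted_wrt (<) p" "p \<noteq> []" "set p \<subseteq> verts n" "hd p = i" "last p = j"
proof -
  have "successively (\<lambda>a b. (a, b) \<in> arrows n) p" using assms by (simp add: paths_def)
  then have "successively (<) p"
    by (rule successively_mono) (use assms(1) in \<open>auto simp: arrows_def\<close>)
  then show "sorted_wrt (<) p" by (simp add: successively_conv_sorted_wrt)
qed (use assms in \<open>auto simp: paths_def\<close>)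

lemma finite_paths: "n \<ge> 1 \<Longrightarrow> finite (paths n i j)"
proof -
  assume n: "n \<ge> 1"
  have "paths n i j \<subseteq> {p. set p \<subseteq> verts n \<and> distinct p}"
  proof
    fix p assume "p \<in> paths n i j"
    then show "p \<in> {p. set p \<subseteq> verts n \<and> distinct p}"
      using paths_sorted(1,3)[OF n] strict_sorted_iff[of p] by simp
  qed
  moreover have "finite {p. set p \<subseteq> verts n \<and> distinct p}"
    by (rule finite_subset_distinct) (simp add: verts_def)
  ultimately show ?thesis by (rule finite_subset)
qed

lemma paths_le: "n \<ge> 1 \<Longrightarrow> p \<in> paths n i j \<Longrightarrow> i \<le> j"
proof -
  assume n: "n \<ge> 1" and p: "p \<in> paths n i j"
  show "i \<le> j"
  proof (cases p)
    case (Cons x xs)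
    then show ?thesis using paths_sorted[OF n p] by (cases xs rule: rev_cases) (auto simp: sorted_wrt_append)
  qed (use paths_sorted[OF n p] in simp)
qed

lemma paths_refl: "n \<ge> 1 \<Longrightarrow> i \<in> verts n \<Longrightarrow> paths n i i = {[i]}"
proof -
  assume n: "n \<ge> 1" and i: "i \<in> verts n"
  have "p = [i]" if p: "p \<in> paths n i i" for p
  proof (cases p)
    case (Cons x xs)
    then show ?thesis using paths_sorted[OF n p] by (cases xs rule: rev_cases) (auto simp: sorted_wrt_append)
  qed (use paths_sorted[OF n p] in simp)
  moreover have "[i] \<in> paths n i i" using i by (simp add: paths_def)
  ultimately show ?thesis by blast
qed

lemma paths_snoc:
  "p \<in> paths n i a \<Longrightarrow> (a, b) \<in> arrows n \<Longrightarrow> b \<in> verts n \<Longrightarrow> p @ [b] \<in> paths n i b"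
  by (auto simp: paths_def successively_append_iff)

lemma paths_snocD:
  "p @ [b] \<in> paths n i j \<Longrightarrow> p \<noteq> [] \<Longrightarrow> p \<in> paths n i (last p) \<and> (last p, b) \<in> arrows n \<and> b = j"
  by (auto simp: paths_def successively_append_iff)

definition basis_fun :: "'b \<Rightarrow> 'b \<Rightarrow> 'k::field" where
  "basis_fun p = (\<lambda>r. of_bool (r = p))"

lemma sum_fun_apply: "(\<Sum>a\<in>A. f a) x = (\<Sum>a\<in>A. f a x)"
  by (induction A rule: infinite_finite_induct) simp_all

lemma sum_basis_fun:
  assumes "finite A" "\<And>p. f p \<noteq> 0 \<Longrightarrow> p \<in> A"
  shows "f = (\<Sum>p\<in>A. fscale (f p) (basis_fun p))"
proof
  fix r
  have "(\<Sum>p\<in>A. fscale (f p) (basis_fun p)) r = (\<Sum>p\<in>A. if r = p then f p else 0)"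
    unfolding sum_fun_apply by (intro sum.cong refl) (simp add: fscale_def basis_fun_def)
  also have "\<dots> = f r" using assms by (auto simp: sum.delta')
  finally show "f r = (\<Sum>p\<in>A. fscale (f p) (basis_fun p)) r" by simp
qed

lemma sp_proj_rep: "f \<in> sp (proj_rep n i) j \<longleftrightarrow> (\<forall>p. f p \<noteq> 0 \<longrightarrow> p \<in> paths n i j)"
  by (simp add: proj_rep_def)

lemma subspace_sp_proj_rep: "fn.subspace (sp (proj_rep n i) j)"
proof (rule fn.subspaceI)
  fix x y :: "nat list \<Rightarrow> 'a" assume xy: "x \<in> sp (proj_rep n i) j" "y \<in> sp (proj_rep n i) j"
  have "p \<in> paths n i j" if "(x + y) p \<noteq> 0" for p
  proof -
    have "x p \<noteq> 0 \<or> y p \<noteq> 0" using that by auto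
    then show ?thesis using xy by (auto simp: sp_proj_rep)
  qed
  then show "x + y \<in> sp (proj_rep n i) j" by (simp add: sp_proj_rep)
qed (auto simp: sp_proj_rep fscale_def)

text \<open>At \<open>i\<close> the module is the line of the trivial path, so a nonzero subspace
  there contains it; prolonging by arrows then yields all paths.\<close>

lemma proj_rep_generated:
  assumes n: "n \<ge> 1" and i: "i \<in> verts n"
    and W: "W \<in> subreps n (proj_rep n i :: (nat list, 'k::field) qrep)" and ne: "W i \<noteq> {0}" and j: "j \<in> verts n"
  shows "W j = sp (proj_rep n i) j"
proof
  show "W j \<subseteq> sp (proj_rep n i) j" using subrepsD(3)[OF W j] .
  have basis: "basis_fun p \<in> W j" if "p \<in> paths n i j" for p j
    using that
  proof (induction p arbitrary: j rule: rev_induct)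
    case Nil
    then show ?case by (simp add: paths_def)
  next
    case (snoc b p)
    show ?case
    proof (cases "p = []")
      case True
      then have ij: "j = i" "b = i" using snoc.prems by (auto simp: paths_def)
      obtain f where f: "f \<in> W i" "f \<noteq> 0" using ne fn.subspace_0[OF subrepsD(2)[OF W i]] by blast
      have "f \<in> sp (proj_rep n i) i" using f subrepsD(3)[OF W i] by blast
      then have "f p \<noteq> 0 \<Longrightarrow> p \<in> {[i]}" for p using paths_refl[OF n i] by (auto simp: sp_proj_rep)
      then have "f = fscale (f [i]) (basis_fun [i])" using sum_basis_fun[of "{[i]}" f] by simp
      moreover from this have "f [i] \<noteq> 0" using f(2) by auto
      ultimately show ?thesis
        using f(1) subspace_scale_iff[OF subrepsD(2)[OF W i], of "f [i]" "basis_fun [i]"] ij True by simp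
    next
      case False
      then have p: "p \<in> paths n i (last p)" "(last p, b) \<in> arrows n" "b = j"
        using paths_snocD snoc.prems by blast+
      have "mp (proj_rep n i) (last p, b) (basis_fun p) = (basis_fun (p @ [b]) :: nat list \<Rightarrow> 'k)"
      proof
        fix r :: "nat list"
        show "mp (proj_rep n i) (last p, b) (basis_fun p) r = (basis_fun (p @ [b]) r :: 'k)"
          using p(1) by (cases r rule: rev_cases) (auto simp: proj_rep_def basis_fun_def)
      qed
      then show ?thesis using subrepsD(4)[OF W p(2) snoc.IH[OF p(1)]] p(3) by simp
    qed
  qed
  show "sp (proj_rep n i) j \<subseteq> W j"
  proof
    fix f :: "nat list \<Rightarrow> 'k" assume f: "f \<in> sp (proj_rep n i) j"
    have "(\<Sum>p\<in>paths n i j. fscale (f p) (basis_fun p)) \<in> W j"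
      using basis subrepsD(2)[OF W j] by (intro fn.subspace_sum fn.subspace_scale)
    moreover have "f = (\<Sum>p\<in>paths n i j. fscale (f p) (basis_fun p))"
      using f finite_paths[OF n] by (intro sum_basis_fun) (auto simp: sp_proj_rep)
    ultimately show "f \<in> W j" by simp
  qed
qed

text \<open>By \<open>proj_rep_generated\<close> a proper submodule vanishes at \<open>i\<close>.
  Hence the spaces at all other vertices form the only maximal submodule, which is the
  radical.\<close>

lemma dim_top_proj_rep:
  assumes n: "n \<ge> 1" and i: "i \<in> verts n"
  shows "dim_top n (proj_rep n i :: (nat list, 'k::field) qrep) = (\<lambda>j. of_bool (j = i))"
proof -
  let ?P = "proj_rep n i :: (nat list, 'k) qrep"
  define R where "R = (\<lambda>j\<in>verts n. if j = i then {0} else sp ?P j)"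
  have line: "sp ?P i = range (\<lambda>c. fscale c (basis_fun [i]))"
  proof (intro equalityI subsetI)
    fix f assume f: "f \<in> sp ?P i"
    then have "f p \<noteq> 0 \<Longrightarrow> p \<in> {[i]}" for p using paths_refl[OF n i] by (auto simp: sp_proj_rep)
    then have "f = fscale (f [i]) (basis_fun [i])" using sum_basis_fun[of "{[i]}" f] by simp
    then show "f \<in> range (\<lambda>c. fscale c (basis_fun [i]))" by blast
  qed (auto simp: sp_proj_rep paths_refl[OF n i] fscale_def basis_fun_def)
  have b0: "basis_fun [i] \<noteq> (0 :: nat list \<Rightarrow> 'k)" by (auto simp: basis_fun_def fun_eq_iff)
  have bi: "basis_fun [i] \<in> sp ?P i" by (auto simp: sp_proj_rep basis_fun_def paths_refl[OF n i])
  have R: "R \<in> subreps n ?P"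
  proof (rule subrepsI)
    show "R \<in> extensional (verts n)" by (simp add: R_def)
    show "fn.subspace (R j)" "R j \<subseteq> sp ?P j" if "j \<in> verts n" for j
      using that fn.subspace_0[OF subspace_sp_proj_rep]
          by (auto simp: R_def subspace_sp_proj_rep fn.subspace_single_0)
    fix a b x assume ab: "(a, b) \<in> arrows n" and x: "x \<in> R a"
    note v = arrowsD[OF n ab]
    have xsp: "x \<in> sp ?P a" using x v fn.subspace_0[OF subspace_sp_proj_rep]
        by (auto simp: R_def split: if_splits)
    have "mp ?P (a, b) x \<in> sp ?P b"
      using xsp v ab paths_snoc[OF _ ab, of _ i]
      unfolding sp_proj_rep by (auto simp: proj_rep_def) (metis append_butlast_last_id)
    moreover have "mp ?P (a, b) x = 0" if "b = i"
    proof -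
      have "paths n i a = {}" using paths_le[OF n] v that by fastforce
      then show ?thesis by (auto simp: proj_rep_def fun_eq_iff)
    qed
    ultimately show "mp ?P (a, b) x \<in> R b" using v by (auto simp: R_def)
  qed
  have Rne: "R i \<noteq> sp ?P i" using bi b0 i by (auto simp: R_def)
  have max: "maximal_subrep n ?P R"
    unfolding maximal_subrep_def
  proof (intro conjI ballI impI)
    fix W assume W: "W \<in> subreps n ?P" and le: "\<forall>j\<in>verts n. R j \<subseteq> W j"
    show "(\<forall>j\<in>verts n. W j = R j) \<or> (\<forall>j\<in>verts n. W j = sp ?P j)"
    proof (cases "W i = {0}")
      case True
      have "W j = R j" if "j \<in> verts n" for j
        using le subrepsD(3)[OF W that] True that by (cases "j = i") (auto simp: R_def)
      then show ?thesis by blast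
    next
      case False
      then show ?thesis using proj_rep_generated[OF n i W] by blast
    qed
  qed (use R Rne i in auto)
  have uniq: "U j = R j" if U: "maximal_subrep n ?P U" and j: "j \<in> verts n" for U j
  proof -
    have Us: "U \<in> subreps n ?P" and Une: "\<exists>i\<in>verts n. U i \<noteq> sp ?P i"
      and Um: "\<forall>W\<in>subreps n ?P. (\<forall>i\<in>verts n. U i \<subseteq> W i) \<longrightarrow> (\<forall>i\<in>verts n. W i = U i) \<or> (\<forall>i\<in>verts n. W i = sp ?P i)"
      using U unfolding maximal_subrep_def by blast+
    have "U i = {0}" using proj_rep_generated[OF n i Us] Une by blast
    then have "\<forall>j\<in>verts n. U j \<subseteq> R j" using subrepsD(3)[OF Us] by (auto simp: R_def)
    then have "(\<forall>i\<in>verts n. R i = U i) \<or> (\<forall>i\<in>verts n. R i = sp ?P i)" using bspec[OF Um R] by blast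
    then show ?thesis using Rne i j by auto
  qed
  have rad: "rad n ?P j = R j" if "j \<in> verts n" for j
    unfolding rad_def using max uniq[OF _ that] subrepsD(3)[OF R that] by blast
  show ?thesis
  proof
    fix j
    show "dim_top n ?P j = of_bool (j = i)"
      using i by (cases "j = i")
        (auto simp: dim_top_def dimvec_def dim_family_def rad R_def dim_zero_space line dim_line[OF b0])
  qed
qed

lemma tail_2n: "tail n (2 * n) = 0"
  by (auto simp: tail_def verts_def fun_eq_iff)

lemma X_rep_thin:
  fixes V :: "('b, 'k::field) qrep"
  assumes n: "n \<ge> 1" and p: "p \<le> 2 * n" and fin: "finite (UNIV :: 'k set)"
    and V: "\<And>i. i \<in> verts n \<Longrightarrow> sp V i = (if i \<le> p then range (\<lambda>c. fscale c (b i)) else {0})"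
    and b: "\<And>i. i \<in> verts n \<Longrightarrow> i \<le> p \<Longrightarrow> b i \<noteq> 0"
    and step: "\<And>i. i \<in> verts n \<Longrightarrow> i < p \<Longrightarrow> mp V (i, Suc i) (b i) = b (Suc i)"
    and lin: "\<And>i j c x. (i, j) \<in> arrows n \<Longrightarrow> mp V (i, j) (fscale c x) = fscale c (mp V (i, j) x)"
    and mp: "\<And>i j x. (i, j) \<in> arrows n \<Longrightarrow> x \<in> sp V i \<Longrightarrow> mp V (i, j) x \<in> sp V j"
  shows "X_rep n q V = (\<Sum>k\<le>p. qterm n q (delta n - tail n p) (tail n k - tail n p))"
proof -
  have "X_rep n q V = (\<Sum>U\<in>subreps n V. qterm n q (dimvec n V) (dim_family n U))"
  proof (rule X_rep_eq[OF fin])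
    fix i assume "i \<in> verts n"
    then show "finite (sp V i) \<and> fn.subspace (sp V i)"
      using V[of i] fin by (auto simp: fn.span_singleton[symmetric] fn.subspace_single_0 fn.subspace_span)
        (auto simp: fn.span_singleton)
  qed
  also have "\<dots> = (\<Sum>k\<le>p. qterm n q (dimvec n V) (tail n k - tail n p))"
    by (rule sum_subreps_thin(1)[OF n p V b step lin mp])
  also have "dimvec n V = delta n - tail n p"
    using sum_subreps_thin(2)[OF n p V b step lin mp] by (simp only: tail_0)
  finally show ?thesis .
qed

lemma X_rep_E_rep:
  fixes c :: "'k::field"
  assumes n: "n \<ge> 2" and fin: "finite (UNIV :: 'k set)"
  shows "X_rep n q (E_rep n c) = (\<Sum>k\<le>2 * n. qterm n q (delta n) (tail n k))"
proof -
  have "X_rep n q (E_rep n c) = (\<Sum>k\<le>2 * n. qterm n q (delta n - tail n (2 * n)) (tail n k - tail n (2 * n)))"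
  proof (rule X_rep_thin[where b = "\<lambda>_ _. 1"])
    have "x \<in> range (\<lambda>c. fscale c (\<lambda>_. 1))" for x :: "unit \<Rightarrow> 'k"
      by (rule range_eqI[of _ _ "x ()"]) (auto simp: fscale_def fun_eq_iff)
    then show "sp (E_rep n c) i = (if i \<le> 2 * n then range (\<lambda>c. fscale c (\<lambda>_. 1)) else {0})" if "i \<in> verts n"
        for i
      using that by (auto simp: E_rep_def verts_def)
    show "mp (E_rep n c) (i, Suc i) (\<lambda>_. 1) = (\<lambda>_. 1)" if "i < 2 * n" for i
      using that n by (auto simp: E_rep_def)
    show "mp (E_rep n c) (i, j) (fscale a x) = fscale a (mp (E_rep n c) (i, j) x)" for i j a x
      by (simp add: E_rep_def mult.commute)
  qed (use n fin in \<open>auto simp: E_rep_def fun_eq_iff\<close>)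
  then show ?thesis by (simp add: tail_2n)
qed

text \<open>The arrow from 1 to \<open>2 * n\<close> ends in the sink, so a path to the vertex
  before the sink cannot use it.\<close>

lemma paths_to_penultimate:
  assumes n: "n \<ge> 2" and i: "i \<in> verts n"
  shows "paths n i (2 * n - 1) = (if i = 2 * n then {} else {[i..<2 * n]})"
proof -
  have n1: "n \<ge> 1" using n by simp
  have uniq: "p = [i..<2 * n]" if "p \<in> paths n i (2 * n - 1)" for p i
    using that
  proof (induction p arbitrary: i)
    case Nil
    then show ?case by (simp add: paths_def)
  next
    case (Cons x xs)
    have x: "x = i" using Cons.prems by (simp add: paths_def)
    show ?case
    proof (cases xs)
      case Nil
      then have "i = 2 * n - 1" using Cons.prems x by (simp add: paths_def)
      then have "2 * n = Suc i" using n by simp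
      then show ?thesis using Nil x by simp
    next
      case (Cons y ys)
      have xs: "xs \<in> paths n y (2 * n - 1)" and a: "(i, y) \<in> arrows n"
        using Cons.prems Cons x by (auto simp: paths_def)
      have "y \<le> 2 * n - 1" using paths_le[OF n1 xs] .
      then have y: "y = Suc i" "i < 2 * n" using a n by (auto simp: arrows_def)
      have "xs = [y..<2 * n]" by (rule Cons.IH[OF xs])
      then show ?thesis using x y upt_conv_Cons by simp
    qed
  qed
  have ex: "[i..<2 * n] \<in> paths n i (2 * n - 1)" if "1 \<le> i" "i \<le> 2 * n - 1" for i
    using that(2,1)
  proof (induction rule: inc_induct)
    case base
    have "[2 * n - 1..<2 * n] = [2 * n - 1]" using n upt_conv_Cons[of "2 * n - 1" "2 * n"] by simp
    then show ?case using n by (simp add: paths_def verts_def)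
  next
    case (step m)
    have p: "[Suc m..<2 * n] \<in> paths n (Suc m) (2 * n - 1)" using step by simp
    have "[m..<2 * n] = m # [Suc m..<2 * n]" using step by (intro upt_conv_Cons) simp
    moreover have "(m, Suc m) \<in> arrows n" "m \<in> verts n" using step by (auto simp: arrows_def verts_def)
    ultimately show ?case using p unfolding paths_def by (auto simp: successively_Cons)
  qed
  show ?thesis
  proof (cases "i = 2 * n")
    case True
    then have "paths n i (2 * n - 1) = {}" using paths_le[OF n1, of _ i "2 * n - 1"] n by fastforce
    then show ?thesis using True by simp
  next
    case False
    then show ?thesis using uniq ex[of i] i by (auto simp: verts_def)
  qed
qed

lemma X_rep_inj_rep:
  assumes n: "n \<ge> 2" and fin: "finite (UNIV :: 'k::field set)"
  shows "X_rep n q (inj_rep n (2 * n - 1) :: (nat list, 'k) qrep) =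
      (\<Sum>k\<le>2 * n - 1. qterm n q (delta n - tail n (2 * n - 1)) (tail n k - tail n (2 * n - 1)))"
    and "dimvec n (inj_rep n (2 * n - 1) :: (nat list, 'k) qrep) = delta n - tail n (2 * n - 1)"
proof -
  let ?I = "inj_rep n (2 * n - 1) :: (nat list, 'k) qrep"
  let ?b = "\<lambda>i. basis_fun [i..<2 * n] :: nat list \<Rightarrow> 'k"
  have n1: "n \<ge> 1" and p: "2 * n - 1 \<le> 2 * n" using n by simp_all
  have V: "sp ?I i = (if i \<le> 2 * n - 1 then range (\<lambda>c. fscale c (?b i)) else {0})" if i: "i \<in> verts n" for i
  proof (cases "i = 2 * n")
    case True
    then show ?thesis using paths_to_penultimate[OF n i] n by (auto simp: inj_rep_def fun_eq_iff)
  next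
    case False
    have "sp ?I i = range (\<lambda>c. fscale c (?b i))"
    proof (intro equalityI subsetI)
      fix f assume "f \<in> sp ?I i"
      then have "f p \<noteq> 0 \<Longrightarrow> p \<in> {[i..<2 * n]}" for p
        using paths_to_penultimate[OF n i] False by (auto simp: inj_rep_def)
      then have "f = fscale (f [i..<2 * n]) (?b i)" using sum_basis_fun[of "{[i..<2 * n]}" f] by simp
      then show "f \<in> range (\<lambda>c. fscale c (?b i))" by blast
    next
      fix f assume "f \<in> range (\<lambda>c. fscale c (?b i))"
      then obtain c where "f = fscale c (?b i)" by blast
      then show "f \<in> sp ?I i"
        using False paths_to_penultimate[OF n i] by (simp add: inj_rep_def fscale_def basis_fun_def)
    qed
    then show ?thesis using False i by (auto simp: verts_def)
  qed
  have b: "?b i \<noteq> 0" for i by (auto simp: basis_fun_def fun_eq_iff)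
  have step: "mp ?I (i, Suc i) (?b i) = ?b (Suc i)" if "i \<in> verts n" "i < 2 * n - 1" for i
  proof -
    have i: "Suc i \<in> verts n" "i < 2 * n" "Suc i \<noteq> 2 * n" using that by (auto simp: verts_def)
    show ?thesis
      using paths_to_penultimate[OF n i(1)] i upt_conv_Cons[OF i(2)]
      by (auto simp: inj_rep_def basis_fun_def fun_eq_iff)
  qed
  have lin: "mp ?I (i, j) (fscale c x) = fscale c (mp ?I (i, j) x)" for i j c x
    by (auto simp: inj_rep_def fscale_def fun_eq_iff)
  have mp: "mp ?I (i, j) x \<in> sp ?I j" for i j x by (auto simp: inj_rep_def)
  show "X_rep n q ?I = (\<Sum>k\<le>2 * n - 1. qterm n q (delta n - tail n (2 * n - 1)) (tail n k - tail n (2 * n - 1)))"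
    by (rule X_rep_thin[OF n1 p fin V b step lin mp])
  show "dimvec n ?I = delta n - tail n (2 * n - 1)"
    using sum_subreps_thin(2)[OF n1 p V b step lin mp] by (simp add: tail_0)
qed

section \<open>Multiplication by the character of \<open>E(\<lambda>)\<close>\<close>

lemma dimvec_model:
  assumes "finite (UNIV :: 'k::field set)"
  shows "dimvec n (model n l :: 'k rep) = (\<lambda>i. if i \<in> verts n then int (model_dim n l i) else 0)"
proof -
  have "fn.dim (supp_below d :: (nat \<Rightarrow> 'k) set) = d" for d
  proof -
    have "CARD('k) ^ fn.dim (supp_below d :: (nat \<Rightarrow> 'k) set) = CARD('k) ^ d"
      using fn.card_subspace[OF assms finite_supp_below(1)[OF assms] subspace_supp_below, of d]
        finite_supp_below(2)[OF assms, of d] by simp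
    then show ?thesis using card_gt_one_field[OF assms] by simp
  qed
  then show ?thesis by (auto simp: dimvec_def dim_family_def model_def model_dim_def)
qed

lemma X_rep_model:
  assumes "n \<ge> 2" "finite (UNIV :: 'k::field set)"
  shows "X_rep n q (model n l :: 'k rep) =
    (\<Sum>U\<in>subreps n (model n l :: 'k rep). qterm n q (dimvec n (model n l :: 'k rep)) (dim_family n U))"
  by (rule X_rep_eq[OF assms(2)]) (simp add: model_def finite_supp_below(1)[OF assms(2)])

lemma qt_scale_scale: "qt_scale c (qt_scale d x) = qt_scale (c * d) x"
  by (rule poly_mapping_eqI) (simp add: qt_scale_lookup)

lemma qt_scale_add_scalar: "qt_scale (c + d) x = qt_scale c x + qt_scale d x"
  by (rule poly_mapping_eqI) (simp add: qt_scale_lookup lookup_add algebra_simps)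

lemma sum_const_qt: "(\<Sum>a\<in>A. x) = qt_scale (real (card A)) x"
proof -
  have z: "qt_scale 0 x = 0" by (rule poly_mapping_eqI) (simp add: qt_scale_lookup)
  have o: "qt_scale 1 x = x" by (rule poly_mapping_eqI) (simp add: qt_scale_lookup)
  show ?thesis
    by (induction A rule: infinite_finite_induct) (simp_all add: z o qt_scale_add_scalar del: sum_constant)
qed

lemma mat_vec_Bmat:
  assumes n: "n \<ge> 2" and i: "i \<in> verts n"
  shows "Bvec n v i = of_bool (i < 2 * n) * v (Suc i) + of_bool (i = 1) * v (2 * n)
    - of_bool (2 \<le> i) * v (i - 1) - of_bool (i = 2 * n) * v 1"
proof -
  have fv: "finite (verts n)" by (simp add: verts_def)
  have "Bmat n i j * v j = of_bool (j = Suc i \<and> i < 2 * n) * v j + of_bool (j = 2 * n \<and> i = 1) * v j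
      - of_bool (j = i - 1 \<and> 2 \<le> i) * v j - of_bool (j = 1 \<and> i = 2 * n) * v j" if j: "j \<in> verts n" for j
  proof -
    have "i = Suc j \<longleftrightarrow> j = i - 1 \<and> 2 \<le> i" "j = Suc i \<longleftrightarrow> j = Suc i \<and> i < 2 * n"
      "i = 1 \<and> j = 2 * n \<longleftrightarrow> j = 2 * n \<and> i = 1"
      using j by (auto simp: verts_def)
    then show ?thesis unfolding Bmat_eq(1)[OF n i j] by (simp only: algebra_simps)
  qed
  then have "Bvec n v i = (\<Sum>j\<in>verts n. of_bool (j = Suc i \<and> i < 2 * n) * v j + of_bool (j = 2 * n \<and> i = 1) * v j
      - of_bool (j = i - 1 \<and> 2 \<le> i) * v j - of_bool (j = 1 \<and> i = 2 * n) * v j)"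
    using i by (simp add: mat_vec_def)
  also have "\<dots> = of_bool (i < 2 * n) * v (Suc i) + of_bool (i = 1) * v (2 * n)
    - of_bool (2 \<le> i) * v (i - 1) - of_bool (i = 2 * n) * v 1"
    unfolding sum_subtractf sum.distrib
    using n i by (subst (1 2 3 4) sum_of_bool_pick[OF fv]) (auto simp: verts_def)
  finally show ?thesis .
qed

text \<open>These give the exponents of the boundary terms; \<open>tail n (2 * n - 1)\<close> is the
  unit vector at \<open>2 * n\<close>. The second identity reflects that the Euler pairing with
  \<open>delta n\<close> changes sign when the arguments are exchanged.\<close>

lemma mat_vec_delta_last:
  assumes n: "n \<ge> 2"
  shows "Cvec n (delta n) = tail n (2 * n - 1) - (\<lambda>j. of_bool (j = 1))"
    and "Bvec n (delta n) = - 2 * Cvec n (delta n)"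
    and "Bvec n (tail n (2 * n - 1)) + Cvec n (tail n (2 * n - 1)) = tail n (2 * n - 1)"
proof -
  have out: "mat_vec n M v i = 0" if "i \<notin> verts n" for M v i using that by (simp add: mat_vec_def)
  show C: "Cvec n (delta n) = tail n (2 * n - 1) - (\<lambda>j. of_bool (j = 1))"
  proof
    fix i
    show "Cvec n (delta n) i = (tail n (2 * n - 1) - (\<lambda>j. of_bool (j = 1))) i"
    proof (cases "i \<in> verts n")
      case True
      then show ?thesis unfolding mat_vec_I_minus_Rtr[OF n True] using n
          by (auto simp: delta_def tail_def verts_def)
    qed (use n in \<open>auto simp: out tail_def verts_def\<close>)
  qed
  show "Bvec n (delta n) = - 2 * Cvec n (delta n)"
  proof
    fix i
    show "Bvec n (delta n) i = (- 2 * Cvec n (delta n)) i"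
    proof (cases "i \<in> verts n")
      case True
      have "Bvec n (delta n) i = - 2 * Cvec n (delta n) i"
        unfolding mat_vec_I_minus_Rtr[OF n True] mat_vec_Bmat[OF n True]
        using n True by (auto simp: delta_def verts_def)
      then show ?thesis by simp
    qed (simp add: out)
  qed
  show "Bvec n (tail n (2 * n - 1)) + Cvec n (tail n (2 * n - 1)) = tail n (2 * n - 1)"
  proof
    fix i
    show "(Bvec n (tail n (2 * n - 1)) + Cvec n (tail n (2 * n - 1))) i = tail n (2 * n - 1) i"
    proof (cases "i \<in> verts n")
      case True
      have "Bvec n (tail n (2 * n - 1)) i + Cvec n (tail n (2 * n - 1)) i = tail n (2 * n - 1) i"
        unfolding mat_vec_I_minus_Rtr[OF n True] mat_vec_Bmat[OF n True]
        using n True by (auto simp: tail_def verts_def)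
      then show ?thesis by simp
    qed (auto simp: out tail_def)
  qed
qed

lemma supp_below_1: "supp_below (Suc 0) = range (\<lambda>a. fscale a unit0)"
proof (intro equalityI subsetI)
  fix f :: "nat \<Rightarrow> 'a" assume "f \<in> supp_below (Suc 0)"
  then have "f = fscale (f 0) unit0" by (auto simp: supp_below_def fscale_def unit0_def fun_eq_iff)
  then show "f \<in> range (\<lambda>a. fscale a unit0)" by blast
qed (auto simp: supp_below_def fscale_def unit0_def)

section \<open>The recursions for the models and their start\<close>

context
  fixes n q :: nat and c :: "'k::field"
  assumes n: "n \<ge> 2" and fin: "finite (UNIV :: 'k set)" and card: "CARD('k) = q ^ 2"
begin

lemma q_pos: "q > 0"
  using card_gt_one_field[OF fin] card by (cases "q = 0") auto

lemma dimvec_model_props: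
  shows "dimvec n (model n l :: 'k rep) 1 - dimvec n (model n l :: 'k rep) (2 * n) = 1"
    and "dimvec n (model n (Suc l) :: 'k rep) = dimvec n (model n l :: 'k rep) + delta n"
    and "dimvec n (model n 0 :: 'k rep) = delta n - tail n (2 * n - 1)"
  unfolding dimvec_model[OF fin] using n by (auto simp: model_dim_def delta_def tail_def verts_def fun_eq_iff)

lemma qt_mult_qterm_tail:
  assumes v: "v 1 - v (2 * n) = 1" and e: "e 0 = 0" and k: "k \<le> 2 * n"
  shows "qt_mult n q (qterm n q v e) (qterm n q (delta n) (tail n k)) =
    qt_scale (real q powr (1 / 2 + 2 * real_of_int (if k = 2 * n then e (2 * n) - e 1 else e k)))
      (qterm n q (v + delta n) (e + tail n k))"
  using qt_mult_qterm[OF n q_pos v, of e "tail n k"] bilin_delta_minus_tail[where e = e, OF n k e] by simp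

lemma X_model_mult_E_rep:
  "qt_mult n q (X_rep n q (model n l :: 'k rep)) (X_rep n q (E_rep n c)) =
    qt_scale (real q powr (1 / 2)) (X_rep n q (model n (Suc l) :: 'k rep)) +
    (\<Sum>W | W \<in> subreps n (model n l :: 'k rep) \<and> unit0 \<in> W 1.
      qt_scale (real q powr (1 / 2 + 2 * real_of_int (dim_family n W (2 * n) - dim_family n W 1)))
        (qterm n q (dimvec n (model n l :: 'k rep) + delta n) (dim_family n W)))"
proof -
  let ?S = "subreps n (model n l :: 'k rep)" and ?v = "dimvec n (model n l :: 'k rep)"
  let ?t = "\<lambda>W k. qterm n q (?v + delta n) (dim_family n W + tail n k)"
  let ?x = "\<lambda>W. qt_scale (real q powr (1 / 2 + 2 * real_of_int (dim_family n W (2 * n) - dim_family n W 1))) (?t W (2 * n))"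
  have fS: "finite ?S" by (rule finite_subreps_model[OF n fin])
  have "real CARD('k) powr b = real q powr (2 * b)" for b
    using q_pos by (simp add: card powr_powr[symmetric] powr_realpow)
  note m = this
  \<comment> \<open>Each product of terms is q^(1/2) times the contribution of its fibre. In the
    exceptional case the fibre is empty and the product \<open>?x W\<close> survives in
    full.\<close>
  have one: "qt_mult n q (qterm n q ?v (dim_family n W)) (qterm n q (delta n) (tail n k)) =
      qt_scale (real q powr (1 / 2)) (qt_scale (real (card (fibre n l W k))) (?t W k)) +
      (if k = 2 * n then if unit0 \<in> W 1 then ?x W else 0 else 0)" if W: "W \<in> ?S" and k: "k \<le> 2 * n" for W k
  proof -
    have e: "dim_family n W 0 = 0" by (simp add: dim_family_def verts_def)
    have z: "qt_scale 0 x = 0" for x by (rule poly_mapping_eqI) (simp add: qt_scale_lookup)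
    show ?thesis
      unfolding qt_mult_qterm_tail[where v = ?v
          and e = "dim_family n W", OF dimvec_model_props(1) e k] card_fibre[OF n fin W k] qt_scale_scale m
      by (simp add: powr_add z)
  qed
  have "qt_mult n q (X_rep n q (model n l :: 'k rep)) (X_rep n q (E_rep n c)) =
      (\<Sum>W\<in>?S. \<Sum>k\<le>2 * n. qt_mult n q (qterm n q ?v (dim_family n W)) (qterm n q (delta n) (tail n k)))"
    unfolding X_rep_model[OF n fin] X_rep_E_rep[OF n fin] by (rule qt_mult_sum)
  also have "\<dots> = (\<Sum>W\<in>?S. \<Sum>k\<le>2 * n. qt_scale (real q powr (1 / 2)) (qt_scale (real (card (fibre n l W k))) (?t W k)) +
      (if k = 2 * n then if unit0 \<in> W 1 then ?x W else 0 else 0))"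
    by (intro sum.cong refl one) auto
  also have "\<dots> = (\<Sum>W\<in>?S. \<Sum>k\<le>2 * n. qt_scale (real q powr (1 / 2)) (qt_scale (real (card (fibre n l W k))) (?t W k))) +
      (\<Sum>W\<in>?S. if unit0 \<in> W 1 then ?x W else 0)"
    by (simp add: sum.distrib)
  also have "(\<Sum>W\<in>?S. if unit0 \<in> W 1 then ?x W else 0) = (\<Sum>W | W \<in> ?S \<and> unit0 \<in> W 1. ?x W)"
    using fS by (rule sum.inter_filter[symmetric])
  also have "(\<Sum>W\<in>?S. \<Sum>k\<le>2 * n. qt_scale (real q powr (1 / 2)) (qt_scale (real (card (fibre n l W k))) (?t W k))) =
      qt_scale (real q powr (1 / 2)) (X_rep n q (model n (Suc l) :: 'k rep))"
    unfolding X_rep_model[OF n fin] dimvec_model_props(2) sum_subreps_model_Suc[OF n fin] qt_scale_sum sum_const_qt ..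
  finally show ?thesis unfolding tail_2n add_0_right .
qed

text \<open>Adding \<open>delta n\<close> to \<open>e\<close> and twice to \<open>v\<close> leaves
  the monomial unchanged, because B sends \<open>delta n\<close> to -2 times its image under
  \<open>Cvec\<close>. One copy in \<open>v\<close> comes from multiplying by the character of
  E(\<lambda>), the other from passing to the next model.\<close>

lemma qterm_twice_delta:
  assumes v: "v 1 - v (2 * n) = 1" and e: "e 0 = 0"
  shows "qterm n q (v + delta n + delta n) (e + delta n) =
    qt_scale (real q powr (- 1 - 2 * real_of_int (e (2 * n) - e 1))) (qterm n q v e)"
proof -
  let ?b = "Cform n"
  have d: "?b x (delta n) = x (2 * n) - x 1" if "x 0 = 0" for x
    using bilin_delta_minus_tail[where e = x, OF n order_refl that] by (simp add: tail_2n)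
  have dl: "?b (delta n) x = x 1 - x (2 * n)" for x
  proof -
    have "?b (delta n) x = (\<Sum>i\<in>verts n. Cvec n x i)"
      by (auto simp: bilin_def delta_def intro!: sum.cong)
    then show ?thesis using sum_mat_vec_I_minus_Rtr[OF n] by simp
  qed
  have dd: "?b (delta n) (delta n) = 0" using dl[of "delta n"] n by (simp add: delta_def verts_def)
  have "euler n (e + delta n) (v + delta n + delta n - (e + delta n)) =
      euler n e (v - e) + 2 * (e (2 * n) - e 1) + 2 * ((v 1 - v (2 * n)) - (e 1 - e (2 * n)))"
    unfolding euler_def by (simp add: bilin_simps d[of e, OF e] dl[of v] dl[of e] dd)
  also have "\<dots> = euler n e (v - e) + 2 + 4 * (e (2 * n) - e 1)" using v by simp
  finally have eu: "- real_of_int (euler n (e + delta n) (v + delta n + delta n - (e + delta n))) / 2 =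
     (- 1 - 2 * real_of_int (e (2 * n) - e 1)) + - real_of_int (euler n e (v - e)) / 2" by simp
  have "- Bvec n (e + delta n) - Cvec n (v + delta n + delta n) =
     - Bvec n e - Cvec n v"
    unfolding mat_vec_add mat_vec_delta_last(2)[OF n] by (simp add: fun_eq_iff)
  then show ?thesis unfolding qterm_def qt_scale_single eu powr_add by simp
qed

lemma X_model_Suc_mult_E_rep:
  "qt_mult n q (X_rep n q (model n (Suc l) :: 'k rep)) (X_rep n q (E_rep n c)) =
    qt_scale (real q powr (1 / 2)) (X_rep n q (model n (Suc (Suc l)) :: 'k rep)) +
    qt_scale (real q powr (- 1 / 2)) (X_rep n q (model n l :: 'k rep))"
proof -
  let ?v = "dimvec n (model n l :: 'k rep)"
  \<comment> \<open>The surviving summand as a function of the dimension vector. Its power of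
    \<open>q\<close> and that of \<open>qterm_twice_delta\<close> combine to 1/2 - 1 = -1/2,
    whatever \<open>e\<close> is.\<close>
  define G where "G e = qt_scale (real q powr (1 / 2 + 2 * real_of_int (e (2 * n) - e 1))) (qterm n q (?v + delta n + delta n) e)" for e :: ivec
  have G: "G (e + delta n) = qt_scale (real q powr (- 1 / 2)) (qterm n q ?v e)" if e: "e 0 = 0" for e
  proof -
    have "(e + delta n) (2 * n) - (e + delta n) 1 = e (2 * n) - e 1" using n by (simp add: delta_def verts_def)
    then show ?thesis
      unfolding G_def qterm_twice_delta[where v = ?v
          and e = e, OF dimvec_model_props(1) e] qt_scale_scale powr_add[symmetric] by simp
  qed
  have "(\<Sum>W | W \<in> subreps n (model n (Suc l) :: 'k rep) \<and> unit0 \<in> W 1. G (dim_family n W)) =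
      (\<Sum>W\<in>subreps n (model n l :: 'k rep). G (dim_family n W + delta n))"
    by (rule sum_subreps_model_unit0[OF n fin])
  also have "\<dots> = (\<Sum>W\<in>subreps n (model n l :: 'k rep). qt_scale (real q powr (- 1 / 2)) (qterm n q ?v (dim_family n W)))"
    by (intro sum.cong refl G) (simp add: dim_family_def verts_def)
  also have "\<dots> = qt_scale (real q powr (- 1 / 2)) (X_rep n q (model n l :: 'k rep))"
    unfolding X_rep_model[OF n fin] qt_scale_sum ..
  finally show ?thesis
    unfolding X_model_mult_E_rep dimvec_model_props(2) G_def by simp
qed

text \<open>The smallest model contains no copy of E(0), as its space at the sink is zero; the
  surviving sum therefore reduces to the term of the whole module.\<close>

lemma model_0_unit0:
  "{W. W \<in> subreps n (model n 0 :: 'k rep) \<and> unit0 \<in> W 1} = {\<lambda>i\<in>verts n. sp (model n 0) i}"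
proof -
  have s1: "supp_below 1 = range (\<lambda>a. fscale a unit0 :: nat \<Rightarrow> 'k)"
    using supp_below_1 by simp
  have s0: "supp_below 0 = {0 :: nat \<Rightarrow> 'k}" by (auto simp: supp_below_def)
  have sp: "sp (model n 0 :: 'k rep) i = (if i < 2 * n then supp_below 1 else {0})" for i
    by (simp add: model_def s0)
  have "W = (\<lambda>i\<in>verts n. sp (model n 0) i)" if W: "W \<in> subreps n (model n 0 :: 'k rep)" and u: "unit0 \<in> W 1"
      for W
  proof (rule extensionalityI[of _ "verts n"])
    fix i assume i: "i \<in> verts n"
    show "W i = (\<lambda>i\<in>verts n. sp (model n 0) i) i"
    proof (cases "i < 2 * n")
      case True
      have "unit0 \<in> W i" using model_subrepD(4)[OF n W, of 1 i] True i u by (auto simp: verts_def)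
      then have "supp_below 1 \<subseteq> W i" unfolding s1 using fn.subspace_scale[OF model_subrepD(2)[OF n W i]]
          by blast
      then show ?thesis using subrepsD(3)[OF W i] True i by (auto simp: sp)
    next
      case False
      then show ?thesis using subrepsD(3)[OF W i] fn.subspace_0[OF model_subrepD(2)[OF n W i]] i
          by (auto simp: sp)
    qed
  qed (use model_subrepD(1)[OF n W] in auto)
  moreover have "(\<lambda>i\<in>verts n. sp (model n 0) i) \<in> subreps n (model n 0 :: 'k rep)"
  proof (rule subrepsI)
    fix i j x assume a: "(i, j) \<in> arrows n" and x: "x \<in> (\<lambda>i\<in>verts n. sp (model n 0 :: 'k rep) i) i"
    have v: "i \<in> verts n" "j \<in> verts n" using arrowsD[OF _ a] n by auto
    have "mp (model n 0) (i, j) x \<in> sp (model n 0 :: 'k rep) j"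
      using a x v n by (auto simp: model_def supp_below_def shift_def trunc_def arrows_def verts_def split: if_splits)
    then show "mp (model n 0) (i, j) x \<in> (\<lambda>i\<in>verts n. sp (model n 0 :: 'k rep) i) j" using v by simp
  qed (auto simp: model_def)
  moreover have "unit0 \<in> (\<lambda>i\<in>verts n. sp (model n 0 :: 'k rep) i) 1"
    using n by (auto simp: sp verts_def supp_below_def unit0_def)
  ultimately show ?thesis by blast
qed

lemma X_model_0_mult_E_rep:
  "qt_mult n q (X_rep n q (model n 0 :: 'k rep)) (X_rep n q (E_rep n c)) =
    qt_scale (real q powr (1 / 2)) (X_rep n q (model n (Suc 0) :: 'k rep)) +
    qt_scale (real q powr (- 1 / 2)) (Poly_Mapping.single (tail n (2 * n - 1)) 1)"
proof -
  let ?u = "tail n (2 * n - 1)" and ?v = "dimvec n (model n 0 :: 'k rep)"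
  have dW: "dim_family n (\<lambda>i\<in>verts n. sp (model n 0 :: 'k rep) i) = ?v"
    by (auto simp: dimvec_def dim_family_def fun_eq_iff)
  have v: "?v = delta n - ?u" by (rule dimvec_model_props(3))
  have v0: "?v 0 = 0" by (simp add: dimvec_def dim_family_def verts_def)
  have vv: "?v (2 * n) - ?v 1 = - 1" using dimvec_model_props(1)[of 0] by simp
  have b: "Cform n ?v (delta n) = - 1"
    using bilin_delta_minus_tail[where e = ?v, OF n order_refl v0] vv by (simp add: tail_2n)
  \<comment> \<open>With \<open>?v = delta n - ?u\<close> the contributions of
    \<open>delta n\<close> cancel, by
    \<open>Bvec n (delta n) = - 2 * Cvec n (delta n)\<close>.\<close>
  have "- Bvec n ?v - Cvec n (?v + delta n) = ?u"
    using mat_vec_delta_last(2,3)[OF n] unfolding v mat_vec_add mat_vec_diff by (simp add: fun_eq_iff)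
  then have "qt_scale (real q powr (1 / 2 + 2 * real_of_int (?v (2 * n) - ?v 1))) (qterm n q (?v + delta n) ?v) =
      qt_scale (real q powr (- 1 / 2)) (Poly_Mapping.single ?u 1)"
  proof -
    have "euler n ?v (?v + delta n - ?v) = - 2" by (simp add: euler_def b)
    \<comment> \<open>The exponents add up to 1/2 - 2 + 1: the -2 is the scalar of the product, the
      1 comes from the Euler form in \<open>qterm\<close>.\<close>
    moreover have "real q powr (1 / 2 + 2 * real_of_int (- 1)) * real q powr (- real_of_int (- 2) / 2)
        = real q powr (- 1 / 2)"
      by (simp only: powr_add[symmetric]) simp
    ultimately show ?thesis
      using \<open>- Bvec n ?v - Cvec n (?v + delta n) = ?u\<close>
      unfolding vv qterm_def qt_scale_single by simp
  qed
  then show ?thesis unfolding X_model_mult_E_rep model_0_unit0 by (simp add: dW)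
qed

text \<open>
  The initial variable at \<open>2n\<close> is the term of a virtual representation of dimension vector \<open>-e\<^sub>2\<^sub>n\<close>,
  that is, of the formal case \<open>l = -1\<close> of the models.
\<close>

lemma X_last_mult_E_rep:
  "qt_mult n q (Poly_Mapping.single (tail n (2 * n - 1)) 1) (X_rep n q (E_rep n c)) =
    qt_scale (real q powr (1 / 2)) (X_rep n q (inj_rep n (2 * n - 1) :: (nat list, 'k) qrep)) +
    qt_scale (real q powr (- 1 / 2)) (Poly_Mapping.single (\<lambda>j. of_bool (j = 1)) 1)"
proof -
  let ?u = "tail n (2 * n - 1)"
  have u: "?u 0 = 0" "?u 1 = 0" "?u (2 * n) = 1" "?u k = 0" if "k < 2 * n" for k
    using n that by (auto simp: tail_def verts_def)
  have u': "(- ?u) 1 - (- ?u) (2 * n) = 1" "(- ?u) 0 = 0" using u[of 0] n by simp_all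
  have BC: "mat_vec n M (- x) = - mat_vec n M x" for M x
    by (auto simp: mat_vec_def sum_negf fun_eq_iff)
  \<comment> \<open>The virtual submodule is the whole virtual representation, so both vectors are
    \<open>- ?u\<close> and the Euler form vanishes.\<close>
  have single: "Poly_Mapping.single ?u 1 = qterm n q (- ?u) (- ?u)"
  proof -
    have "bilin n M x 0 = 0" for M x by (simp add: bilin_def mat_vec_def)
    moreover have "Bvec n ?u + Cvec n ?u = ?u" by (rule mat_vec_delta_last(3)[OF n])
    ultimately show ?thesis using q_pos by (simp add: qterm_def euler_def BC)
  qed
  have b: "Cform n (- ?u) (delta n) = - 1"
    using bilin_delta_minus_tail[where e = "- ?u", OF n order_refl u'(2)] u'(1) by (simp add: tail_2n)
  have last: "qterm n q (- ?u + delta n) (- ?u)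
      = qt_scale (real q powr 1) (Poly_Mapping.single (\<lambda>j. of_bool (j = 1)) 1)"
  proof -
    have "- Bvec n (- ?u) - Cvec n (- ?u + delta n) =
        (Bvec n ?u + Cvec n ?u) - Cvec n (delta n)"
      unfolding mat_vec_add BC by simp
    also have "\<dots> = (\<lambda>j. of_bool (j = 1))" unfolding mat_vec_delta_last(1,3)[OF n] by simp
    finally have "- Bvec n (- ?u) - Cvec n (- ?u + delta n) = (\<lambda>j. of_bool (j = 1))" .
    moreover have "euler n (- ?u) (- ?u + delta n - - ?u) = - 2"
        by (simp add: euler_def b[unfolded One_nat_def])
    ultimately show ?thesis unfolding qterm_def qt_scale_single by simp
  qed
  have split: "{..2 * n} = insert (2 * n) {..2 * n - 1}" using n by auto
  have "qt_mult n q (Poly_Mapping.single ?u 1) (X_rep n q (E_rep n c)) =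
      (\<Sum>k\<le>2 * n. qt_mult n q (qterm n q (- ?u) (- ?u)) (qterm n q (delta n) (tail n k)))"
    using qt_mult_sum[of n q "\<lambda>_. qterm n q (- ?u) (- ?u)" "{()}" "\<lambda>k. qterm n q (delta n) (tail n k)"
        "{..2 * n}"]
    unfolding X_rep_E_rep[OF n fin] single by simp
  also have "\<dots> = (\<Sum>k\<le>2 * n. qt_scale (real q powr (1 / 2 + 2 * real_of_int (if k = 2 * n then (- ?u) (2 * n) - (- ?u) 1 else (- ?u) k)))
      (qterm n q (- ?u + delta n) (- ?u + tail n k)))"
    by (intro sum.cong refl qt_mult_qterm_tail[where v = "- ?u" and e = "- ?u", OF u']) auto
  \<comment> \<open>For \<open>k\<close> below \<open>2 * n\<close> the entry of \<open>- ?u\<close>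
    is 0, and the terms are those of I_{2n-1}. At \<open>k = 2 * n\<close> the exponent is 1/2 - 2,
    and \<open>last\<close> supplies the missing 1.\<close>
  also have "\<dots> = (\<Sum>k\<le>2 * n - 1. qt_scale (real q powr (1 / 2)) (qterm n q (delta n - ?u) (tail n k - ?u))) +
      qt_scale (real q powr (1 / 2 - 2)) (qterm n q (- ?u + delta n) (- ?u))"
  proof -
    have "(\<Sum>k\<le>2 * n - 1. qt_scale (real q powr (1 / 2 + 2 * real_of_int (if k = 2 * n then (- ?u) (2 * n) - (- ?u) 1 else (- ?u) k)))
        (qterm n q (- ?u + delta n) (- ?u + tail n k))) =
      (\<Sum>k\<le>2 * n - 1. qt_scale (real q powr (1 / 2)) (qterm n q (delta n - ?u) (tail n k - ?u)))"
    proof (intro sum.cong refl)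
      fix k assume "k \<in> {..2 * n - 1}"
      then have k: "k < 2 * n" using n by auto
      then have "?u k = 0" using u by blast
      then show "qt_scale (real q powr (1 / 2 + 2 * real_of_int (if k = 2 * n then (- ?u) (2 * n) - (- ?u) 1 else (- ?u) k)))
        (qterm n q (- ?u + delta n) (- ?u + tail n k)) = qt_scale (real q powr (1 / 2)) (qterm n q (delta n - ?u) (tail n k - ?u))"
        using k by simp
    qed
    moreover have "(- ?u) (2 * n) - (- ?u) 1 = - 1" using u'(1) by simp
    moreover have "2 * n \<notin> {..2 * n - 1}" using n by auto
    ultimately show ?thesis unfolding split by (simp add: tail_2n)
  qed
  also have "\<dots> = qt_scale (real q powr (1 / 2)) (X_rep n q (inj_rep n (2 * n - 1) :: (nat list, 'k) qrep)) +
    qt_scale (real q powr (- 1 / 2)) (Poly_Mapping.single (\<lambda>j. of_bool (j = 1)) 1)"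
    unfolding X_rep_inj_rep(1)[OF n fin] qt_scale_sum last qt_scale_scale powr_add[symmetric] by simp
  finally show ?thesis .
qed

end

section \<open>Reflection at the source\<close>

lemma linear_fscale_iff:
  "Vector_Spaces.linear fscale fscale f \<longleftrightarrow>
    (\<forall>x y. f (x + y) = f x + f y) \<and> (\<forall>c x. f (fscale c x) = fscale c (f x))"
  by (simp add: Vector_Spaces.linear_def module_hom_def module_hom_axioms_def fn.module_axioms fn.vector_space_axioms)

lemma is_rep_iff:
  fixes V :: "('b, 'k::field) qrep"
  assumes "finite (UNIV :: 'k set)"
  shows "is_rep n V \<longleftrightarrow> (\<forall>i\<in>verts n. finite (sp V i) \<and> fn.subspace (sp V i)) \<and>
    (\<forall>(i, j)\<in>arrows n. Vector_Spaces.linear fscale fscale (mp V (i, j)) \<and> mp V (i, j) ` sp V i \<subseteq> sp V j)"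
proof -
  have "(\<exists>A. finite A \<and> W = fn.span A) \<longleftrightarrow> finite W \<and> fn.subspace W" for W :: "('b \<Rightarrow> 'k) set"
    using fn.finite_span[OF assms] fn.subspace_span fn.span_eq_iff by metis
  then show ?thesis unfolding is_rep_def by simp
qed

lemma linear_fscaleD:
  assumes "Vector_Spaces.linear fscale fscale f"
  shows "f (x + y) = f x + f y" "f (x - y) = f x - f y" "f (fscale c x) = fscale c (f x)" "f 0 = 0"
proof -
  show add: "f (x + y) = f x + f y" for x y using assms by (simp add: linear_fscale_iff)
  show sc: "f (fscale c x) = fscale c (f x)" for c x using assms by (simp add: linear_fscale_iff)
  show "f (x - y) = f x - f y" using add[of "x - y" y] by (simp add: algebra_simps)
  show "f 0 = 0" using sc[of 0 0] by simp
qed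

lemma is_repD:
  fixes V :: "('b, 'k::field) qrep"
  assumes "finite (UNIV :: 'k set)" "is_rep n V"
  shows "i \<in> verts n \<Longrightarrow> finite (sp V i)" "i \<in> verts n \<Longrightarrow> fn.subspace (sp V i)"
    and "(i, j) \<in> arrows n \<Longrightarrow> Vector_Spaces.linear fscale fscale (mp V (i, j))"
    and "(i, j) \<in> arrows n \<Longrightarrow> x \<in> sp V i \<Longrightarrow> mp V (i, j) x \<in> sp V j"
  using assms(2) unfolding is_rep_iff[OF assms(1)] by blast+

lemma card_eq_kernel_times_image:
  fixes S :: "('b \<Rightarrow> 'k::field) set" and f :: "('b \<Rightarrow> 'k) \<Rightarrow> 'c \<Rightarrow> 'k"
  assumes S: "fn.subspace S" "finite S" and f: "\<And>x y. f (x + y) = f x + f y"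
  shows "card S = card {x \<in> S. f x = 0} * card (f ` S)"
proof -
  have fd: "f (x - y) = f x - f y" for x y using f[of "x - y" y] by (simp add: algebra_simps)
  have fib: "card {x \<in> S. f x = z} = card {x \<in> S. f x = 0}" if "z \<in> f ` S" for z
  proof -
    obtain x0 where x0: "x0 \<in> S" "z = f x0" using \<open>z \<in> f ` S\<close> by blast
    have "bij_betw (\<lambda>x. x - x0) {x \<in> S. f x = z} {x \<in> S. f x = 0}"
      by (rule bij_betwI[where g = "\<lambda>x. x + x0"])
        (auto simp: fd f x0 fn.subspace_diff[OF S(1)] fn.subspace_add[OF S(1)])
    then show ?thesis by (rule bij_betw_same_card)
  qed
  have "card S = (\<Sum>x\<in>S. 1)" by simp
  also have "\<dots> = (\<Sum>z\<in>f ` S. \<Sum>x\<in>{x \<in> S. f x = z}. 1)"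
    using S(2) by (intro sum.group[symmetric]) auto
  also have "\<dots> = (\<Sum>z\<in>f ` S. card {x \<in> S. f x = 0})"
    by (intro sum.cong refl) (simp add: fib)
  finally show ?thesis by simp
qed

text \<open>Provides cokernels inside the same function space. A vector \<open>e\<close> with
  \<open>e t \<noteq> 0\<close> is removed by clearing the entry at \<open>t\<close>; this kills
  \<open>e\<close> and makes the image of \<open>T\<close> smaller.\<close>

lemma exists_linear_with_kernel:
  fixes T :: "('b \<Rightarrow> 'k::field) set"
  assumes "finite T" "fn.subspace T"
  shows "\<exists>p :: ('b \<Rightarrow> 'k) \<Rightarrow> ('b \<Rightarrow> 'k). Vector_Spaces.linear fscale fscale p \<and> (\<forall>z. p z = 0 \<longleftrightarrow> z \<in> T)"
  using assms
proof (induction "card T" arbitrary: T rule: less_induct)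
  case less
  show ?case
  proof (cases "T = {0}")
    case True
    then show ?thesis by (intro exI[of _ id]) (simp add: linear_fscale_iff)
  next
    case False
    then obtain e where e: "e \<in> T" "e \<noteq> 0" using fn.subspace_0[OF less.prems(2)] by blast
    then obtain t where t: "e t \<noteq> 0" by (auto simp: fun_eq_iff)
    define p where "p z = z - fscale (z t / e t) e" for z
    have p: "p (x + y) = p x + p y" "p (fscale c x) = fscale c (p x)" for x y c
      by (auto simp: p_def fscale_def fun_eq_iff field_simps t)
    have p0: "p 0 = 0" using p(2)[of 0 0] by simp
    have pe: "p e = 0" by (simp add: p_def t)
    have pT: "p z \<in> p ` T \<longleftrightarrow> z \<in> T" for z
    proof
      assume "p z \<in> p ` T"
      then obtain w where w: "w \<in> T" "p z = p w" by blast
      then have "z = w + fscale (z t / e t - w t / e t) e"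
        by (auto simp: p_def fscale_def fun_eq_iff algebra_simps)
      then show "z \<in> T" using w(1) e(1) less.prems(2) fn.subspace_add fn.subspace_scale by metis
    qed blast
    have "\<not> inj_on p T"
      using e pe p0 fn.subspace_0[OF less.prems(2)] unfolding inj_on_def by metis
    then have "card (p ` T) < card T"
      using card_image_le[OF less.prems(1), of p] eq_card_imp_inj_on[OF less.prems(1), of p] by linarith
    moreover have "fn.subspace (p ` T)" by (rule subspace_image[OF less.prems(2) p0 p])
    ultimately obtain p' :: "('b \<Rightarrow> 'k) \<Rightarrow> ('b \<Rightarrow> 'k)" where p': "Vector_Spaces.linear fscale fscale p'" "\<And>z. p' z
        = 0 \<longleftrightarrow> z \<in> p ` T"
      using less.hyps[of "p ` T"] less.prems(1) by blast
    have "Vector_Spaces.linear fscale fscale (p' \<circ> p)"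
      using p'(1) by (simp add: linear_fscale_iff p)
    moreover have "(p' \<circ> p) z = 0 \<longleftrightarrow> z \<in> T" for z using p'(2) pT by simp
    ultimately show ?thesis by blast
  qed
qed

definition comb :: "(nat \<Rightarrow> 'k::field) \<Rightarrow> (nat \<Rightarrow> 'k) \<Rightarrow> (nat \<Rightarrow> 'k)" where
  "comb f g = (\<lambda>j. if even j then f (j div 2) else g (j div 2))"

lemma comb_simps:
  "comb (a + a') (b + b') = comb a b + comb a' b'"
  "comb (fscale c a) (fscale c b) = fscale c (comb a b)"
  "comb 0 0 = 0"
  by (auto simp: comb_def fscale_def fun_eq_iff)

lemma comb_inject [simp]: "comb a b = comb a' b' \<longleftrightarrow> a = a' \<and> b = b'"
proof
  assume *: "comb a b = comb a' b'"
  have "a j = a' j" "b j = b' j" for j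
    using fun_cong[OF *, of "2 * j"] fun_cong[OF *, of "Suc (2 * j)"] by (auto simp: comb_def)
  then show "a = a' \<and> b = b'" by auto
qed simp

text \<open>
  The preinjective indecomposables form a sequence with dimension vectors \<open>chain_dim n s\<close> for
  \<open>s \<ge> 1\<close>, starting with \<open>I\<^sub>1, \<dots>, I\<^sub>2\<^sub>n\<close>. A chain exhibits a representation as a string module: the
  basis vectors are traversed along the arrows \<open>i \<rightarrow> i + 1\<close> and, backwards, along \<open>1 \<rightarrow> 2n\<close>.
\<close>

definition chain_dim :: "nat \<Rightarrow> nat \<Rightarrow> nat \<Rightarrow> nat" where
  "chain_dim n s i = (s + (2 * n - 1) - i) div (2 * n - 1)"

text \<open>Setting the vectors beyond the dimension to 0 absorbs the ends of the string, so the
  arrow conditions hold for all \<open>j\<close>. The last clause is linear independence; spanning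
  is left to a count of elements.\<close>

definition is_chain :: "nat \<Rightarrow> nat \<Rightarrow> 'k::field rep \<Rightarrow> (nat \<Rightarrow> nat \<Rightarrow> nat \<Rightarrow> 'k) \<Rightarrow> bool" where
  "is_chain n s V b \<longleftrightarrow>
    (\<forall>i\<in>verts n. \<forall>j. b i j \<in> sp V i \<and> (chain_dim n s i \<le> j \<longrightarrow> b i j = 0)) \<and>
    (\<forall>i\<in>verts n. i < 2 * n \<longrightarrow> (\<forall>j. mp V (i, Suc i) (b i j) = b (Suc i) j)) \<and>
    (\<forall>j. mp V (1, 2 * n) (b 1 j) = (case j of 0 \<Rightarrow> 0 | Suc k \<Rightarrow> b (2 * n) k)) \<and>
    (\<forall>i\<in>verts n. \<forall>f. (\<Sum>j<chain_dim n s i. fscale (f j) (b i j)) = 0 \<longrightarrow> (\<forall>j<chain_dim n s i. f j = 0))"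

lemma chain_dim_Suc: "chain_dim n (Suc s) (Suc i) = chain_dim n s i"
  by (simp add: chain_dim_def)

text \<open>The two arguments of \<open>div\<close> differ by exactly \<open>2 * n - 1\<close>. This
  determines the dimension of the new space in a reflection.\<close>

lemma chain_dim_first_last:
  assumes "n \<ge> 1" "s \<ge> 1"
  shows "chain_dim n s 1 = Suc (chain_dim n s (2 * n))"
proof -
  have "s + (2 * n - 1) - 1 = (s - 1) + (2 * n - 1)" "s + (2 * n - 1) - 2 * n = s - 1" using assms by simp_all
  moreover have "((s - 1) + (2 * n - 1)) div (2 * n - 1) = Suc ((s - 1) div (2 * n - 1))"
    using assms(1) by (intro trans[OF div_add_self2]) simp_all
  ultimately show ?thesis by (simp add: chain_dim_def)
qed

abbreviation direct_sum ::
    "nat \<Rightarrow> (nat \<Rightarrow> ('b \<Rightarrow> 'k::field) set) \<Rightarrow> (nat \<Rightarrow> ('b \<Rightarrow> 'k) set) \<Rightarrow> (nat \<Rightarrow> ('b \<Rightarrow> 'k) set) \<Rightarrow> bool" where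
  "direct_sum n U W S \<equiv>
    \<forall>i\<in>verts n. U i \<inter> W i = {0} \<and> {u + w | u w. u \<in> U i \<and> w \<in> W i} = S i"

lemma decomposition_symmetric: "direct_sum n U W S \<Longrightarrow> direct_sum n W U S"
proof (intro ballI conjI)
  fix i assume *: "direct_sum n U W S" and i: "i \<in> verts n"
  show "W i \<inter> U i = {0}" using bspec[OF * i] by (simp add: Int_commute)
  have "{u + w | u w. u \<in> W i \<and> w \<in> U i} = {u + w | u w. u \<in> U i \<and> w \<in> W i}"
    by (metis (no_types, opaque_lifting) add.commute)
  then show "{u + w | u w. u \<in> W i \<and> w \<in> U i} = S i" using bspec[OF * i] by simp
qed

section \<open>Splitting off the simple representation at the source\<close>

context
  fixes n :: nat
  assumes n: "n \<ge> 2" and fin: "finite (UNIV :: 'k::field set)"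
begin

text \<open>A vector at the source killed by both arrows spans a copy of the simple module there. A
  complement of its line, with the full spaces elsewhere, is also a submodule because no arrow ends
  at the source. Nonzero vectors at 2 keep that second summand from being zero.\<close>

lemma indecomposable_source_injective:
  fixes V :: "('b, 'k) qrep"
  assumes V: "is_rep n V" "indecomposable n V" and two: "sp V 2 \<noteq> {0}"
    and x: "x \<in> sp V 1" "mp V (1, 2) x = 0" "mp V (1, 2 * n) x = 0"
  shows "x = 0"
proof (rule ccontr)
  assume x0: "x \<noteq> 0"
  have v: "1 \<in> verts n" "2 \<in> verts n" using n by (auto simp: verts_def)
  note sub = is_repD(1,2)[OF fin V(1)] and lin = linear_fscaleD[OF is_repD(3)[OF fin V(1)]]
  \<comment> \<open>The existence of a complement is obtained from the count, which cannot be
    zero.\<close>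
  have "card (complements x {0} (sp V 1)) * card {0 :: 'b \<Rightarrow> 'k} * CARD('k) = card (sp V 1)"
    using sub[OF v(1)] x x0 fn.subspace_0[OF sub(2)[OF v(1)]] by (intro complements_count[OF fin]) auto
  moreover have "card (sp V 1) \<noteq> 0" using sub(1)[OF v(1)] x by auto
  ultimately have "complements x {0} (sp V 1) \<noteq> {}" by auto
  then obtain C where C: "fn.subspace C" "C \<subseteq> sp V 1" "x \<notin> C" "\<And>s. s \<in> sp V 1 \<Longrightarrow> \<exists>c. s - fscale c x \<in> C"
    unfolding complements_def by blast
  define U where "U = (\<lambda>i\<in>verts n. if i = 1 then range (\<lambda>c. fscale c x) else {0})"
  define W where "W = (\<lambda>i\<in>verts n. if i = 1 then C else sp V i)"
  have "U \<in> subreps n V"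
  proof (rule subrepsI)
    show "fn.subspace (U i)" if "i \<in> verts n" for i
      using that by (auto simp: U_def fn.span_singleton[symmetric] fn.subspace_span fn.subspace_single_0)
    show "U i \<subseteq> sp V i" if "i \<in> verts n" for i
    proof (cases "i = 1")
      case True
      then show ?thesis using v(1) fn.subspace_scale[OF sub(2)[OF v(1)] x(1)] by (auto simp: U_def)
    next
      case False
      then show ?thesis using that fn.subspace_0[OF sub(2)[OF that]] by (simp add: U_def)
    qed
    fix i j w assume a: "(i, j) \<in> arrows n" and w: "w \<in> U i"
    have ij: "i \<in> verts n" "j \<in> verts n" "i < j" using arrowsD[OF _ a] n by auto
    have "mp V (i, j) w = 0"
    proof (cases "i = 1")
      case True
      then have j: "j = 2 \<or> j = 2 * n" using a by (auto simp: arrows_def)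
      obtain c where "w = fscale c x" using w True v by (auto simp: U_def)
      then have "mp V (i, j) w = fscale c (mp V (i, j) x)" using lin(3)[OF a] by simp
      then show ?thesis using j x True by auto
    next
      case False
      then show ?thesis using w ij lin(4)[OF a] by (auto simp: U_def)
    qed
    then show "mp V (i, j) w \<in> U j" using ij by (auto simp: U_def)
  qed (simp add: U_def)
  moreover have "W \<in> subreps n V"
  proof (rule subrepsI)
    show "fn.subspace (W i)" "W i \<subseteq> sp V i" if "i \<in> verts n" for i using that C sub by (auto simp: W_def)
    fix i j w assume a: "(i, j) \<in> arrows n" and w: "w \<in> W i"
    have ij: "i \<in> verts n" "j \<in> verts n" "i < j" using arrowsD[OF _ a] n by auto
    have "j \<noteq> 1" using ij by (auto simp: verts_def)
    moreover have "w \<in> sp V i" using w ij C(2) by (auto simp: W_def split: if_splits)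
    ultimately show "mp V (i, j) w \<in> W j" using is_repD(4)[OF fin V(1) a] ij by (auto simp: W_def)
  qed (simp add: W_def)
  moreover have "direct_sum n U W (sp V)"
  proof
    fix i assume i: "i \<in> verts n"
    show "U i \<inter> W i = {0} \<and> {u + w | u w. u \<in> U i \<and> w \<in> W i} = sp V i"
    proof (cases "i = 1")
      case False
      then show ?thesis using i fn.subspace_0[OF sub(2)[OF i]] by (auto simp: U_def W_def)
    next
      case True
      have U1: "U i = range (\<lambda>c. fscale c x)" and W1: "W i = C" using True v by (auto simp: U_def W_def)
      have "w = 0" if w: "w \<in> U i \<inter> W i" for w
      proof -
        obtain c where c: "w = fscale c x" using w U1 by blast
        then have "c = 0" using w W1 subspace_scale_iff[OF C(1)] C(3) by blast
        then show ?thesis using c by simp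
      qed
      moreover have "0 \<in> U i \<inter> W i" using U1 W1 fn.subspace_0[OF C(1)] range_eqI[of 0 "\<lambda>c. fscale c x" 0]
          by simp
      moreover have "s \<in> {u + w | u w. u \<in> U i \<and> w \<in> W i}" if "s \<in> sp V i" for s
      proof -
        have "s \<in> sp V 1" using that True by simp
        then obtain c where c: "s - fscale c x \<in> C" using C(4) by blast
        have "s = fscale c x + (s - fscale c x)" by simp
        then show ?thesis using c U1 W1 by blast
      qed
      moreover have "u + w \<in> sp V i" if "u \<in> U i" "w \<in> W i" for u w
        using that U1 W1 C(2) x(1) True fn.subspace_add[OF sub(2)[OF i]] fn.subspace_scale[OF sub(2)[OF i]]
            by auto
      ultimately show ?thesis by blast
    qed
  qed
  ultimately have "(\<forall>i\<in>verts n. U i = {0}) \<or> (\<forall>i\<in>verts n. W i = {0})"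
    using V(2) unfolding indecomposable_def by blast
  moreover have "U 1 \<noteq> {0}"
  proof -
    have "fscale 1 x \<in> range (\<lambda>c. fscale c x)" by (rule rangeI)
    then have "x \<in> U 1" using v by (simp add: U_def)
    then show ?thesis using x0 by auto
  qed
  moreover have "W 2 \<noteq> {0}" using two v by (simp add: W_def)
  ultimately show False using v by blast
qed

end

text \<open>
  The reflection functor at the source \<open>1\<close>, with the vertices renumbered so that the result is again
  a representation of the same quiver. The new space at \<open>2n\<close> is the cokernel of the map from \<open>V\<^sub>1\<close> to
  \<open>V\<^sub>2 \<oplus> V\<^sub>2\<^sub>n\<close>, realised as the image of a linear map \<open>p\<close> with the appropriate kernel; \<open>comb\<close> embeds
  the direct sum into \<open>nat \<Rightarrow> 'k\<close>.
\<close>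

definition reflect ::
    "nat \<Rightarrow> ((nat \<Rightarrow> 'k) \<Rightarrow> (nat \<Rightarrow> 'k)) \<Rightarrow> 'k::field rep \<Rightarrow> 'k rep" where
  "reflect n p V = \<lparr>
     sp = (\<lambda>i. if i < 2 * n then sp V (Suc i)
       else p ` (\<lambda>(a, b). comb a b) ` (sp V 2 \<times> sp V (2 * n))),
     mp = (\<lambda>(i, j). if i = 1 \<and> j = 2 * n then \<lambda>a. p (comb a 0)
       else if j = 2 * n then \<lambda>b. p (comb 0 b) else mp V (Suc i, Suc j))\<rparr>"

lemma comb_mem: "a \<in> A \<Longrightarrow> b \<in> B \<Longrightarrow> comb a b \<in> (\<lambda>(a, b). comb a b) ` (A \<times> B)"
  by force

lemma comb_linear:
  "comb (x + y) 0 = comb x 0 + comb y 0" "comb 0 (x + y) = comb 0 x + comb 0 y"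
  "comb (fscale c x) 0 = fscale c (comb x 0)" "comb 0 (fscale c x) = fscale c (comb 0 x)"
  by (auto simp: comb_def fscale_def fun_eq_iff)

text \<open>Transports a submodule of the reflection back to \<open>V\<close>. After the
  renumbering, the old vertices 2 and \<open>2 * n\<close> are the new 1 and
  \<open>2 * n - 1\<close>; at the source everything is taken that both arrows send into
  \<open>U\<close>.\<close>

definition pull_family :: "nat \<Rightarrow> 'k::field rep \<Rightarrow> (nat \<Rightarrow> (nat \<Rightarrow> 'k) set) \<Rightarrow> nat \<Rightarrow> (nat \<Rightarrow> 'k) set" where
  "pull_family n V U = (\<lambda>i\<in>verts n. if i = 1 then {v \<in> sp V 1. mp V (1, 2) v \<in> U 1 \<and> mp V (1, 2 * n) v
    \<in> U (2 * n - 1)} else U (i - 1))"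

context
  fixes n :: nat
  assumes n: "n \<ge> 2"
begin

lemma v_mem: "1 \<in> verts n" "2 \<in> verts n" "2 * n \<in> verts n" "2 * n - 1 \<in> verts n"
  using n by (auto simp: verts_def)

lemma arrow_mem: "(1, 2) \<in> arrows n" "(1, 2 * n) \<in> arrows n"
  using n by (auto simp: arrows_def)

lemma reflect_simps:
  shows "i < 2 * n \<Longrightarrow> sp (reflect n p V) i = sp V (Suc i)"
    and "sp (reflect n p V) (2 * n) = p ` (\<lambda>(a, b). comb a b) ` (sp V 2 \<times> sp V (2 * n))"
    and "mp (reflect n p V) (1, 2 * n) = (\<lambda>a. p (comb a 0))"
    and "mp (reflect n p V) (2 * n - 1, 2 * n) = (\<lambda>b. p (comb 0 b))"
    and "i < 2 * n - 1 \<Longrightarrow> mp (reflect n p V) (i, Suc i) = mp V (Suc i, Suc (Suc i))"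
  using n by (auto simp: reflect_def)

lemma reflect_arrow_cases:
  assumes "(i, j) \<in> arrows n"
  obtains "i = 1" "j = 2 * n" | "i = 2 * n - 1" "j = 2 * n" | "1 \<le> i" "i < 2 * n - 1" "j = Suc i"
  using assms n by (fastforce simp: arrows_def)

end

section \<open>Dimension and indecomposability of the reflection\<close>

context
  fixes n :: nat
  assumes n: "n \<ge> 2" and fin: "finite (UNIV :: 'k::field set)"
begin

context
  fixes V :: "'k rep" and p :: "(nat \<Rightarrow> 'k) \<Rightarrow> (nat \<Rightarrow> 'k)"
  assumes V: "is_rep n V"
    and inj: "\<And>x. x \<in> sp V 1 \<Longrightarrow> mp V (1, 2) x = 0 \<Longrightarrow> mp V (1, 2 * n) x = 0 \<Longrightarrow> x = 0"
    and p: "Vector_Spaces.linear fscale fscale p"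
    and kernel: "\<And>z. p z = 0 \<longleftrightarrow> z \<in> (\<lambda>v. comb (mp V (1, 2) v) (- mp V (1, 2 * n) v)) ` sp V 1"
begin

lemmas rep_facts = is_repD[OF fin V]
lemmas rep_linear = linear_fscaleD[OF is_repD(3)[OF fin V]]
lemmas p_linear = linear_fscaleD[OF p]
lemmas reflect_eqs = reflect_simps[where p = p and V = V, OF n]

text \<open>With this sign in the kernel the two routes from the source to the new sink agree:
  \<open>p (comb (mp V (1, 2) v) 0) = p (comb 0 (mp V (1, 2 * n) v))\<close> for \<open>v\<close> in
  \<open>sp V 1\<close>.\<close>

lemma p_comb_eq_0_iff: "p (comb a b) = 0 \<longleftrightarrow> (\<exists>v\<in>sp V 1. a = mp V (1, 2) v \<and> b = - mp V (1, 2 * n) v)"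
  unfolding kernel by auto

lemma subspace_comb: "fn.subspace ((\<lambda>(a, b). comb a b) ` (sp V 2 \<times> sp V (2 * n)))" (is "fn.subspace ?S")
proof (rule fn.subspaceI)
  note s = rep_facts(2)[OF v_mem(2)[OF n]] rep_facts(2)[OF v_mem(3)[OF n]]
  show "0 \<in> ?S" using fn.subspace_0[OF s(1)] fn.subspace_0[OF s(2)]
    by (intro image_eqI[of _ _ "(0, 0)"]) (simp_all add: comb_simps)
  show "x + y \<in> ?S" if x: "x \<in> ?S" and y: "y \<in> ?S" for x y
  proof -
    obtain a b where "x = comb a b" "a \<in> sp V 2" "b \<in> sp V (2 * n)" using x by auto
    moreover obtain a' b' where "y = comb a' b'" "a' \<in> sp V 2" "b' \<in> sp V (2 * n)" using y by auto
    ultimately show ?thesis using fn.subspace_add[OF s(1)] fn.subspace_add[OF s(2)]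
      by (intro image_eqI[of _ _ "(a + a', b + b')"]) (auto simp: comb_simps)
  qed
  show "fscale c x \<in> ?S" if x: "x \<in> ?S" for c x
  proof -
    obtain a b where "x = comb a b" "a \<in> sp V 2" "b \<in> sp V (2 * n)" using x by auto
    then show ?thesis using fn.subspace_scale[OF s(1)] fn.subspace_scale[OF s(2)]
      by (intro image_eqI[of _ _ "(fscale c a, fscale c b)"]) (auto simp: comb_simps)
  qed
qed

lemma is_rep_reflect: "is_rep n (reflect n p V)"
proof -
  have arr: "Vector_Spaces.linear fscale fscale (mp (reflect n p V) (i, j)) \<and>
      mp (reflect n p V) (i, j) ` sp (reflect n p V) i \<subseteq> sp (reflect n p V) j" if "(i, j) \<in> arrows n" for i j
  proof -
    consider "i = 1" "j = 2 * n" | "i = 2 * n - 1" "j = 2 * n" | "1 \<le> i" "i < 2 * n - 1" "j = Suc i"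
      using reflect_arrow_cases[OF n \<open>(i, j) \<in> arrows n\<close>] by metis
    then show ?thesis
    proof cases
      case 1
      have "p (comb x 0) \<in> p ` (\<lambda>(a, b). comb a b) ` (sp V 2 \<times> sp V (2 * n))" if "x \<in> sp V 2" for x
        using that fn.subspace_0[OF rep_facts(2)[OF v_mem(3)[OF n]]]
        by - (rule imageI, rule comb_mem)
      moreover have "sp (reflect n p V) 1 = sp V 2" using n by (simp add: reflect_eqs(1) numeral_2_eq_2)
      ultimately show ?thesis unfolding 1 reflect_eqs(2,3)
        by (auto simp: linear_fscale_iff comb_linear p_linear)
    next
      case 2
      have "p (comb 0 x) \<in> p ` (\<lambda>(a, b). comb a b) ` (sp V 2 \<times> sp V (2 * n))" if "x \<in> sp V (2 * n)" for x
        using that fn.subspace_0[OF rep_facts(2)[OF v_mem(2)[OF n]]]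
        by - (rule imageI, rule comb_mem)
      moreover have "sp (reflect n p V) (2 * n - 1) = sp V (2 * n)" using n by (simp add: reflect_eqs(1))
      ultimately show ?thesis unfolding 2 reflect_eqs(2,4)
        by (auto simp: linear_fscale_iff comb_linear p_linear)
    next
      case 3
      have "(Suc i, Suc (Suc i)) \<in> arrows n" using 3 by (auto simp: arrows_def)
      note f = rep_facts(3)[OF this] rep_facts(4)[OF this]
      have "sp (reflect n p V) i = sp V (Suc i)" "sp (reflect n p V) (Suc i) = sp V (Suc (Suc i))"
        using 3 by (simp_all add: reflect_eqs(1))
      then show ?thesis unfolding 3(3) reflect_eqs(5)[OF 3(2)] using f by auto
    qed
  qed
  show ?thesis
    unfolding is_rep_iff[OF fin]
  proof (intro conjI ballI)
    fix i assume i: "i \<in> verts n"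
    show "finite (sp (reflect n p V) i)"
      using i rep_facts(1)[of "Suc i"] rep_facts(1)[OF v_mem(2)[OF n]] rep_facts(1)[OF v_mem(3)[OF n]]
      by (auto simp: reflect_def verts_def)
    show "fn.subspace (sp (reflect n p V) i)"
    proof (cases "i < 2 * n")
      case True
      then show ?thesis using i rep_facts(2)[of "Suc i"] by (simp add: reflect_eqs verts_def)
    next
      case False
      then have "i = 2 * n" using i by (simp add: verts_def)
      then show ?thesis unfolding reflect_eqs(2)
        using subspace_image[OF subspace_comb p_linear(4,1,3)] by (simp only: reflect_eqs(2))
    qed
  next
    fix a assume "a \<in> arrows n"
    then show "case a of (i, j) \<Rightarrow> Vector_Spaces.linear fscale fscale (mp (reflect n p V) (i, j)) \<and>
        mp (reflect n p V) (i, j) ` sp (reflect n p V) i \<subseteq> sp (reflect n p V) j"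
      using arr by (cases a) simp
  qed
qed

text \<open>The sequence from \<open>sp V 1\<close> through the direct sum of the spaces at 2 and
  \<open>2 * n\<close> to the new space is short exact; \<open>inj\<close> gives exactness on the
  left.\<close>

lemma card_reflect_last:
  "card (sp V 2) * card (sp V (2 * n)) = card (sp V 1) * card (sp (reflect n p V) (2 * n))"
proof -
  let ?S = "(\<lambda>(a, b). comb a b) ` (sp V 2 \<times> sp V (2 * n))"
  let ?g = "\<lambda>v. comb (mp V (1, 2) v) (- mp V (1, 2 * n) v)"
  note s = rep_facts(2)[OF v_mem(1)[OF n]] rep_facts(2)[OF v_mem(3)[OF n]]
  have fS: "finite ?S" using rep_facts(1)[OF v_mem(2)[OF n]] rep_facts(1)[OF v_mem(3)[OF n]] by simp
  have "inj_on (\<lambda>(a, b). comb a b) (sp V 2 \<times> sp V (2 * n))" by (auto intro!: inj_onI)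
  then have "card ?S = card (sp V 2) * card (sp V (2 * n))" by (simp add: card_image card_cartesian_product)
  moreover have "card ?S = card {x \<in> ?S. p x = 0} * card (p ` ?S)"
    by (rule card_eq_kernel_times_image[OF subspace_comb fS p_linear(1)])
  moreover have "{x \<in> ?S. p x = 0} = ?g ` sp V 1"
  proof
    show "?g ` sp V 1 \<subseteq> {x \<in> ?S. p x = 0}"
    proof clarify
      fix v assume v: "v \<in> sp V 1"
      have "mp V (1, 2) v \<in> sp V 2" "- mp V (1, 2 * n) v \<in> sp V (2 * n)"
        using rep_facts(4)[OF arrow_mem(1)[OF n] v] rep_facts(4)[OF arrow_mem(2)[OF n] v] fn.subspace_neg[OF s(2)] by auto
      then show "?g v \<in> ?S \<and> p (?g v) = 0" using kernel v by auto
    qed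
    show "{x \<in> ?S. p x = 0} \<subseteq> ?g ` sp V 1" using kernel by blast
  qed
  moreover have "card (?g ` sp V 1) = card (sp V 1)"
  proof (rule card_image, rule inj_onI)
    fix v w assume vw: "v \<in> sp V 1" "w \<in> sp V 1" "?g v = ?g w"
    then have "mp V (1, 2) (v - w) = 0" "mp V (1, 2 * n) (v - w) = 0"
      unfolding rep_linear(2)[OF arrow_mem(1)[OF n]] rep_linear(2)[OF arrow_mem(2)[OF n]] by simp_all
    moreover have "v - w \<in> sp V 1" using fn.subspace_diff[OF s(1) vw(1,2)] .
    ultimately show "v = w" using inj by (metis eq_iff_diff_eq_0)
  qed
  ultimately show ?thesis unfolding reflect_eqs(2) by simp
qed

text \<open>The new space is generated by the images of the two arrows. If \<open>U\<close> vanishes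
  before the sink, then \<open>W\<close> is full there and hence full at the sink too. This is
  needed because \<open>pull_family\<close> forgets \<open>U (2 * n)\<close>.\<close>

lemma reflect_subrep_last_zero:
  assumes U: "U \<in> subreps n (reflect n p V)" and W: "W \<in> subreps n (reflect n p V)"
    and dec: "direct_sum n U W (sp (reflect n p V))"
    and z: "\<And>i. i \<in> verts n \<Longrightarrow> i < 2 * n \<Longrightarrow> U i = {0}"
  shows "U (2 * n) = {0}"
proof -
  have full: "W i = sp (reflect n p V) i" if "i \<in> verts n" "i < 2 * n" for i
    using bspec[OF dec that(1)] z[OF that] by simp
  have "U (2 * n) \<subseteq> W (2 * n)"
  proof
    fix u assume "u \<in> U (2 * n)"
    then have "u \<in> sp (reflect n p V) (2 * n)" using subrepsD(3)[OF U v_mem(3)[OF n]] by blast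
    then obtain a b where ab: "u = p (comb a b)" "a \<in> sp V 2" "b \<in> sp V (2 * n)"
      unfolding reflect_eqs(2) by auto
    have "a \<in> W 1" using full[OF v_mem(1)[OF n]] ab(2) n by (simp add: reflect_eqs(1) numeral_2_eq_2)
    moreover have "b \<in> W (2 * n - 1)" using full[OF v_mem(4)[OF n]] ab(3) n by (simp add: reflect_eqs(1))
    moreover have "(2 * n - 1, 2 * n) \<in> arrows n" using n by (auto simp: arrows_def)
    ultimately have "p (comb a 0) \<in> W (2 * n)" "p (comb 0 b) \<in> W (2 * n)"
      using subrepsD(4)[OF W arrow_mem(2)[OF n], of a] subrepsD(4)[OF W, of "2 * n - 1" "2 * n" b]
      unfolding reflect_eqs(3,4) by blast+
    then have "p (comb a 0) + p (comb 0 b) \<in> W (2 * n)"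
        by (rule fn.subspace_add[OF subrepsD(2)[OF W v_mem(3)[OF n]]])
    moreover have "p (comb a 0) + p (comb 0 b) = u"
        unfolding ab(1) p_linear(1)[symmetric] comb_simps(1)[symmetric] by simp
    ultimately show "u \<in> W (2 * n)" by simp
  qed
  then show ?thesis using bspec[OF dec v_mem(3)[OF n]] by auto
qed

lemma pull_family_subrep:
  assumes U: "U \<in> subreps n (reflect n p V)"
  shows "pull_family n V U \<in> subreps n V"
proof (rule subrepsI)
  have s1: "fn.subspace (pull_family n V U 1)"
  proof -
    have "fn.subspace (sp V 1 \<inter> (mp V (1, 2) -` U 1 \<inter> mp V (1, 2 * n) -` U (2 * n - 1)))"
      using rep_facts(2)[OF v_mem(1)[OF n]] subspace_vimage[OF subrepsD(2)[OF U v_mem(1)[OF n]] rep_linear(4,1,3)[OF arrow_mem(1)[OF n]]]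
        subspace_vimage[OF subrepsD(2)[OF U v_mem(4)[OF n]] rep_linear(4,1,3)[OF arrow_mem(2)[OF n]]]
      by (intro fn.subspace_inter)
    moreover have "pull_family n V U 1 = sp V 1 \<inter> (mp V (1, 2) -` U 1 \<inter> mp V (1, 2 * n) -` U (2 * n - 1))"
      using v_mem[OF n] by (auto simp: pull_family_def)
    ultimately show ?thesis by simp
  qed
  have pred: "i - 1 \<in> verts n" "i - 1 < 2 * n" "Suc (i - 1) = i" if "i \<in> verts n" "i \<noteq> 1" for i
    using that by (auto simp: verts_def)
  show "fn.subspace (pull_family n V U i)" if i: "i \<in> verts n" for i
  proof (cases "i = 1")
    case False
    then show ?thesis using subrepsD(2)[OF U pred(1)[OF i False]] i by (simp add: pull_family_def)
  qed (use s1 in simp)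
  show "pull_family n V U i \<subseteq> sp V i" if i: "i \<in> verts n" for i
  proof (cases "i = 1")
    case False
    then show ?thesis using subrepsD(3)[OF U pred(1)[OF i False]] reflect_eqs(1)[OF pred(2)[OF i False]] pred(3)[OF i False] i
      by (simp add: pull_family_def)
  qed (use i in \<open>auto simp: pull_family_def\<close>)
  fix i j x assume a: "(i, j) \<in> arrows n" and x: "x \<in> pull_family n V U i"
  have ij: "i \<in> verts n" "j \<in> verts n" "i < j" using arrowsD[OF _ a] n by auto
  show "mp V (i, j) x \<in> pull_family n V U j"
  proof (cases "i = 1")
    case True
    then have "j = 2 \<or> j = 2 * n" using a by (auto simp: arrows_def)
    then show ?thesis using x True ij n by (auto simp: pull_family_def numeral_2_eq_2)
  next
    case False
    then have j: "j = Suc i" using a by (auto simp: arrows_def)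
    have i1: "i - 1 < 2 * n - 1" using ij j by (auto simp: verts_def)
    have "(i - 1, Suc (i - 1)) \<in> arrows n" using ij False i1 by (auto simp: arrows_def verts_def)
    moreover have "x \<in> U (i - 1)" using x ij False by (simp add: pull_family_def)
    ultimately have "mp (reflect n p V) (i - 1, Suc (i - 1)) x \<in> U (Suc (i - 1))" by (rule subrepsD(4)[OF U])
    then have "mp V (i, j) x \<in> U i"
      unfolding pred(3)[OF ij(1) False] reflect_eqs(5)[OF i1, unfolded pred(3)[OF ij(1) False]] j .
    moreover have "i \<noteq> 0" using ij by (auto simp: verts_def)
    ultimately show ?thesis using ij j False by (simp add: pull_family_def)
  qed
qed (simp add: pull_family_def)

text \<open>The critical vertex is the source. Split both images of \<open>v\<close> along
  \<open>U\<close> and \<open>W\<close>. The class of the \<open>U\<close>-part in the cokernel lies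
  in \<open>U (2 * n)\<close> and, being the negative of that of the \<open>W\<close>-part, in
  \<open>W (2 * n)\<close>; so it is 0, and the \<open>U\<close>-part comes from a vector at the
  source.\<close>

lemma pull_family_decomposition:
  assumes U: "U \<in> subreps n (reflect n p V)" and W: "W \<in> subreps n (reflect n p V)"
    and dec: "direct_sum n U W (sp (reflect n p V))"
    and i: "i \<in> verts n"
  shows "pull_family n V U i \<inter> pull_family n V W i = {0} \<and>
    {u + w | u w. u \<in> pull_family n V U i \<and> w \<in> pull_family n V W i} = sp V i"
proof (cases "i = 1")
  case False
  have p1: "i - 1 \<in> verts n" "i - 1 < 2 * n" "Suc (i - 1) = i" using i False by (auto simp: verts_def)
  then show ?thesis using bspec[OF dec p1(1)] reflect_eqs(1)[OF p1(2)] i False by (simp add: pull_family_def)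
next
  case True
  note sU = subrepsD(2)[OF pull_family_subrep[OF U] v_mem(1)[OF n]]
      and sW = subrepsD(2)[OF pull_family_subrep[OF W] v_mem(1)[OF n]]
  have memU: "v \<in> pull_family n V U 1 \<longleftrightarrow> v \<in> sp V 1 \<and> mp V (1, 2) v \<in> U 1 \<and> mp V (1, 2 * n) v \<in> U (2 * n - 1)"
    and memW: "v \<in> pull_family n V W 1 \<longleftrightarrow> v \<in> sp V 1 \<and> mp V (1, 2) v \<in> W 1 \<and> mp V (1, 2 * n) v \<in> W (2 * n - 1)"
        for v
    using v_mem[OF n] by (auto simp: pull_family_def)
  have d1: "U 1 \<inter> W 1 = {0}" "{u + w | u w. u \<in> U 1 \<and> w \<in> W 1} = sp V 2"
    using bspec[OF dec v_mem(1)[OF n]] n by (simp_all add: reflect_eqs(1) numeral_2_eq_2)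
  have d2: "U (2 * n - 1) \<inter> W (2 * n - 1) = {0}"
    "{u + w | u w. u \<in> U (2 * n - 1) \<and> w \<in> W (2 * n - 1)} = sp V (2 * n)"
    using bspec[OF dec v_mem(4)[OF n]] n by (simp_all add: reflect_eqs(1))
  have d3: "U (2 * n) \<inter> W (2 * n) = {0}" using bspec[OF dec v_mem(3)[OF n]] by blast
  have last: "p (comb a (- b)) \<in> X (2 * n)" if X: "X \<in> subreps n (reflect n p V)"
      and ab: "a \<in> X 1" "b \<in> X (2 * n - 1)" for X a b
  proof -
    have "(2 * n - 1, 2 * n) \<in> arrows n" using n by (auto simp: arrows_def)
    then have "p (comb a 0) \<in> X (2 * n)" "p (comb 0 b) \<in> X (2 * n)"
      using subrepsD(4)[OF X arrow_mem(2)[OF n] ab(1)] subrepsD(4)[OF X _ ab(2), of "2 * n"]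
          unfolding reflect_eqs(3,4) by blast+
    then have "p (comb a 0) - p (comb 0 b) \<in> X (2 * n)"
        by (rule fn.subspace_diff[OF subrepsD(2)[OF X v_mem(3)[OF n]]])
    moreover have "comb a 0 - comb 0 b = comb a (- b)" by (auto simp: comb_def fun_eq_iff)
    ultimately show ?thesis by (simp add: p_linear(2)[symmetric])
  qed
  have "v = 0" if "v \<in> pull_family n V U 1 \<inter> pull_family n V W 1" for v
  proof -
    have "mp V (1, 2) v \<in> U 1 \<inter> W 1" "mp V (1, 2 * n) v \<in> U (2 * n - 1) \<inter> W (2 * n - 1)"
      using that memU memW by blast+
    then show ?thesis using d1(1) d2(1) inj[of v] that memU by auto
  qed
  then have int: "pull_family n V U 1 \<inter> pull_family n V W 1 = {0}"
    using fn.subspace_0[OF sU] fn.subspace_0[OF sW] by blast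
  have "v \<in> {u + w | u w. u \<in> pull_family n V U 1 \<and> w \<in> pull_family n V W 1}" if v: "v \<in> sp V 1" for v
  proof -
    have "mp V (1, 2) v \<in> {u + w | u w. u \<in> U 1 \<and> w \<in> W 1}" unfolding d1(2)
        by (rule rep_facts(4)[OF arrow_mem(1)[OF n] v])
    then obtain a a' where a: "mp V (1, 2) v = a + a'" "a \<in> U 1" "a' \<in> W 1" by blast
    have "mp V (1, 2 * n) v \<in> {u + w | u w. u \<in> U (2 * n - 1) \<and> w \<in> W (2 * n - 1)}"
      unfolding d2(2) by (rule rep_facts(4)[OF arrow_mem(2)[OF n] v])
    then obtain b b' where b: "mp V (1, 2 * n) v = b + b'" "b \<in> U (2 * n - 1)" "b' \<in> W (2 * n - 1)" by blast
    have "p (comb (a + a') (- (b + b'))) = 0"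
      unfolding a(1)[symmetric] b(1)[symmetric] kernel using v by (rule imageI)
    moreover have "comb (a + a') (- (b + b')) = comb a (- b) + comb a' (- b')"
      unfolding comb_simps(1)[symmetric] by simp
    ultimately have "p (comb a (- b)) + p (comb a' (- b')) = 0" by (simp add: p_linear(1))
    then have eq: "p (comb a (- b)) = - p (comb a' (- b'))" by (rule eq_neg_iff_add_eq_0[THEN iffD2])
    have "p (comb a (- b)) \<in> U (2 * n)" by (rule last[OF U a(2) b(2)])
    moreover have "p (comb a (- b)) \<in> W (2 * n)"
      unfolding eq by (rule fn.subspace_neg[OF subrepsD(2)[OF W v_mem(3)[OF n]] last[OF W a(3) b(3)]])
    ultimately have "p (comb a (- b)) = 0" using d3 by blast
    then obtain w where w: "w \<in> sp V 1" "a = mp V (1, 2) w" "b = mp V (1, 2 * n) w"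
      unfolding p_comb_eq_0_iff by auto
    have "w \<in> pull_family n V U 1" using w a(2) b(2) memU by simp
    moreover have "v - w \<in> pull_family n V W 1"
      unfolding memW rep_linear(2)[OF arrow_mem(1)[OF n]] rep_linear(2)[OF arrow_mem(2)[OF n]]
      using a b w v fn.subspace_diff[OF rep_facts(2)[OF v_mem(1)[OF n]] v w(1)] by simp
    moreover have "v = w + (v - w)" by simp
    ultimately show ?thesis by blast
  qed
  moreover have "u + w \<in> sp V 1" if "u \<in> pull_family n V U 1" "w \<in> pull_family n V W 1" for u w
    using that memU memW fn.subspace_add[OF rep_facts(2)[OF v_mem(1)[OF n]]] by blast
  ultimately have "{u + w | u w. u \<in> pull_family n V U 1 \<and> w \<in> pull_family n V W 1} = sp V 1" by blast
  then show ?thesis using int True by simp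
qed

text \<open>One side of the pulled back decomposition is zero. Its original is then zero at all
  vertices before the sink, and \<open>reflect_subrep_last_zero\<close> settles the sink.\<close>

lemma indecomposable_reflect:
  assumes ind: "indecomposable n V" and two: "sp V 2 \<noteq> {0}"
  shows "indecomposable n (reflect n p V)"
  unfolding indecomposable_def
proof (intro conjI ballI impI)
  have "sp (reflect n p V) 1 \<noteq> {0}" using two n by (simp add: reflect_eqs(1) numeral_2_eq_2)
  then show "\<exists>i\<in>verts n. sp (reflect n p V) i \<noteq> {0}" using v_mem(1)[OF n] by blast
  fix U W assume U: "U \<in> subreps n (reflect n p V)" and W: "W \<in> subreps n (reflect n p V)"
    and dec: "direct_sum n U W (sp (reflect n p V))"
  have step: "\<forall>i\<in>verts n. X i = {0}" if X: "X \<in> subreps n (reflect n p V)"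
      and Y: "Y \<in> subreps n (reflect n p V)"
    and dec: "direct_sum n X Y (sp (reflect n p V))"
    and z: "\<forall>i\<in>verts n. pull_family n V X i = {0}" for X Y
  proof -
    have X0: "X i = {0}" if "i \<in> verts n" "i < 2 * n" for i
    proof -
      have "Suc i \<in> verts n" "Suc i \<noteq> 1" using that by (auto simp: verts_def)
      then show ?thesis using bspec[OF z, of "Suc i"] by (simp add: pull_family_def)
    qed
    then have "X (2 * n) = {0}" by (rule reflect_subrep_last_zero[OF X Y dec])
    show ?thesis
    proof
      fix i assume "i \<in> verts n"
      then show "X i = {0}" using X0 \<open>X (2 * n) = {0}\<close> by (cases "i < 2 * n") (auto simp: verts_def)
    qed
  qed
  have "(\<forall>i\<in>verts n. pull_family n V U i = {0}) \<or> (\<forall>i\<in>verts n. pull_family n V W i = {0})"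
  proof (rule mp[OF bspec[OF bspec[OF conjunct2[OF ind[unfolded indecomposable_def]]]]])
    show "pull_family n V U \<in> subreps n V" "pull_family n V W \<in> subreps n V"
      by (rule pull_family_subrep, fact)+
    show "direct_sum n (pull_family n V U) (pull_family n V W) (sp V)"
      using pull_family_decomposition[OF U W dec] by (rule ballI)
  qed
  then show "(\<forall>i\<in>verts n. U i = {0}) \<or> (\<forall>i\<in>verts n. W i = {0})"
    using step[OF U W dec] step[OF W U decomposition_symmetric[OF dec]] by blast
qed

end

end

section \<open>Classification of the preinjective representations\<close>

lemma sum_fscale_Suc:
  "(\<Sum>j<Suc d. fscale (f j) (g j)) = fscale (f 0) (g 0) + (\<Sum>j<d. fscale (f (Suc j)) (g (Suc j)))"
  by (rule sum.lessThan_Suc_shift)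

lemma linear_sum_fscale:
  assumes "Vector_Spaces.linear fscale fscale h"
  shows "h (\<Sum>j\<in>A. fscale (f j) (g j)) = (\<Sum>j\<in>A. fscale (f j) (h (g j)))"
proof -
  have "h 0 = 0" using assms unfolding linear_fscale_iff by (metis fn.scale_zero_left)
  then show ?thesis
    using assms by (induction A rule: infinite_finite_induct) (simp_all add: linear_fscale_iff)
qed

lemma sum_extend_zero:
  fixes g :: "nat \<Rightarrow> 'b \<Rightarrow> 'k::field"
  assumes "d \<le> d'" "\<And>j. d \<le> j \<Longrightarrow> g j = 0"
  shows "(\<Sum>j<d'. fscale (f j) (g j)) = (\<Sum>j<d. fscale (f j) (g j))"
  using assms by (intro sum.mono_neutral_right) auto

section \<open>Existence of chains, and invariance of the characters under isomorphism\<close>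

context
  fixes n :: nat
  assumes n: "n \<ge> 2" and fin: "finite (UNIV :: 'k::field set)"
begin

lemma is_chainD:
  assumes "is_chain n s V b"
  shows "i \<in> verts n \<Longrightarrow> b i j \<in> sp V i" "i \<in> verts n \<Longrightarrow> chain_dim n s i \<le> j \<Longrightarrow> b i j = 0"
    "i \<in> verts n \<Longrightarrow> i < 2 * n \<Longrightarrow> mp V (i, Suc i) (b i j) = b (Suc i) j"
    "mp V (1, 2 * n) (b 1 0) = 0" "mp V (1, 2 * n) (b 1 (Suc k)) = b (2 * n) k"
    "i \<in> verts n \<Longrightarrow> (\<Sum>j<chain_dim n s i. fscale (f j) (b i j)) = 0 \<Longrightarrow> j < chain_dim n s i \<Longrightarrow> f j = 0"
proof -
  have c: "\<forall>i\<in>verts n. \<forall>j. b i j \<in> sp V i \<and> (chain_dim n s i \<le> j \<longrightarrow> b i j = 0)"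
    "\<forall>i\<in>verts n. i < 2 * n \<longrightarrow> (\<forall>j. mp V (i, Suc i) (b i j) = b (Suc i) j)"
    "\<forall>j. mp V (1, 2 * n) (b 1 j) = (case j of 0 \<Rightarrow> 0 | Suc k \<Rightarrow> b (2 * n) k)"
    "\<forall>i\<in>verts n. \<forall>f. (\<Sum>j<chain_dim n s i. fscale (f j) (b i j)) = 0 \<longrightarrow> (\<forall>j<chain_dim n s i. f j = 0)"
    using assms unfolding is_chain_def by - (elim conjE, assumption)+
  show "i \<in> verts n \<Longrightarrow> b i j \<in> sp V i" "i \<in> verts n \<Longrightarrow> chain_dim n s i \<le> j \<Longrightarrow> b i j = 0"
    using c(1) by blast+
  show "i \<in> verts n \<Longrightarrow> i < 2 * n \<Longrightarrow> mp V (i, Suc i) (b i j) = b (Suc i) j" using c(2) by blast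
  show "mp V (1, 2 * n) (b 1 0) = 0" "mp V (1, 2 * n) (b 1 (Suc k)) = b (2 * n) k"
    using spec[OF c(3), of 0] spec[OF c(3), of "Suc k"] by simp_all
  show "i \<in> verts n \<Longrightarrow> (\<Sum>j<chain_dim n s i. fscale (f j) (b i j)) = 0 \<Longrightarrow> j < chain_dim n s i \<Longrightarrow> f j = 0"
    using c(4) by blast
qed

text \<open>The dimensions are those of the simple module at 1, and any nonzero vector there is the
  whole chain.\<close>

lemma chain_base:
  fixes V :: "'k rep"
  assumes V: "is_rep n V" and dim: "\<And>i. i \<in> verts n \<Longrightarrow> card (sp V i) = CARD('k) ^ chain_dim n 1 i"
  shows "\<exists>b. is_chain n 1 V b"
proof -
  note r = is_repD[OF fin V]
  have d: "chain_dim n 1 i = of_bool (i = 1)" if "i \<in> verts n" for i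
    using that n by (auto simp: chain_dim_def verts_def)
  have v: "1 \<in> verts n" "2 * n \<in> verts n" using n by (auto simp: verts_def)
  have z: "x = 0" if i: "i \<in> verts n" "i \<noteq> 1" and x: "x \<in> sp V i" for x i
  proof -
    have "card (sp V i) = 1" using dim[OF i(1)] d[OF i(1)] i(2) by simp
    then obtain w where "sp V i = {w}" by (rule card_1_singletonE)
    then show ?thesis using x fn.subspace_0[OF r(2)[OF i(1)]] by auto
  qed
  have "card (sp V 1) > 1" using dim[OF v(1)] d[OF v(1)] card_gt_one_field[OF fin] by simp
  then have "\<not> sp V 1 \<subseteq> {0}" by (metis card_mono finite.emptyI finite_insert card_1_singleton_iff One_nat_def not_less)
  then obtain x where x: "x \<in> sp V 1" "x \<noteq> 0" by blast
  define b where "b i j = (if i = 1 \<and> j = 0 then x else 0)" for i j :: nat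
  have arr0: "mp V (1, j) (b 1 k) = 0" if a: "(1, j) \<in> arrows n" for j k
  proof -
    have j: "j \<in> verts n" "j \<noteq> 1" using arrowsD[OF _ a] n by auto
    have "b 1 k \<in> sp V 1" using x fn.subspace_0[OF r(2)[OF v(1)]] by (simp add: b_def)
    then show ?thesis using r(4)[OF a] z[OF j] by blast
  qed
  have "is_chain n 1 V b"
    unfolding is_chain_def
  proof (intro conjI ballI allI impI)
    fix i j assume i: "i \<in> verts n"
    show "b i j \<in> sp V i" using x(1) fn.subspace_0[OF r(2)[OF i]] by (simp add: b_def)
    show "b i j = 0" if "chain_dim n 1 i \<le> j" using that d[OF i] by (auto simp: b_def)
  next
    fix i j assume i: "i \<in> verts n" "i < 2 * n"
    then have a: "(i, Suc i) \<in> arrows n" by (auto simp: arrows_def verts_def)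
    show "mp V (i, Suc i) (b i j) = b (Suc i) j"
    proof (cases "i = 1")
      case True
      then show ?thesis using arr0[of "Suc i" j] a by (simp add: b_def)
    next
      case False
      then show ?thesis using i linear_fscaleD(4)[OF r(3)[OF a]] by (auto simp: b_def verts_def)
    qed
  next
    fix j
    have "(1, 2 * n) \<in> arrows n" by (simp add: arrows_def)
    then have "mp V (1, 2 * n) (b 1 j) = 0" by (rule arr0)
    moreover have "b (2 * n) k = 0" for k using n by (simp add: b_def)
    ultimately show "mp V (1, 2 * n) (b 1 j) = (case j of 0 \<Rightarrow> 0 | Suc k \<Rightarrow> b (2 * n) k)"
      by (simp split: nat.splits)
  next
    fix i f j assume i: "i \<in> verts n" and s: "(\<Sum>j<chain_dim n 1 i. fscale (f j) (b i j)) = 0"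
        and j: "j < chain_dim n 1 i"
    have "i = 1" "j = 0" using d[OF i] j by (cases "i = 1"; simp)+
    then have "fscale (f 0) x = 0" using s d[OF i] by (simp add: b_def)
    then show "f j = 0" using x(2) \<open>j = 0\<close> by simp
  qed
  then show ?thesis by blast
qed

text \<open>The chain of the reflection lacks only the vectors at the source. The
  \<open>j\<close>-th must map to \<open>b' 1 j\<close> and to
  \<open>b' (2 * n - 1) (j - 1)\<close>, or 0 if \<open>j = 0\<close>; these have the same image in
  the cokernel, so a common preimage exists.\<close>

lemma chain_lift:
  fixes V :: "'k rep"
  assumes V: "is_rep n V" and s: "s \<ge> 1"
    and inj: "\<And>x. x \<in> sp V 1 \<Longrightarrow> mp V (1, 2) x = 0 \<Longrightarrow> mp V (1, 2 * n) x = 0 \<Longrightarrow> x = 0"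
    and p: "Vector_Spaces.linear fscale fscale p"
    and kernel: "\<And>z. p z = 0 \<longleftrightarrow> z \<in> (\<lambda>v. comb (mp V (1, 2) v) (- mp V (1, 2 * n) v)) ` sp V 1"
    and b': "is_chain n s (reflect n p V) b'"
  shows "\<exists>b. is_chain n (Suc s) V b"
proof -
  note r = is_repD[OF fin V] and c = is_chainD[OF b'] and rl = linear_fscaleD[OF is_repD(3)[OF fin V]]
    and a = arrow_mem[OF n] and v = v_mem[OF n] and rs = reflect_simps[where p = p and V = V, OF n]
    and pl = linear_fscaleD[OF p]
  have first: "\<exists>w\<in>sp V 1. mp V (1, 2) w = b' 1 j \<and> mp V (1, 2 * n) w
      = (case j of 0 \<Rightarrow> 0 | Suc k \<Rightarrow> b' (2 * n - 1) k)" for j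
  proof -
    define w where "w = (case j of 0 \<Rightarrow> 0 | Suc k \<Rightarrow> b' (2 * n - 1) k)"
    have "p (comb 0 (b' (2 * n - 1) k)) = b' (2 * n) k" for k
    proof -
      have e: "Suc (2 * n - 1) = 2 * n" "2 * n - 1 < 2 * n" using n by simp_all
      show ?thesis using c(3)[OF v(4) e(2), of k] unfolding e(1) rs(4) .
    qed
    then have "p (comb (b' 1 j) 0) = p (comb 0 w)"
      using c(4) c(5) unfolding rs(3) by (cases j) (auto simp: w_def comb_simps pl)
    moreover have "comb (b' 1 j) (- w) = comb (b' 1 j) 0 - comb 0 w" by (auto simp: comb_def fun_eq_iff)
    ultimately have "p (comb (b' 1 j) (- w)) = 0" by (simp add: pl)
    then obtain v where "v \<in> sp V 1" "b' 1 j = mp V (1, 2) v" "- w = - mp V (1, 2 * n) v"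
      using kernel by (auto simp only: comb_inject)
    then show ?thesis unfolding w_def[symmetric] by (intro bexI[of _ v]) simp_all
  qed
  then obtain w where w: "\<And>j. w j \<in> sp V 1" "\<And>j. mp V (1, 2) (w j) = b' 1 j"
    "\<And>j. mp V (1, 2 * n) (w j) = (case j of 0 \<Rightarrow> 0 | Suc k \<Rightarrow> b' (2 * n - 1) k)"
    by metis
  define b where "b i j = (if i = 1 then w j else b' (i - 1) j)" for i j
  have pred: "i - 1 \<in> verts n" "i - 1 < 2 * n" "Suc (i - 1) = i" "chain_dim n (Suc s) i = chain_dim n s (i - 1)"
    if "i \<in> verts n" "i \<noteq> 1" for i
  proof -
    show "i - 1 \<in> verts n" "i - 1 < 2 * n" and i: "Suc (i - 1) = i" using that by (auto simp: verts_def)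
    show "chain_dim n (Suc s) i = chain_dim n s (i - 1)"
      using chain_dim_Suc[of n s "i - 1"] unfolding i .
  qed
  have d1: "chain_dim n (Suc s) 1 = Suc (chain_dim n s (2 * n - 1))"
    using chain_dim_first_last[of n "Suc s"] n pred(4)[OF v(3)] by simp
  have d1': "chain_dim n s 1 \<le> chain_dim n (Suc s) 1"
    by (auto simp: chain_dim_def intro!: div_le_mono)
  have d10: "chain_dim n s 1 > 0" using chain_dim_first_last[OF _ s] n by simp
  have "is_chain n (Suc s) V b"
    unfolding is_chain_def
  proof (intro conjI ballI allI impI)
    fix i j assume i: "i \<in> verts n"
    show "b i j \<in> sp V i"
    proof (cases "i = 1")
      case False
      then show ?thesis using c(1)[OF pred(1)[OF i False], of j] rs(1)[OF pred(2)[OF i False]] pred(3)[OF i False]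
        by (simp add: b_def)
    qed (use w in \<open>simp add: b_def\<close>)
    show "b i j = 0" if le: "chain_dim n (Suc s) i \<le> j"
    proof (cases "i = 1")
      case True
      \<comment> \<open>Beyond the dimension both images are zero, so \<open>inj\<close> forces the
        chosen preimage to be zero.\<close>
      have "b' 1 j = 0" using c(2)[OF v(1)] d1' le True by simp
      moreover have "(case j of 0 \<Rightarrow> 0 | Suc k \<Rightarrow> b' (2 * n - 1) k) = 0"
        using c(2)[OF v(4)] le d1 True by (auto split: nat.splits)
      ultimately have "w j = 0" using inj[OF w(1)[of j]] unfolding w(2,3) by blast
      then show ?thesis using True by (simp add: b_def)
    next
      case False
      then show ?thesis using c(2)[OF pred(1)[OF i False]] le pred(4)[OF i False] by (simp add: b_def)
    qed
  next
    fix i j assume i: "i \<in> verts n" "i < 2 * n"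
    show "mp V (i, Suc i) (b i j) = b (Suc i) j"
    proof (cases "i = 1")
      case True
      then show ?thesis using w(2)[of j] by (simp add: b_def numeral_2_eq_2)
    next
      case False
      note P = pred[OF i(1) False]
      have i1: "i - 1 < 2 * n - 1" using i(2) False P(3) by linarith
      have "mp (reflect n p V) (i - 1, Suc (i - 1)) (b' (i - 1) j) = b' (Suc (i - 1)) j"
          by (rule c(3)[OF P(1,2)])
      then have "mp V (i, Suc i) (b' (i - 1) j) = b' i j"
        unfolding P(3) rs(5)[OF i1, unfolded P(3)] .
      moreover have "Suc i \<noteq> 1" using i by (auto simp: verts_def)
      ultimately show ?thesis using False by (simp add: b_def)
    qed
  next
    fix j
    have "b (2 * n) k = b' (2 * n - 1) k" "b 1 k = w k" for k using n by (simp_all add: b_def)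
    then show "mp V (1, 2 * n) (b 1 j) = (case j of 0 \<Rightarrow> 0 | Suc k \<Rightarrow> b (2 * n) k)"
      using w(3)[of j] by (simp only:)
  next
    fix i f j assume i: "i \<in> verts n" and sm: "(\<Sum>j<chain_dim n (Suc s) i. fscale (f j) (b i j)) = 0"
      and j: "j < chain_dim n (Suc s) i"
    show "f j = 0"
    proof (cases "i = 1")
      case False
      then show ?thesis using c(6)[OF pred(1)[OF i False], of f j] sm j pred(4)[OF i False] by (simp add: b_def)
    next
      case True
      let ?d = "chain_dim n (Suc s) 1"
      have smw: "(\<Sum>j<?d. fscale (f j) (w j)) = 0" using sm True by (simp add: b_def)
      have "(\<Sum>j<?d. fscale (f j) (b' 1 j)) = mp V (1, 2) (\<Sum>j<?d. fscale (f j) (w j))"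
        unfolding linear_sum_fscale[OF r(3)[OF a(1)]] w(2) ..
      then have "(\<Sum>j<?d. fscale (f j) (b' 1 j)) = 0" unfolding smw rl(4)[OF a(1)] .
      then have "(\<Sum>j<chain_dim n s 1. fscale (f j) (b' 1 j)) = 0"
        using sum_extend_zero[of _ _ "b' 1" f, OF d1' c(2)[OF v(1)]] by simp
      \<comment> \<open>The arrow to 2 is used for the coefficient 0, which the arrow to
        \<open>2 * n\<close> cannot see; the latter lowers the index by one and handles all
        others.\<close>
      then have f0: "f 0 = 0" using c(6)[OF v(1)] d10 by blast
      have "(\<Sum>j<?d. fscale (f j) (case j of 0 \<Rightarrow> 0 | Suc k \<Rightarrow> b' (2 * n - 1) k))
          = mp V (1, 2 * n) (\<Sum>j<?d. fscale (f j) (w j))"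
        unfolding linear_sum_fscale[OF r(3)[OF a(2)]] w(3) ..
      then have "(\<Sum>j<?d. fscale (f j) (case j of 0 \<Rightarrow> 0 | Suc k \<Rightarrow> b' (2 * n - 1) k)) = 0"
        unfolding smw rl(4)[OF a(2)] .
      then have "(\<Sum>k<chain_dim n s (2 * n - 1). fscale (f (Suc k)) (b' (2 * n - 1) k)) = 0"
        unfolding d1 sum_fscale_Suc by simp
      then have "f (Suc k) = 0" if "k < chain_dim n s (2 * n - 1)" for k
        using c(6)[OF v(4), of "\<lambda>k. f (Suc k)"] that by blast
      then show ?thesis using f0 j d1 True by (cases j) auto
    qed
  qed
  then show ?thesis by blast
qed

text \<open>A reflection lowers \<open>s\<close> by one and preserves indecomposability as long as
  the space at 2 is nonzero, which the dimensions guarantee for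
  \<open>Suc s \<ge> 2\<close>.\<close>

lemma exists_chain:
  fixes V :: "'k rep"
  assumes "s \<ge> 1" "is_rep n V" "indecomposable n V"
    "\<And>i. i \<in> verts n \<Longrightarrow> card (sp V i) = CARD('k) ^ chain_dim n s i"
  shows "\<exists>b. is_chain n s V b"
  using assms
proof (induction s arbitrary: V rule: dec_induct)
  case base
  then show ?case by (intro chain_base)
next
  case (step s)
  note V = step.prems(1) and ind = step.prems(2) and dim = step.prems(3)
  note v = v_mem[OF n]
  have K: "CARD('k) > 1" by (rule card_gt_one_field[OF fin])
  have d2: "chain_dim n (Suc s) 2 = chain_dim n s 1" using chain_dim_Suc[of n s 1] by (simp add: numeral_2_eq_2)
  have fl: "chain_dim n s 1 = Suc (chain_dim n s (2 * n))" "chain_dim n (Suc s) 1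
      = Suc (chain_dim n (Suc s) (2 * n))"
    using chain_dim_first_last[of n s] chain_dim_first_last[of n "Suc s"] n step.hyps by simp_all
  have two: "sp V 2 \<noteq> {0}"
  proof
    assume "sp V 2 = {0}"
    then have "CARD('k) ^ Suc (chain_dim n s (2 * n)) = 1" using dim[OF v(2)] unfolding d2 fl(1) by simp
    then show False using K by simp
  qed
  have inj: "x = 0" if "x \<in> sp V 1" "mp V (1, 2) x = 0" "mp V (1, 2 * n) x = 0" for x
    by (rule indecomposable_source_injective[OF n fin V ind two that])
  let ?g = "\<lambda>v. comb (mp V (1, 2) v) (- mp V (1, 2 * n) v)"
  note rl = linear_fscaleD[OF is_repD(3)[OF fin V]]
  have g: "?g 0 = 0" "?g (x + y) = ?g x + ?g y" "?g (fscale a x) = fscale a (?g x)" for x y a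
  proof -
    note A = arrow_mem[OF n]
    show "?g 0 = 0" unfolding rl(4)[OF A(1)] rl(4)[OF A(2)] by (simp add: comb_simps)
    show "?g (x + y) = ?g x + ?g y"
      unfolding rl(1)[OF A(1)] rl(1)[OF A(2)] comb_simps(1)[symmetric] by simp
    show "?g (fscale a x) = fscale a (?g x)"
      unfolding rl(3)[OF A(1)] rl(3)[OF A(2)] comb_simps(2)[symmetric] by simp
  qed
  have "finite (?g ` sp V 1)" "fn.subspace (?g ` sp V 1)"
    using is_repD(1,2)[OF fin V v(1)] g by (auto intro!: subspace_image)
  then obtain p :: "(nat \<Rightarrow> 'k) \<Rightarrow> (nat \<Rightarrow> 'k)" where p: "Vector_Spaces.linear fscale fscale p" "\<And>z. p z = 0 \<longleftrightarrow> z
      \<in> ?g ` sp V 1"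
    using exists_linear_with_kernel[of "?g ` sp V 1"] by blast
  have "card (sp (reflect n p V) i) = CARD('k) ^ chain_dim n s i" if i: "i \<in> verts n" for i
  proof (cases "i < 2 * n")
    case True
    then have "Suc i \<in> verts n" by (simp add: verts_def)
    then show ?thesis using dim chain_dim_Suc[of n s i] reflect_simps(1)[OF n True, of p V] by simp
  next
    case False
    then have i2: "i = 2 * n" using i by (simp add: verts_def)
    have "card (sp V 2) * card (sp V (2 * n)) = card (sp V 1) * card (sp (reflect n p V) (2 * n))"
      by (rule card_reflect_last[OF n fin V inj p])
    then have "CARD('k) ^ (chain_dim n (Suc s) 2 + chain_dim n (Suc s) (2 * n)) =
        CARD('k) ^ chain_dim n (Suc s) 1 * card (sp (reflect n p V) (2 * n))"
      using dim[OF v(1)] dim[OF v(2)] dim[OF v(3)] by (simp add: power_add)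
    \<comment> \<open>Both summands on the left are related by \<open>chain_dim_first_last\<close>
      to those on the right, so the short exact sequence leaves exactly
      \<open>chain_dim n s (2 * n)\<close> for the new space.\<close>
    moreover have "chain_dim n (Suc s) 2 + chain_dim n (Suc s) (2 * n) = chain_dim n (Suc s) 1
        + chain_dim n s (2 * n)"
      using d2 fl by simp
    ultimately have "CARD('k) ^ chain_dim n (Suc s) 1 * CARD('k) ^ chain_dim n s (2 * n) =
        CARD('k) ^ chain_dim n (Suc s) 1 * card (sp (reflect n p V) (2 * n))"
      by (simp only: power_add)
    then show ?thesis using K i2 by simp
  qed
  moreover have "is_rep n (reflect n p V)" by (rule is_rep_reflect[OF n fin V inj p])
  moreover have "indecomposable n (reflect n p V)" by (rule indecomposable_reflect[OF n fin V inj p ind two])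
  ultimately obtain b' where b': "is_chain n s (reflect n p V) b'" using step.IH by blast
  show ?case by (rule chain_lift[OF V step.hyps(1) inj p b'])
qed

text \<open>The maps \<open>h i\<close> are bijective only between the given subspaces, so
  submodules are pulled back as preimages instead of along an inverse homomorphism.\<close>

lemma X_rep_isomorphic:
  fixes M :: "('b, 'k) qrep" and V :: "('c, 'k) qrep"
  assumes M: "is_rep n M" and V: "is_rep n V" and h: "is_hom n M V h"
    and bij: "\<And>i. i \<in> verts n \<Longrightarrow> bij_betw (h i) (sp M i) (sp V i)"
  shows "X_rep n q V = X_rep n q M"
proof -
  have sM: "finite (sp M i) \<and> fn.subspace (sp M i)" and sV: "finite (sp V i) \<and> fn.subspace (sp V i)"
    if "i \<in> verts n" for i
    using is_repD(1,2)[OF fin M that] is_repD(1,2)[OF fin V that] by simp_all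
  note mpM = is_repD(4)[OF fin M]
  have lin: "Vector_Spaces.linear fscale fscale (h i)" if "i \<in> verts n" for i
    using h that unfolding is_hom_def by blast
  note h' = linear_fscaleD[OF lin]
  have comm: "h j (mp M (i, j) x) = mp V (i, j) (h i x)" if "(i, j) \<in> arrows n" "x \<in> sp M i" for i j x
    using h that unfolding is_hom_def by blast
  have ar: "i \<in> verts n \<and> j \<in> verts n" if "(i, j) \<in> arrows n" for i j using arrowsD[OF _ that] n by auto
  have inj: "inj_on (h i) (sp M i)" and img: "h i ` sp M i = sp V i" if "i \<in> verts n" for i
    using bij[OF that] by (auto simp: bij_betw_def)
  define push where "push U = (\<lambda>i\<in>verts n. h i ` U i)" for U
  define pull where "pull U = (\<lambda>i\<in>verts n. sp M i \<inter> h i -` U i)" for U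
  have push: "push U \<in> subreps n V" if U: "U \<in> subreps n M" for U
  proof (rule subrepsI)
    fix i assume i: "i \<in> verts n"
    show "fn.subspace (push U i)"
      using subspace_image[OF subrepsD(2)[OF U i] h'(4,1,3)[OF i]] i by (simp add: push_def)
    show "push U i \<subseteq> sp V i" using subrepsD(3)[OF U i] img[OF i] i by (auto simp: push_def)
  next
    fix i j x assume a: "(i, j) \<in> arrows n" and x: "x \<in> push U i"
    obtain y where y: "y \<in> U i" "x = h i y" using x ar[OF a] by (auto simp: push_def)
    have "y \<in> sp M i" using y(1) subrepsD(3)[OF U, of i] ar[OF a] by blast
    then have "mp V (i, j) x = h j (mp M (i, j) y)" using comm[OF a] y(2) by simp
    then show "mp V (i, j) x \<in> push U j" using subrepsD(4)[OF U a y(1)] ar[OF a] by (simp add: push_def)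
  qed (simp add: push_def)
  have pull: "pull U \<in> subreps n M" if U: "U \<in> subreps n V" for U
  proof (rule subrepsI)
    fix i assume i: "i \<in> verts n"
    show "fn.subspace (pull U i)"
      using fn.subspace_inter[OF _ subspace_vimage[OF subrepsD(2)[OF U i] h'(4,1,3)[OF i]]] sM[OF i] i
          by (simp add: pull_def)
    show "pull U i \<subseteq> sp M i" using i by (simp add: pull_def)
  next
    fix i j x assume a: "(i, j) \<in> arrows n" and x: "x \<in> pull U i"
    have x': "x \<in> sp M i" "h i x \<in> U i" using x ar[OF a] by (auto simp: pull_def)
    then show "mp M (i, j) x \<in> pull U j"
      using mpM[OF a x'(1)] comm[OF a x'(1)] subrepsD(4)[OF U a x'(2)] ar[OF a] by (simp add: pull_def)
  qed (simp add: pull_def)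
  have "pull (push U) = U" if U: "U \<in> subreps n M" for U
  proof (rule extensionalityI[of _ "verts n"])
    fix i assume i: "i \<in> verts n"
    show "pull (push U) i = U i"
      using inj_on_image_mem_iff[OF inj[OF i] _ subrepsD(3)[OF U i]] subrepsD(3)[OF U i] i
      by (auto simp: pull_def push_def)
  qed (use subrepsD(1)[OF U] in \<open>auto simp: pull_def\<close>)
  moreover have "push (pull U) = U" if U: "U \<in> subreps n V" for U
  proof (rule extensionalityI[of _ "verts n"])
    fix i assume i: "i \<in> verts n"
    have "U i \<subseteq> h i ` sp M i" using subrepsD(3)[OF U i] img[OF i] by simp
    then show "push (pull U) i = U i" using i by (auto simp: pull_def push_def)
  qed (use subrepsD(1)[OF U] in \<open>auto simp: push_def\<close>)
  ultimately have bijU: "bij_betw push (subreps n M) (subreps n V)"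
    using push pull by (intro bij_betwI[where g = pull]) auto
  have dim_eq: "fn.dim (h i ` A) = fn.dim A" if i: "i \<in> verts n" and A: "A \<subseteq> sp M i" "fn.subspace A" for i A
  proof -
    have fA: "finite A" using A(1) sM[OF i] finite_subset by blast
    have "card (h i ` A) = card A" using card_image[OF inj_on_subset[OF inj[OF i] A(1)]] .
    then show ?thesis
      using dim_eq_iff_card[OF fin subspace_image[OF A(2) h'(4,1,3)[OF i]] _ A(2) fA, where j = 0] fA by simp
  qed
  have dims: "dim_family n (push U) = dim_family n U" if U: "U \<in> subreps n M" for U
    using dim_eq[OF _ subrepsD(3)[OF U] subrepsD(2)[OF U]] by (auto simp: dim_family_def push_def fun_eq_iff)
  have dv: "dimvec n V = dimvec n M"
    using dim_eq[OF _ subset_refl] sM img by (auto simp: dimvec_def dim_family_def fun_eq_iff)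
  have "(\<Sum>U\<in>subreps n V. qterm n q (dimvec n V) (dim_family n U)) =
      (\<Sum>U\<in>subreps n M. qterm n q (dimvec n V) (dim_family n (push U)))"
    by (rule sum.reindex_bij_betw[OF bijU, symmetric])
  also have "\<dots> = (\<Sum>U\<in>subreps n M. qterm n q (dimvec n M) (dim_family n U))"
    by (intro sum.cong refl) (simp add: dims dv)
  also have "\<dots> = X_rep n q M" by (rule X_rep_eq[OF fin, symmetric]) (rule sM)
  also have "(\<Sum>U\<in>subreps n V. qterm n q (dimvec n V) (dim_family n U)) = X_rep n q V"
    by (rule X_rep_eq[OF fin, symmetric]) (rule sV)
  finally show ?thesis .
qed

end

section \<open>Identifying the representations of the statement with the models\<close>

context
  fixes n :: nat
  assumes n: "n \<ge> 2" and fin: "finite (UNIV :: 'k::field set)"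
begin

lemma is_rep_model: "is_rep n (model n l :: 'k rep)"
proof -
  have "Vector_Spaces.linear fscale fscale (mp (model n l :: 'k rep) (i, j))" for i j
    by (auto simp: model_def linear_fscale_iff)
  moreover have "mp (model n l) (i, j) x \<in> sp (model n l :: 'k rep) j"
    if "(i, j) \<in> arrows n" "x \<in> sp (model n l :: 'k rep) i" for i j x
    using that n by (auto simp: model_def supp_below_def shift_def trunc_def arrows_def split: if_splits)
  moreover have "finite (sp (model n l :: 'k rep) i) \<and> fn.subspace (sp (model n l :: 'k rep) i)" for i
    by (simp add: model_def finite_supp_below(1)[OF fin])
  ultimately show ?thesis
    unfolding is_rep_iff[OF fin] image_subset_iff by blast
qed

text \<open>I_{2n-1} is the member with index \<open>2 * n - 1\<close> of the preinjective sequence,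
  and \<open>2 * n - 1\<close> further steps add \<open>delta n\<close> to the dimension
  vector.\<close>

lemma chain_dim_model:
  assumes "i \<in> verts n"
  shows "chain_dim n ((2 * n - 1) * Suc l) i = model_dim n l i"
proof -
  define L where "L = 2 * n - 1"
  have L: "L > 0" "2 * n = Suc L" using n by (auto simp: L_def)
  show ?thesis
  proof (cases "i < 2 * n")
    case True
    then have e: "L * Suc l + L - i = (L - i) + L * Suc l" and "L - i < L" using assms L
        by (auto simp: verts_def)
    then have "(L * Suc l + L - i) div L = Suc l" unfolding e using L by (subst div_mult_self2) simp_all
    then show ?thesis using True by (simp add: chain_dim_def model_dim_def L_def)
  next
    case False
    then have i: "i = Suc L" using assms L by (simp add: verts_def)
    have e: "L * Suc l + L - i = (L - 1) + L * l" and "L - 1 < L" using L i by auto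
    then have "(L * Suc l + L - i) div L = l" unfolding e using L by (subst div_mult_self2) simp_all
    then show ?thesis using False by (simp add: chain_dim_def model_dim_def L_def)
  qed
qed

text \<open>Sending the basis vectors of the model to the chain is a homomorphism. It is injective
  by independence and onto because both spaces have the same number of elements.\<close>

lemma X_rep_chain:
  fixes V :: "'k rep"
  assumes V: "is_rep n V" and b: "is_chain n ((2 * n - 1) * Suc l) V b"
    and dim: "\<And>i. i \<in> verts n \<Longrightarrow> card (sp V i) = CARD('k) ^ model_dim n l i"
  shows "X_rep n q V = X_rep n q (model n l :: 'k rep)"
proof -
  let ?M = "model n l :: 'k rep"
  define h where "h i f = (\<Sum>j<model_dim n l i. fscale (f j) (b i j))" for i and f :: "nat \<Rightarrow> 'k"
  note c = is_chainD[OF n fin b] and cd = chain_dim_model[of _ l] and r = is_repD[OF fin V]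
  have lin: "Vector_Spaces.linear fscale fscale (h i)" for i
    by (simp add: linear_fscale_iff h_def fn.scale_left_distrib sum.distrib fn.scale_sum_right)
      (simp add: fscale_def)
  have spM: "sp ?M i = supp_below (model_dim n l i)" for i by (simp add: model_def model_dim_def)
  have hV: "h i f \<in> sp V i" if "i \<in> verts n" for i f
    unfolding h_def using r(2)[OF that] c(1)[OF that] by (intro fn.subspace_sum fn.subspace_scale)
  have bij: "bij_betw (h i) (sp ?M i) (sp V i)" if i: "i \<in> verts n" for i
    unfolding bij_betw_def
  proof
    show inj: "inj_on (h i) (sp ?M i)"
    proof (rule inj_onI)
      fix x y assume xy: "x \<in> sp ?M i" "y \<in> sp ?M i" "h i x = h i y"
      have "h i (x - y) = 0" using xy(3) linear_fscaleD(2)[OF lin] by simp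
      then have "(x - y) j = 0" if "j < model_dim n l i" for j
        using c(6)[OF i, of "x - y" j] that unfolding cd[OF i] h_def by blast
      moreover have "x j = 0" "y j = 0" if "model_dim n l i \<le> j" for j
        using xy(1,2) that by (auto simp: spM supp_below_def)
      ultimately have "x j = y j" for j by (cases "j < model_dim n l i") auto
      then show "x = y" by blast
    qed
    have "card (h i ` sp ?M i) = card (sp V i)"
      using card_image[OF inj] dim[OF i] finite_supp_below(2)[OF fin, of "model_dim n l i"] by (simp add: spM)
    then show "h i ` sp ?M i = sp V i" using hV[OF i] r(1)[OF i] by (intro card_subset_eq) auto
  qed
  have comm: "h j (mp ?M (i, j) x) = mp V (i, j) (h i x)" if a: "(i, j) \<in> arrows n" and x: "x \<in> sp ?M i"
      for i j x
  proof -
    have ij: "i \<in> verts n" "j \<in> verts n" using arrowsD[OF _ a] n by auto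
    have push: "mp V (i, j) (h i x) = (\<Sum>t<model_dim n l i. fscale (x t) (mp V (i, j) (b i t)))"
      unfolding h_def by (rule linear_sum_fscale[OF r(3)[OF a]])
    consider "i = 1" "j = 2 * n" | "i = 2 * n - 1" "j = 2 * n" "i \<noteq> 1" | "1 \<le> i" "i < 2 * n - 1" "j = Suc i"
      using reflect_arrow_cases[OF n a] n by (metis One_nat_def)
    then show ?thesis
    proof cases
      case 1
      have d: "model_dim n l 1 = Suc l" "model_dim n l (2 * n) = l" using n by (simp_all add: model_dim_def)
      have "mp V (1, 2 * n) (h 1 x) = (\<Sum>t<l. fscale (x (Suc t)) (b (2 * n) t))"
        using push unfolding 1 d sum_fscale_Suc c(4) c(5) by simp
      moreover have "h (2 * n) (mp ?M (1, 2 * n) x) = (\<Sum>t<l. fscale (x (Suc t)) (b (2 * n) t))"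
        unfolding h_def d by (simp add: model_def shift_def)
      ultimately show ?thesis unfolding 1 by simp
    next
      case 2
      have d: "model_dim n l i = Suc l" "model_dim n l (2 * n) = l" using n 2 by (simp_all add: model_dim_def)
      have e: "Suc i = 2 * n" "i < 2 * n" using 2 n by simp_all
      have m: "mp V (i, 2 * n) (b i t) = b (2 * n) t" for t using c(3)[OF ij(1) e(2)] unfolding e(1) .
      have "chain_dim n ((2 * n - 1) * Suc l) (2 * n) \<le> l" using cd[OF ij(2)] d(2) unfolding 2 by simp
      \<comment> \<open>The chain has no vector with index \<open>l\<close> at the sink, in
        accordance with \<open>trunc l\<close> in the model.\<close>
      then have z: "b (2 * n) l = 0" using c(2)[OF ij(2)[unfolded 2(2)], of l] by blast
      have "mp V (i, 2 * n) (h i x) = (\<Sum>t<l. fscale (x t) (b (2 * n) t))"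
        using push unfolding d m 2(2) by (simp add: z)
      moreover have "h (2 * n) (mp ?M (i, 2 * n) x) = (\<Sum>t<l. fscale (x t) (b (2 * n) t))"
        unfolding h_def d using 2 by (simp add: model_def trunc_def)
      ultimately show ?thesis unfolding 2(2) by simp
    next
      case 3
      have d: "model_dim n l i = Suc l" "model_dim n l (Suc i) = Suc l" using 3 by (simp_all add: model_dim_def)
      have m: "mp V (i, Suc i) (b i t) = b (Suc i) t" for t using c(3)[OF ij(1)] 3 by simp
      have "mp ?M (i, Suc i) x = x" using 3 by (auto simp: model_def)
      then show ?thesis using push unfolding 3(3) d m h_def by simp
    qed
  qed
  have mpM: "is_hom n ?M V h"
    unfolding is_hom_def using lin hV comm by auto
  show ?thesis by (rule X_rep_isomorphic[OF n fin is_rep_model V mpM bij])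
qed

lemma X_rep_is_N2n:
  fixes N :: "'k rep"
  assumes "is_N2n n l N"
  shows "X_rep n q N = X_rep n q (model n l :: 'k rep)"
proof -
  have N: "is_rep n N" "indecomposable n N"
    and dv: "dimvec n N = (\<lambda>i. dimvec n (inj_rep n (2 * n - 1) :: (nat list, 'k) qrep) i + int l * delta n i)"
    using assms unfolding is_N2n_def by blast+
  have dim: "card (sp N i) = CARD('k) ^ model_dim n l i" if i: "i \<in> verts n" for i
  proof -
    have "int (fn.dim (sp N i)) = dimvec n N i" using i by (simp add: dimvec_def dim_family_def)
    also have "\<dots> = int (model_dim n l i)"
      unfolding dv X_rep_inj_rep(2)[OF n fin] using i n
          by (auto simp: delta_def tail_def model_dim_def verts_def)
    finally show ?thesis using fn.card_subspace[OF fin is_repD(1,2)[OF fin N(1) i]] by simp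
  qed
  have "(2 * n - 1) * Suc l \<ge> 1" using n by simp
  then obtain b where "is_chain n ((2 * n - 1) * Suc l) N b"
    using exists_chain[OF n fin _ N] dim chain_dim_model by metis
  then show ?thesis by (rule X_rep_chain[OF N(1) _ dim])
qed

text \<open>Both representations have lines at the vertices before the sink, joined by isomorphisms,
  so \<open>X_rep_thin\<close> gives the same expansion for both.\<close>

lemma X_rep_inj_rep_model:
  "X_rep n q (inj_rep n (2 * n - 1) :: (nat list, 'k) qrep) = X_rep n q (model n 0 :: 'k rep)"
proof -
  have n1: "n \<ge> 1" and p: "2 * n - 1 \<le> 2 * n" using n by simp_all
  have sp: "sp (model n 0 :: 'k rep) i = (if i \<le> 2 * n - 1 then range (\<lambda>a. fscale a unit0) else {0})"
    if "i \<in> verts n" for i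
  proof -
    have "supp_below (Suc 0) = range (\<lambda>a. fscale a unit0 :: nat \<Rightarrow> 'k)" by (rule supp_below_1)
    moreover have "supp_below 0 = {0 :: nat \<Rightarrow> 'k}" by (auto simp: supp_below_def)
    moreover have "i < 2 * n \<longleftrightarrow> i \<le> 2 * n - 1" using n by auto
    ultimately show ?thesis by (simp add: model_def)
  qed
  have step: "mp (model n 0 :: 'k rep) (i, Suc i) unit0 = unit0" if "i < 2 * n - 1" for i
    using that by (auto simp: model_def)
  have lin: "mp (model n 0 :: 'k rep) (i, j) (fscale a x) = fscale a (mp (model n 0) (i, j) x)" for i j a x
    by (simp add: model_def)
  show ?thesis
    unfolding X_rep_inj_rep(1)[OF n fin]
    by (rule X_rep_thin[where b = "\<lambda>_. unit0", OF n1 p fin sp _ step lin is_repD(4)[OF fin is_rep_model], symmetric]) simp_all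
qed

end

theorem lemma3p7:
  fixes n q :: nat
    and \<iota> :: "'f::{field, finite} \<Rightarrow> 'k::field"
    and c :: 'k
  assumes "n \<ge> 2"
    and "q = CARD('f)"
    and "degree2_extension \<iota>"
  shows "qt_mult n q (X_shift n q (proj_rep n (2 * n) :: (nat list, 'k) qrep)) (X_rep n q (E_rep n c)) =
           qt_scale (real q powr (1 / 2)) (X_rep n q (inj_rep n (2 * n - 1) :: (nat list, 'k) qrep)) +
           qt_scale (real q powr (- 1 / 2)) (X_shift n q (proj_rep n 1 :: (nat list, 'k) qrep)) \<and>
         (\<forall>N1 :: (nat, 'k) qrep. is_N2n n 1 N1 \<longrightarrow>
           qt_mult n q (X_rep n q (inj_rep n (2 * n - 1) :: (nat list, 'k) qrep)) (X_rep n q (E_rep n c)) =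
           qt_scale (real q powr (1 / 2)) (X_rep n q N1) +
           qt_scale (real q powr (- 1 / 2)) (X_shift n q (proj_rep n (2 * n) :: (nat list, 'k) qrep))) \<and>
         (\<forall>l\<ge>1. \<forall>(N :: (nat, 'k) qrep) (N_next :: (nat, 'k) qrep) (N_prev :: (nat, 'k) qrep).
           is_N2n n l N \<longrightarrow> is_N2n n (l + 1) N_next \<longrightarrow> is_N2n n (l - 1) N_prev \<longrightarrow>
           qt_mult n q (X_rep n q N) (X_rep n q (E_rep n c)) =
           qt_scale (real q powr (1 / 2)) (X_rep n q N_next) +
           qt_scale (real q powr (- 1 / 2)) (X_rep n q N_prev))"
proof -
  have fin: "finite (UNIV :: 'k set)" and card: "CARD('k) = q ^ 2"
    using degree2_extension_card[OF assms(3)] assms(2) by simp_all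
  have n1: "n \<ge> 1" and v: "1 \<in> verts n" "2 * n \<in> verts n" using assms(1) by (auto simp: verts_def)
  have q: "q > 0" by (rule q_pos[OF assms(1) fin card])
  have "(\<lambda>j. of_bool (j = 2 * n)) = tail n (2 * n - 1)"
    using n1 by (auto simp: tail_def verts_def fun_eq_iff)
  then have P: "X_shift n q (proj_rep n (2 * n) :: (nat list, 'k) qrep) = Poly_Mapping.single (tail n (2 * n - 1)) 1"
    "X_shift n q (proj_rep n 1 :: (nat list, 'k) qrep) = Poly_Mapping.single (\<lambda>j. of_bool (j = 1)) 1"
    unfolding X_shift_eq[OF n1 q] dim_top_proj_rep[OF n1 v(1)] dim_top_proj_rep[OF n1 v(2)] by simp_all
  note N = X_rep_is_N2n[OF assms(1) fin]
  show ?thesis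
  proof (intro conjI allI impI)
    show "qt_mult n q (X_shift n q (proj_rep n (2 * n) :: (nat list, 'k) qrep)) (X_rep n q (E_rep n c)) =
           qt_scale (real q powr (1 / 2)) (X_rep n q (inj_rep n (2 * n - 1) :: (nat list, 'k) qrep)) +
           qt_scale (real q powr (- 1 / 2)) (X_shift n q (proj_rep n 1 :: (nat list, 'k) qrep))"
      unfolding P by (rule X_last_mult_E_rep[OF assms(1) fin card])
  next
    fix N1 :: "(nat, 'k) qrep" assume "is_N2n n 1 N1"
    then have "X_rep n q N1 = X_rep n q (model n (Suc 0) :: (nat, 'k) qrep)" using N by simp
    then show "qt_mult n q (X_rep n q (inj_rep n (2 * n - 1) :: (nat list, 'k) qrep)) (X_rep n q (E_rep n c)) =
           qt_scale (real q powr (1 / 2)) (X_rep n q N1) +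
           qt_scale (real q powr (- 1 / 2)) (X_shift n q (proj_rep n (2 * n) :: (nat list, 'k) qrep))"
      unfolding P X_rep_inj_rep_model[OF assms(1) fin] using X_model_0_mult_E_rep[OF assms(1) fin card] by simp
  next
    fix l :: nat and N N_next N_prev :: "(nat, 'k) qrep"
    assume l: "1 \<le> l" and "is_N2n n l N" "is_N2n n (l + 1) N_next" "is_N2n n (l - 1) N_prev"
    \<comment> \<open>With \<open>l = Suc l'\<close> the natural subtraction in \<open>l - 1\<close>
      becomes \<open>l'\<close>.\<close>
    moreover obtain l' where "l = Suc l'" using l by (cases l) auto
    ultimately have "X_rep n q N = X_rep n q (model n (Suc l') :: (nat, 'k) qrep)"
      "X_rep n q N_next = X_rep n q (model n (Suc (Suc l')) :: (nat, 'k) qrep)"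
      "X_rep n q N_prev = X_rep n q (model n l' :: (nat, 'k) qrep)" using N by simp_all
    then show "qt_mult n q (X_rep n q N) (X_rep n q (E_rep n c)) =
           qt_scale (real q powr (1 / 2)) (X_rep n q N_next) +
           qt_scale (real q powr (- 1 / 2)) (X_rep n q N_prev)"
      using X_model_Suc_mult_E_rep[OF assms(1) fin card] by simp
  qed
qed

end
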